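(* There exist $\varepsilon>0$ (in fact $\varepsilon=1/18$ works) and $n_0\in\mathbb{N}$ such that if $T$ is a tournament on $n>n_0$ vertices with $n$ even and $\mathrm{ex}(T)\ge n^{2-\varepsilon}$, then $\mathrm{pn}(T)=\mathrm{ex}(T)$.
   Context: A tournament is an orientation of a complete graph. Paths are directed paths. For a digraph $D$ and vertex $v$, $\mathrm{ex}_D(v)=d^+_D(v)-d^-_D(v)$ (out-degree minus in-degree), $\mathrm{ex}^+_D(v)=\max\{\mathrm{ex}_D(v),0\}$, and $\mathrm{ex}(D)=\sum_{v}\mathrm{ex}^+_D(v)$. The path number $\mathrm{pn}(D)$ is the minimum number of paths in a collection of paths of $D$ whose edge sets partition $E(D)$. *)

theory Defs
  imports Complex_Main "HOL-Library.Disjoint_Sets" "Graph_Theory.Arc_Walk"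
begin

locale tournament = digraph +
  assumes one_orientation:
    "\<lbrakk>u \<in> verts G; v \<in> verts G; u \<noteq> v\<rbrakk> \<Longrightarrow> (u \<rightarrow> v) \<longleftrightarrow> \<not> (v \<rightarrow> u)"

definition vertex_excess :: "('a, 'b) pre_digraph \<Rightarrow> 'a \<Rightarrow> int" where
  "vertex_excess D v = int (out_degree D v) - int (in_degree D v)"

definition pos_vertex_excess :: "('a, 'b) pre_digraph \<Rightarrow> 'a \<Rightarrow> int" where
  "pos_vertex_excess D v = max (vertex_excess D v) 0"

definition excess :: "('a, 'b) pre_digraph \<Rightarrow> int" where
  "excess D = (\<Sum>v \<in> verts D. pos_vertex_excess D v)"

text \<open>
  Paths are lists of arcs. Parts of a partition are nonempty, so the paths below have at
  least one arc; this does not affect the minimum number of paths, and a digraph without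
  arcs has path number 0. Injectivity says that two members of the collection never account
  for the same part.
\<close>
definition path_decomposition :: "('a, 'b) pre_digraph \<Rightarrow> 'b list set \<Rightarrow> bool" where
  "path_decomposition D P \<longleftrightarrow>
     finite P \<and> (\<forall>p \<in> P. \<exists>u v. pre_digraph.apath D u p v) \<and>
     inj_on set P \<and> partition_on (arcs D) (set ` P)"

definition path_number :: "('a, 'b) pre_digraph \<Rightarrow> nat" where
  "path_number D = (LEAST k. \<exists>P. path_decomposition D P \<and> card P = k)"

text \<open>The minimum is taken over a nonempty set of numbers.\<close>
lemma (in digraph) path_decomposition_singletons:
  "path_decomposition G ((\<lambda>e. [e]) ` arcs G)"
  unfolding path_decomposition_def
proof (intro conjI)
  show "\<forall>p \<in> (\<lambda>e. [e]) ` arcs G. \<exists>u v. apath u p v"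
  proof
    fix p assume "p \<in> (\<lambda>e. [e]) ` arcs G"
    then obtain e where "e \<in> arcs G" "p = [e]" by blast
    then have "apath (tail G e) p (head G e)"
      by (simp add: apath_def awalk_def no_loops)
    then show "\<exists>u v. apath u p v" by blast
  qed
  show "inj_on set ((\<lambda>e. [e]) ` arcs G)"
    by (auto simp: inj_on_def)
  show "partition_on (arcs G) (set ` (\<lambda>e. [e]) ` arcs G)"
    by (auto simp: partition_on_def disjoint_def)
qed simp

lemma (in digraph) path_number_attained:
  "\<exists>P. path_decomposition G P \<and> card P = path_number G"
  unfolding path_number_def
  by (rule LeastI_ex) (use path_decomposition_singletons in blast)

end

theory Submission
  imports Defs "HOL-Real_Asymp.Real_Asymp"
begin

text \<open>
  It suffices to decompose the arcs into paths that start at vertices of nonnegative excess and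
  end at vertices of negative excess, since the number of starts minus the number of ends at a
  vertex is its excess. Let \<open>U\<close> and \<open>U'\<close> be the sets of vertices of excess above \<open>r\<close> and below
  \<open>- r\<close>, where \<open>r\<close> is about \<open>n powr (17/18)\<close>; both have at least \<open>5 r\<close> elements.

  Every vertex reaches \<open>U'\<close>, and is reached from \<open>U\<close>, robustly along short paths. So one can
  greedily reserve for every vertex \<open>w\<close> many short paths from \<open>U\<close> through \<open>w\<close> to \<open>U'\<close>, all
  arc-disjoint and, for a fixed \<open>w\<close>, meeting only in \<open>w\<close>. Colour the vertices randomly with
  \<open>k\<close> colours. A decomposition of the complete digraph on the colours into Hamilton paths splits
  the unreserved arcs into acyclic classes, and these decompose into short paths with few ends at
  every vertex beyond those forced by the excess. A path that ends and a path that starts at the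
  wrong kind of vertex \<open>w\<close> are finally crossed with a reserved path through \<open>w\<close>.
\<close>

section \<open>Paths, excess and path decompositions\<close>

text \<open>The exponents come from a conflict between two demands. The colouring is controlled only
  up to a deviation \<open>t\<close> slightly above the square root of \<open>n\<close>, so the
  \<open>k\<close> classes can leave about \<open>t * k\<close> wrong ends at a vertex, and the one
  class whose Hamilton path stops at the colour of that vertex leaves about \<open>n / k\<close>
  more. The best balance, \<open>k\<close> near \<open>n powr (1/4)\<close>, still needs somewhat
  more than \<open>n powr (3/4)\<close> reserved paths at every vertex. These paths have length
  about \<open>n / r\<close>, and together they may put a load of at most about \<open>r\<close> on
  each vertex: otherwise the greedy reservation gets stuck, or deleting the reserved arcs changes
  the sign of an excess. Avoiding the overloaded vertices then requires
  \<open>n * n powr (3/4) * (n / r)\<close> to be of order at most \<open>r ^ 2\<close>, so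
  \<open>r\<close> must exceed \<open>n powr (11/12)\<close>. The value 1/18, being smaller than
  1/12, leaves room for roundings and constants. Shortness matters once more at the end: the
  reserved paths at \<open>w\<close> are disjoint off \<open>w\<close>, so each vertex to be avoided
  in a crossing spoils at most one of them.\<close>

definition path_edges :: "'a list \<Rightarrow> ('a \<times> 'a) set" where
  "path_edges p = set (zip p (tl p))"

lemma path_edges_simps [simp]:
  "path_edges [] = {}" "path_edges [x] = {}"
  "path_edges (x # y # p) = insert (x, y) (path_edges (y # p))"
  by (auto simp: path_edges_def)

lemma finite_path_edges [simp]: "finite (path_edges p)"
  by (simp add: path_edges_def)

lemma path_edges_join:
  "p \<noteq> [] \<Longrightarrow> q \<noteq> [] \<Longrightarrow> last p = hd q \<Longrightarrow> path_edges (p @ tl q) = path_edges p \<union> path_edges q"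
proof (induction p rule: induct_list012)
  case (2 x) then show ?case by (cases q) auto
qed auto

lemma path_edges_rev: "path_edges (rev p) = (path_edges p)\<inverse>"
proof (induction p rule: induct_list012)
  case (3 x y zs)
  have "path_edges (rev (y # zs) @ tl [y, x]) = path_edges (rev (y # zs)) \<union> path_edges [y, x]"
    by (rule path_edges_join) (auto simp: last_rev)
  then show ?case using 3 by auto
qed auto

lemma path_edges_verts: "(x, y) \<in> path_edges p \<Longrightarrow> x \<in> set p \<and> y \<in> set p"
  by (induction p rule: induct_list012) auto

lemma path_edges_nonempty: "2 \<le> length p \<Longrightarrow> path_edges p \<noteq> {}"
  by (induction p rule: induct_list012) auto

lemma path_edges_not_hd: "distinct p \<Longrightarrow> (x, y) \<in> path_edges p \<Longrightarrow> y \<noteq> hd p"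
  by (induction p rule: induct_list012) (auto dest: path_edges_verts)

section \<open>Degrees and excess of a set of arcs\<close>

definition outs :: "('a \<times> 'a) set \<Rightarrow> 'a \<Rightarrow> 'a set" where "outs E v = {y. (v, y) \<in> E}"
definition ins :: "('a \<times> 'a) set \<Rightarrow> 'a \<Rightarrow> 'a set" where "ins E v = {x. (x, v) \<in> E}"
text \<open>A function of a bare set of pairs, so that it applies alike to the tournament, to the
  reserved arcs, to the arcs they leave, to a single class and to a converse relation.\<close>

definition arc_excess :: "('a \<times> 'a) set \<Rightarrow> 'a \<Rightarrow> int" where
  "arc_excess E v = int (card (outs E v)) - int (card (ins E v))"

lemma finite_outs_ins [simp, intro]: "finite E \<Longrightarrow> finite (outs E v)" "finite E \<Longrightarrow> finite (ins E v)"
proof -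
  assume "finite E"
  have "outs E v \<subseteq> snd ` E" "ins E v \<subseteq> fst ` E" by (force simp: outs_def ins_def)+
  then show "finite (outs E v)" "finite (ins E v)" using \<open>finite E\<close> finite_surj finite_subset by blast+
qed

lemma ins_converse: "ins (E\<inverse>) v = outs E v" and outs_converse: "outs (E\<inverse>) v = ins E v"
  by (auto simp: ins_def outs_def)

lemma arc_excess_converse: "arc_excess (E\<inverse>) v = - arc_excess E v"
  by (simp add: arc_excess_def ins_converse outs_converse)

lemma outs_path: "distinct p \<Longrightarrow> v \<in> set (butlast p) \<Longrightarrow> \<exists>y. outs (path_edges p) v = {y}"
proof (induction p rule: induct_list012)
  case (3 x y zs)
  show ?case
  proof (cases "v = x")
    case True
    then have "outs (path_edges (x # y # zs)) v = {y}"
      using 3 by (auto simp: outs_def dest: path_edges_verts)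
    then show ?thesis by blast
  next
    case False
    then have "outs (path_edges (x # y # zs)) v = outs (path_edges (y # zs)) v"
      by (auto simp: outs_def)
    then show ?thesis using 3 False by auto
  qed
qed auto

lemma outs_path_empty: "distinct p \<Longrightarrow> v \<notin> set (butlast p) \<Longrightarrow> outs (path_edges p) v = {}"
proof (induction p rule: induct_list012)
  case (3 x y zs)
  then have "outs (path_edges (x # y # zs)) v = outs (path_edges (y # zs)) v"
      by (auto simp: outs_def split: if_splits)
  then show ?case using 3 by (auto split: if_splits)
qed (auto simp: outs_def)

lemma card_outs_path:
  assumes "distinct p" "p \<noteq> []"
  shows "card (outs (path_edges p) v) = of_bool (v \<in> set p \<and> v \<noteq> last p)"
proof -
  have "v \<in> set (butlast p) \<longleftrightarrow> v \<in> set p \<and> v \<noteq> last p"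
    using assms by (metis append_butlast_last_id distinct_append distinct.simps(2) UnE UnI1
        empty_iff empty_set list.set_intros(1) not_distinct_conv_prefix set_ConsD set_append)
  then show ?thesis using outs_path[OF assms(1), of v] outs_path_empty[OF assms(1), of v] by auto
qed

lemma card_ins_path:
  assumes "distinct p" "p \<noteq> []"
  shows "card (ins (path_edges p) v) = of_bool (v \<in> set p \<and> v \<noteq> hd p)"
  using card_outs_path[of "rev p" v] assms by (simp add: path_edges_rev outs_converse last_rev)

lemma arc_excess_path:
  assumes "distinct p" "p \<noteq> []"
  shows "arc_excess (path_edges p) v = of_bool (hd p = v) - of_bool (last p = v)"
  using assms card_outs_path[OF assms, of v] card_ins_path[OF assms, of v] by (auto simp:
      arc_excess_def)

lemma card_outs_UN:
  assumes "finite I" "\<And>i. i \<in> I \<Longrightarrow> finite (F i)" "\<And>i j. i \<in> I \<Longrightarrow> j \<in> I \<Longrightarrow> i \<noteq> j \<Longrightarrow> F i \<inter> F j = {}"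
  shows "card (outs (\<Union>i\<in>I. F i) v) = (\<Sum>i\<in>I. card (outs (F i) v))"
proof -
  have "outs (\<Union>i\<in>I. F i) v = (\<Union>i\<in>I. outs (F i) v)" by (auto simp: outs_def)
  moreover have "outs (F i) v \<inter> outs (F j) v = {}" if "i \<in> I" "j \<in> I" "i \<noteq> j" for i j
    using assms(3)[OF that] by (auto simp: outs_def)
  ultimately show ?thesis
    using assms(1,2) by (simp add: card_UN_disjoint)
qed

lemma card_ins_UN:
  assumes "finite I" "\<And>i. i \<in> I \<Longrightarrow> finite (F i)" "\<And>i j. i \<in> I \<Longrightarrow> j \<in> I \<Longrightarrow> i \<noteq> j \<Longrightarrow> F i \<inter> F j = {}"
  shows "card (ins (\<Union>i\<in>I. F i) v) = (\<Sum>i\<in>I. card (ins (F i) v))"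
proof -
  have "card (outs (\<Union>i\<in>I. (F i)\<inverse>) v) = (\<Sum>i\<in>I. card (outs ((F i)\<inverse>) v))"
    by (rule card_outs_UN) (use assms in auto)
  then show ?thesis by (simp add: outs_converse flip: converse_UNION)
qed

lemma arc_excess_UN:
  assumes "finite I" "\<And>i. i \<in> I \<Longrightarrow> finite (F i)" "\<And>i j. i \<in> I \<Longrightarrow> j \<in> I \<Longrightarrow> i \<noteq> j \<Longrightarrow> F i \<inter> F j = {}"
  shows "arc_excess (\<Union>i\<in>I. F i) v = (\<Sum>i\<in>I. arc_excess (F i) v)"
  using card_outs_UN[of I F v] card_ins_UN[of I F v] assms by (simp add: arc_excess_def sum_subtractf)

section \<open>Path decompositions of arc sets\<close>

definition simple_path :: "'a list \<Rightarrow> bool" where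
  "simple_path p \<longleftrightarrow> distinct p \<and> 2 \<le> length p"

text \<open>A set of vertex lists is enough because \<open>simple_path\<close> demands an arc:
  different members are kept apart by their disjoint nonempty arc sets, and no trivial path inflates
  \<open>card Q\<close>.\<close>

definition path_dec :: "('a \<times> 'a) set \<Rightarrow> 'a list set \<Rightarrow> bool" where
  "path_dec E Q \<longleftrightarrow> finite Q \<and> (\<forall>q\<in>Q. simple_path q) \<and> (\<Union>q\<in>Q. path_edges q) = E \<and>
     (\<forall>q\<in>Q. \<forall>q'\<in>Q. q \<noteq> q' \<longrightarrow> path_edges q \<inter> path_edges q' = {})"

lemma simple_path_ne [simp]: "simple_path p \<Longrightarrow> p \<noteq> []" by (auto simp: simple_path_def)

lemma simple_path_hd_last: "simple_path p \<Longrightarrow> hd p \<noteq> last p"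
  by (cases p) (auto simp: simple_path_def Suc_le_eq)

text \<open>An inner vertex of a path has one arc in and one arc out, so each path contributes to
  the excess only at its two ends.\<close>

lemma path_dec_arc_excess:
  assumes "path_dec E Q"
  shows "arc_excess E v = int (card {q\<in>Q. hd q = v}) - int (card {q\<in>Q. last q = v})"
proof -
  have fin: "finite Q" using assms by (simp add: path_dec_def)
  have "arc_excess E v = (\<Sum>q\<in>Q. arc_excess (path_edges q) v)"
    using assms arc_excess_UN[of Q path_edges v] by (auto simp: path_dec_def)
  also have "\<dots> = (\<Sum>q\<in>Q. of_bool (hd q = v) - of_bool (last q = v))"
  proof (intro sum.cong refl arc_excess_path)
    fix q assume "q \<in> Q"
    then have "simple_path q" using assms by (simp add: path_dec_def)
    then show "distinct q" "q \<noteq> []" by (auto simp: simple_path_def)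
  qed
  also have "\<dots> = int (card {q\<in>Q. hd q = v}) - int (card {q\<in>Q. last q = v})"
    using fin by (simp add: sum_subtractf of_bool_def sum.If_cases Int_def)
  finally show ?thesis .
qed

lemma path_dec_UN:
  assumes "finite I" "\<And>i. i \<in> I \<Longrightarrow> simple_path (p i)"
    "\<And>i j. i \<in> I \<Longrightarrow> j \<in> I \<Longrightarrow> i \<noteq> j \<Longrightarrow> path_edges (p i) \<inter> path_edges (p j) = {}"
    "(\<Union>i\<in>I. path_edges (p i)) = E"
  shows "path_dec E (p ` I)"
  using assms unfolding path_dec_def by (auto; blast)

section \<open>Decomposing acyclic classes into paths\<close>

text \<open>A potential that rises along every arc certifies that a walk is a path and bounds its
  length. The potentials used later are positions on a Hamilton path and ranks.\<close>

lemma increasing_path: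
  fixes f :: "'a \<Rightarrow> nat"
  shows "(\<And>x y. (x, y) \<in> path_edges p \<Longrightarrow> f x < f y) \<Longrightarrow> sorted_wrt (<) (map f p)"
proof (induction p rule: induct_list012)
  case (3 x y zs)
  have "sorted_wrt (<) (map f (y # zs))" by (rule "3.IH"(2)) (use 3(3) in auto)
  moreover have "f x < f y" using 3(3) by auto
  ultimately show ?case by auto
qed auto

lemma increasing_path_distinct:
  fixes f :: "'a \<Rightarrow> nat"
  assumes "\<And>x y. (x, y) \<in> path_edges p \<Longrightarrow> f x < f y"
  shows "distinct p"
  using increasing_path[of p f, OF assms] by (simp add: strict_sorted_iff distinct_map)

lemma increasing_path_length:
  fixes f :: "'a \<Rightarrow> nat"
  assumes "\<And>x y. (x, y) \<in> path_edges p \<Longrightarrow> f x < f y" "\<And>x. x \<in> set p \<Longrightarrow> f x \<le> l"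
  shows "length p \<le> l + 1"
proof -
  have "distinct (map f p)" using increasing_path[of p f, OF assms(1)] by (simp add: strict_sorted_iff)
  then have "length p = card (set (map f p))" by (metis distinct_card length_map)
  also have "\<dots> \<le> card {..l}" by (rule card_mono) (use assms(2) in auto)
  finally show ?thesis by simp
qed

lemma path_edges_covers: "2 \<le> length p \<Longrightarrow> x \<in> set p \<Longrightarrow> \<exists>y. (x, y) \<in> path_edges p \<or> (y, x) \<in> path_edges p"
proof (induction p rule: induct_list012)
  case (3 a b zs) then show ?case by (cases zs) auto
qed auto

text \<open>
  In a monochromatic path decomposition with as few paths as possible no path of a class starts
  where another path of the same class ends, as the two could be concatenated.
\<close>
lemma class_decomposition:
  fixes pos :: "'c \<Rightarrow> 'a \<Rightarrow> nat"
  assumes fin: "finite G"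
    and pos: "\<And>x y. (x, y) \<in> G \<Longrightarrow> pos (cl (x, y)) x < pos (cl (x, y)) y \<and> pos (cl (x, y)) y \<le> l"
  shows "\<exists>Q. path_dec G Q \<and> (\<forall>q\<in>Q. length q \<le> l + 1) \<and>
    (\<forall>w. int (card {q\<in>Q. last q = w}) = (\<Sum>c\<in>cl ` G. max 0 (- arc_excess {e\<in>G. cl e = c} w))) \<and>
    (\<forall>w. int (card {q\<in>Q. hd q = w}) = (\<Sum>c\<in>cl ` G. max 0 (arc_excess {e\<in>G. cl e = c} w)))"
proof -
  \<comment> \<open>Admissible decompositions keep every path inside one class. The single arcs form
    one, so a smallest one exists.\<close>
  define adm where "adm Q \<longleftrightarrow> path_dec G Q \<and> (\<forall>q\<in>Q. \<exists>c. \<forall>e\<in>path_edges q. cl e = c)" for Q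
  have "adm ((\<lambda>(x, y). [x, y]) ` G)"
    unfolding adm_def
  proof
    show "path_dec G ((\<lambda>(x, y). [x, y]) ` G)"
    proof (rule path_dec_UN)
      fix e assume "e \<in> G"
      then show "simple_path (case e of (x, y) \<Rightarrow> [x, y])"
        using pos[of "fst e" "snd e"] by (auto simp: simple_path_def split: prod.splits)
    qed (use fin in auto)
  qed auto
  then obtain Q where adm: "adm Q" and minimal: "\<And>Q'. adm Q' \<Longrightarrow> card Q \<le> card Q'"
    using exists_least_iff[of "\<lambda>n. \<exists>Q. adm Q \<and> card Q = n"] by (metis not_less)
  have path_dec: "path_dec G Q" and finQ: "finite Q" using adm by (auto simp: adm_def path_dec_def)
  have dp: "simple_path q" if "q \<in> Q" for q using path_dec that by (auto simp: path_dec_def)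
  have sub: "path_edges q \<subseteq> G" if "q \<in> Q" for q using path_dec that by (auto simp: path_dec_def)
  define kl where "kl q = cl (SOME e. e \<in> path_edges q)" for q
  have kl: "cl e = kl q" if "q \<in> Q" "e \<in> path_edges q" for q e
    using adm that someI[of "\<lambda>e. e \<in> path_edges q" e] by (auto simp: adm_def kl_def)
  have kl_G: "kl q \<in> cl ` G" if q: "q \<in> Q" for q
  proof -
    obtain e where "e \<in> path_edges q" using path_edges_nonempty[of q] dp[OF q] by (auto simp:
        simple_path_def)
    then show ?thesis using kl[OF q] sub[OF q] by (metis imageI subsetD)
  qed
  have len: "length q \<le> l + 1" if q: "q \<in> Q" for q
  proof (rule increasing_path_length)
    have *: "pos (kl q) x < pos (kl q) y \<and> pos (kl q) y \<le> l" if "(x, y) \<in> path_edges q" for x y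
      using pos[of x y] kl[OF q that] sub[OF q] that by auto
    show "pos (kl q) x < pos (kl q) y" if "(x, y) \<in> path_edges q" for x y using *[OF that] by simp
    show "pos (kl q) x \<le> l" if "x \<in> set q" for x
      using path_edges_covers[OF _ that] dp[OF q] * by (fastforce simp: simple_path_def)
  qed
  have nomerge: "last q \<noteq> hd q'" if q: "q \<in> Q" "q' \<in> Q" "kl q = kl q'" for q q'
  proof
    assume eq: "last q = hd q'"
    have ne: "q \<noteq> q'" using simple_path_hd_last[OF dp[OF q(1)]] eq by auto
    \<comment> \<open>The joined walk stays inside one class, so positions rise along it and it is
      again a path. Putting it in place of \<open>q\<close> and \<open>q'\<close> would contradict
      minimality.\<close>
    define m where "m = q @ tl q'"
    have E: "path_edges m = path_edges q \<union> path_edges q'"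
      unfolding m_def by (rule path_edges_join) (use dp q eq in auto)
    have col: "cl e = kl q" if "e \<in> path_edges m" for e
      using that kl[OF q(1), of e] kl[OF q(2), of e] q(3) E by auto
    have "distinct m"
    proof (rule increasing_path_distinct)
      fix x y assume "(x, y) \<in> path_edges m"
      then show "pos (kl q) x < pos (kl q) y"
        using pos[of x y] col[of "(x, y)"] E sub[OF q(1)] sub[OF q(2)] by auto
    qed
    moreover have "2 \<le> length m" using dp[OF q(1)] by (simp add: m_def simple_path_def)
    ultimately have m: "simple_path m" by (simp add: simple_path_def)
    have "adm (insert m (Q - {q, q'}))"
      unfolding adm_def
    proof
      have disj: "path_edges a \<inter> path_edges b = {}" if "a \<in> Q" "b \<in> Q" "a \<noteq> b" for a b
        using path_dec that by (auto simp: path_dec_def)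
      show "\<forall>q\<in>insert m (Q - {q, q'}). \<exists>c. \<forall>e\<in>path_edges q. cl e = c"
        using adm col by (auto simp: adm_def)
      have "(\<Union>x\<in>insert m (Q - {q, q'}). path_edges x) = (\<Union>x\<in>Q. path_edges x)"
        using E q by auto
      moreover have "path_edges m \<inter> path_edges a = {}" if "a \<in> Q - {q, q'}" for a
        using E disj[of q a] disj[of q' a] q that by auto
      ultimately show "path_dec G (insert m (Q - {q, q'}))"
        using path_dec m unfolding path_dec_def by (auto simp: Int_commute)
    qed
    then have "card Q \<le> card (insert m (Q - {q, q'}))" by (rule minimal)
    also have "\<dots> \<le> Suc (card (Q - {q, q'}))" by (rule card_insert_le_m1) (use finQ in auto)
    also have "card (Q - {q, q'}) = card Q - 2"
      using q ne finQ by (simp add: card_Diff_subset)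
    finally have "card Q \<le> Suc (card Q - 2)" .
    moreover have "2 \<le> card Q" using card_mono[of Q "{q, q'}"] q ne finQ by auto
    ultimately show False by simp
  qed
  have count: "int (card {q\<in>Q. kl q = c \<and> last q = w}) = max 0 (- arc_excess {e\<in>G. cl e = c} w) \<and>
      int (card {q\<in>Q. kl q = c \<and> hd q = w}) = max 0 (arc_excess {e\<in>G. cl e = c} w)" for c w
  proof -
    have "path_dec {e\<in>G. cl e = c} {q\<in>Q. kl q = c}"
    proof -
      have "e \<in> (\<Union>q\<in>{q\<in>Q. kl q = c}. path_edges q) \<longleftrightarrow> e \<in> {e\<in>G. cl e = c}" for e
      proof
        assume "e \<in> {e\<in>G. cl e = c}"
        then obtain q where "q \<in> Q" "e \<in> path_edges q" using path_dec by (auto simp: path_dec_def)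
        then show "e \<in> (\<Union>q\<in>{q\<in>Q. kl q = c}. path_edges q)"
          using kl[of q e] \<open>e \<in> {e\<in>G. cl e = c}\<close> by auto
      next
        assume "e \<in> (\<Union>q\<in>{q\<in>Q. kl q = c}. path_edges q)"
        then obtain q where q: "q \<in> Q" "e \<in> path_edges q" "kl q = c" by auto
        then show "e \<in> {e\<in>G. cl e = c}" using kl[OF q(1,2)] sub[OF q(1)] by auto
      qed
      then have "(\<Union>q\<in>{q\<in>Q. kl q = c}. path_edges q) = {e\<in>G. cl e = c}" by (rule set_eqI)
      then show ?thesis using path_dec by (simp add: path_dec_def)
    qed
    from path_dec_arc_excess[OF this, of w]
    have "arc_excess {e\<in>G. cl e = c} w = int (card {q\<in>Q. kl q = c \<and> hd q = w}) - int (card {q\<in>Q. kl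
        q = c \<and> last q = w})"
      by simp
    \<comment> \<open>By \<open>nomerge\<close>, starts and ends at \<open>w\<close> exclude each
      other within a class. Their difference is the excess of the class, so the two counts are its
      positive and its negative part.\<close>
    moreover have "{q\<in>Q. kl q = c \<and> hd q = w} = {} \<or> {q\<in>Q. kl q = c \<and> last q = w} = {}"
    proof (rule ccontr)
      assume "\<not> ?thesis"
      then obtain q q' where "q \<in> Q" "kl q = c" "hd q = w" "q' \<in> Q" "kl q' = c" "last q' = w" by blast
      then show False using nomerge[of q' q] by simp
    qed
    then have "card {q\<in>Q. kl q = c \<and> hd q = w} = 0 \<or> card {q\<in>Q. kl q = c \<and> last q = w} = 0"
      by (elim disj_forward) (simp_all only: card.empty)
    ultimately show ?thesis by linarith
  qed
  have split: "card {q\<in>Q. P q} = (\<Sum>c\<in>cl ` G. card {q\<in>Q. kl q = c \<and> P q})" for P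
  proof -
    have "{q\<in>Q. P q} = (\<Union>c\<in>cl ` G. {q\<in>Q. kl q = c \<and> P q})" using kl_G by auto
    then have "card {q\<in>Q. P q} = card (\<Union>c\<in>cl ` G. {q\<in>Q. kl q = c \<and> P q})" by (rule arg_cong)
    also have "\<dots> = (\<Sum>c\<in>cl ` G. card {q\<in>Q. kl q = c \<and> P q})"
      by (rule card_UN_disjoint) (use fin finQ in auto)
    finally show ?thesis .
  qed
  show ?thesis
  proof (intro exI[of _ Q] conjI allI)
    show "int (card {q\<in>Q. last q = w}) = (\<Sum>c\<in>cl ` G. max 0 (- arc_excess {e\<in>G. cl e = c} w))" for w
      using count by (subst split) simp
    show "int (card {q\<in>Q. hd q = w}) = (\<Sum>c\<in>cl ` G. max 0 (arc_excess {e\<in>G. cl e = c} w))" for w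
      using count by (subst split) simp
  qed (use path_dec len in auto)
qed

section \<open>Reserved paths through every vertex\<close>

lemma sum_card_relation:
  assumes "finite A" "finite B"
  shows "(\<Sum>x\<in>A. card {y\<in>B. R x y}) = (\<Sum>y\<in>B. card {x\<in>A. R x y})"
proof -
  have "(\<Sum>x\<in>A. card {y\<in>B. R x y}) = (\<Sum>x\<in>A. \<Sum>y\<in>B. of_bool (R x y))"
    using assms by (intro sum.cong) (auto simp: of_bool_def sum.If_cases Int_def)
  also have "\<dots> = (\<Sum>y\<in>B. \<Sum>x\<in>A. of_bool (R x y))" by (rule sum.swap)
  also have "\<dots> = (\<Sum>y\<in>B. card {x\<in>A. R x y})"
    using assms by (intro sum.cong) (auto simp: of_bool_def sum.If_cases Int_def)
  finally show ?thesis .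
qed

lemma Collect_insert_if:
  "{i\<in>insert j J. P i} = (if P j then insert j {i\<in>J. P i} else {i\<in>J. P i})"
  by auto

section \<open>Robust reachability and greedy reservation\<close>

definition tournament_on :: "'a set \<Rightarrow> ('a \<times> 'a) set \<Rightarrow> bool" where
  "tournament_on V E \<longleftrightarrow> finite V \<and> E \<subseteq> V \<times> V \<and> (\<forall>v. (v, v) \<notin> E) \<and>
     (\<forall>u\<in>V. \<forall>v\<in>V. u \<noteq> v \<longrightarrow> ((u, v) \<in> E \<longleftrightarrow> (v, u) \<notin> E))"

lemma tournament_on_finite: "tournament_on V E \<Longrightarrow> finite E"
  by (rule finite_subset[of E "V \<times> V"]) (auto simp: tournament_on_def)

lemma tournament_on_arc: "tournament_on V E \<Longrightarrow> u \<in> V \<Longrightarrow> v \<in> V \<Longrightarrow> u \<noteq> v \<Longrightarrow> (u, v) \<in> E \<longleftrightarrow> (v, u) \<notin> E"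
  unfolding tournament_on_def by metis

lemma tournament_on_converse: "tournament_on V E \<Longrightarrow> tournament_on V (E\<inverse>)"
  unfolding tournament_on_def converse_iff by blast

text \<open>Arcs inside \<open>Z\<close> cancel in the sum of the excesses over \<open>Z\<close>, so
  this sum is the number of arcs leaving \<open>Z\<close> minus the number entering it. On average a
  vertex of \<open>Z\<close> therefore sends at most \<open>r\<close> fewer arcs out of
  \<open>Z\<close> than it receives from there, and in a tournament the two numbers add up to
  \<open>card (V - Z)\<close>.\<close>

lemma cut_vertex:
  assumes T: "tournament_on V E" and Z: "Z \<subseteq> V" "Z \<noteq> {}" and ex: "\<And>z. z \<in> Z \<Longrightarrow> - int r \<le> arc_excess E z"
  shows "\<exists>z\<in>Z. card (V - Z) \<le> 2 * card (outs E z - Z) + r"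
proof (rule ccontr)
  assume neg: "\<not> ?thesis"
  have fin: "finite V" "finite E" using T tournament_on_finite by (auto simp: tournament_on_def)
  then have finZ: "finite Z" using Z finite_subset by blast
  have part: "card (outs E z - Z) + card (ins E z - Z) = card (V - Z)" if "z \<in> Z" for z
  proof -
    have "(outs E z - Z) \<union> (ins E z - Z) = V - Z" "(outs E z - Z) \<inter> (ins E z - Z) = {}"
    proof -
      have "(z, y) \<in> E \<longleftrightarrow> (y, z) \<notin> E" if "y \<in> V - Z" for y
        using T \<open>z \<in> Z\<close> that Z(1) by (intro tournament_on_arc[OF T]) auto
      moreover have "outs E z \<subseteq> V" "ins E z \<subseteq> V" using T by (auto simp: tournament_on_def outs_def
          ins_def)
      ultimately show "(outs E z - Z) \<union> (ins E z - Z) = V - Z" "(outs E z - Z) \<inter> (ins E z - Z) = {}"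
        by (auto simp: outs_def ins_def)
    qed
    then show ?thesis using fin card_Un_disjoint[of "outs E z - Z" "ins E z - Z"] by simp
  qed
  have split: "card (outs E z) = card (outs E z - Z) + card {y\<in>Z. (z, y) \<in> E}"
    "card (ins E z) = card (ins E z - Z) + card {y\<in>Z. (y, z) \<in> E}" for z
  proof -
    have "{y\<in>Z. (z, y) \<in> E} = outs E z \<inter> Z" "{y\<in>Z. (y, z) \<in> E} = ins E z \<inter> Z"
      by (auto simp: outs_def ins_def)
    then show "card (outs E z) = card (outs E z - Z) + card {y\<in>Z. (z, y) \<in> E}"
     "card (ins E z) = card (ins E z - Z) + card {y\<in>Z. (y, z) \<in> E}"
      using fin finZ by (simp_all add: card_Diff_subset_Int card_mono)
  qed
  have "(\<Sum>z\<in>Z. arc_excess E z) = (\<Sum>z\<in>Z. int (card (outs E z - Z)) - int (card (ins E z - Z)))"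
    using sum_card_relation[OF finZ finZ, of "\<lambda>x y. (x, y) \<in> E"]
    by (simp add: arc_excess_def split sum_subtractf sum.distrib flip: of_nat_sum)
  also have "\<dots> < (\<Sum>z\<in>Z. - int r)"
  proof (rule sum_strict_mono)
    fix z assume z: "z \<in> Z"
    have "2 * card (outs E z - Z) + r < card (V - Z)" using neg z by auto
    then show "int (card (outs E z - Z)) - int (card (ins E z - Z)) < - int r"
      using part[OF z] by linarith
  qed (use finZ Z in auto)
  also have "\<dots> \<le> (\<Sum>z\<in>Z. arc_excess E z)" by (rule sum_mono) (rule ex)
  finally show False by simp
qed

text \<open>
  A set closed under having many out-neighbours in it is everything: otherwise
  the complement would send few and hence, its excess being bounded below, receive few arcs.
\<close>
lemma rank_exists:
  assumes T: "tournament_on V E" and U: "U \<subseteq> V" "5 * r \<le> card U" and r: "0 < r"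
    and ex: "\<And>v. v \<in> V - U \<Longrightarrow> - int r \<le> arc_excess E v" and h: "card V \<le> h * r"
  shows "\<exists>\<rho>::'a \<Rightarrow> nat. \<forall>x\<in>V. \<rho> x \<le> h \<and> (\<rho> x = 0 \<longrightarrow> x \<in> U) \<and>
    (0 < \<rho> x \<longrightarrow> r \<le> card {y\<in>V. (x, y) \<in> E \<and> \<rho> y < \<rho> x})"
proof -
  have fin: "finite V" "finite E" using T tournament_on_finite by (auto simp: tournament_on_def)
  \<comment> \<open>Each layer adds the vertices with \<open>r\<close> out-neighbours in the
    previous one. The rank of a vertex will be the first layer that contains it.\<close>
  define L where "L = rec_nat U (\<lambda>_ S. S \<union> {x\<in>V. r \<le> card (outs E x \<inter> S)})"
  have L0: "L 0 = U" and LS: "L (Suc i) = L i \<union> {x\<in>V. r \<le> card (outs E x \<inter> L i)}" for i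
    by (simp_all add: L_def)
  have LV: "L i \<subseteq> V" for i by (induction i) (use U in \<open>auto simp: L0 LS\<close>)
  have finL: "finite (L i)" for i using LV fin finite_subset by blast
  have UL: "U \<subseteq> L i" for i by (induction i) (auto simp: L0 LS)
  \<comment> \<open>A vertex \<open>z\<close> outside \<open>L (Suc i)\<close> has fewer than
    \<open>r\<close> out-neighbours in \<open>L i\<close>. If the layer gained fewer than
    \<open>r\<close> vertices, \<open>cut_vertex\<close> applied to its complement would give
    \<open>card (L (Suc i)) < 2 * (r + r) + r\<close>. This is the origin of the factor 5.\<close>
  have grow: "card (L i) + r \<le> card (L (Suc i))" if ne: "L (Suc i) \<noteq> V" for i
  proof (rule ccontr)
    assume small: "\<not> ?thesis"
    obtain z where z: "z \<in> V - L (Suc i)"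
      and c: "card (V - (V - L (Suc i))) \<le> 2 * card (outs E z - (V - L (Suc i))) + r"
      using cut_vertex[OF T, of "V - L (Suc i)" r] ne LV[of "Suc i"] ex UL[of "Suc i"] by blast
    have "V - (V - L (Suc i)) = L (Suc i)" using LV[of "Suc i"] by auto
    moreover have "outs E z - (V - L (Suc i)) \<subseteq> (outs E z \<inter> L i) \<union> (L (Suc i) - L i)"
      using T by (auto simp: tournament_on_def outs_def)
    then have "card (outs E z - (V - L (Suc i))) \<le> card (outs E z \<inter> L i) + card (L (Suc i) - L i)"
      using finL fin by (meson card_Un_le card_mono finite_Diff finite_Int finite_UnI order_trans)
    moreover have "card (L (Suc i) - L i) = card (L (Suc i)) - card (L i)"
      by (rule card_Diff_subset) (use finL in \<open>auto simp: LS\<close>)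
    moreover have "card (outs E z \<inter> L i) < r" using z by (auto simp: LS)
    moreover have "5 * r \<le> card (L (Suc i))" using U(2) card_mono[OF finL UL] order_trans by blast
    ultimately show False using c small by simp
  qed
  have big: "L i \<noteq> V \<Longrightarrow> i * r + 5 * r \<le> card (L i)" for i
  proof (induction i)
    case (Suc i)
    have "L i \<noteq> V" using Suc.prems LV[of "Suc i"] by (auto simp: LS)
    then show ?case using Suc.IH grow[OF Suc.prems] by simp
  qed (use U in \<open>simp add: L0\<close>)
  have Lh: "L h = V"
  proof (rule ccontr)
    assume "L h \<noteq> V"
    from big[OF this] show False using h r card_mono[OF fin(1) LV[of h]] by simp
  qed
  define \<rho> where "\<rho> x = (LEAST i. x \<in> L i)" for x
  have le: "x \<in> L i \<Longrightarrow> \<rho> x \<le> i" for x i unfolding \<rho>_def by (rule Least_le)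
  have mem: "x \<in> V \<Longrightarrow> x \<in> L (\<rho> x)" for x unfolding \<rho>_def by (rule LeastI[of _ h]) (use Lh in simp)
  have "\<rho> x \<le> h \<and> (\<rho> x = 0 \<longrightarrow> x \<in> U) \<and> (0 < \<rho> x \<longrightarrow> r \<le> card {y\<in>V. (x, y) \<in> E \<and> \<rho> y < \<rho> x})"
    if x: "x \<in> V" for x
  proof (intro conjI impI)
    show "\<rho> x \<le> h" using le x Lh by blast
    show "x \<in> U" if "\<rho> x = 0" using mem[OF x] that L0 by simp
    assume "0 < \<rho> x"
    then obtain i where i: "\<rho> x = Suc i" using gr0_implies_Suc by blast
    have "x \<notin> L i" using le[of x i] i by auto
    then have "r \<le> card (outs E x \<inter> L i)" using mem[OF x] i by (auto simp: LS)
    also have "\<dots> \<le> card {y\<in>V. (x, y) \<in> E \<and> \<rho> y < \<rho> x}"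
      by (rule card_mono) (use fin LV[of i] in \<open>auto simp: outs_def i less_Suc_eq_le le\<close>)
    finally show "r \<le> card {y\<in>V. (x, y) \<in> E \<and> \<rho> y < \<rho> x}" .
  qed
  then show ?thesis by blast
qed

text \<open>A certificate of robust descent: blocking fewer than \<open>r\<close> of the choices at
  a vertex cannot stop a walk above rank 0. Which vertices have rank 0 is left open, because the
  reservation of paths depends on the ranks alone.\<close>

definition ranking :: "'a set \<Rightarrow> ('a \<times> 'a) set \<Rightarrow> nat \<Rightarrow> nat \<Rightarrow> ('a \<Rightarrow> nat) \<Rightarrow> bool" where
  "ranking V E r h \<rho> \<longleftrightarrow> (\<forall>x\<in>V. \<rho> x \<le> h \<and>
     (0 < \<rho> x \<longrightarrow> r \<le> card {y\<in>V. (x, y) \<in> E \<and> \<rho> y < \<rho> x}))"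

text \<open>The path is built greedily. At each vertex, \<open>r\<close> out-neighbours have smaller
  rank, and by \<open>room\<close> fewer than \<open>r\<close> of them are excluded by the used arcs
  \<open>D\<close> or the forbidden vertices \<open>F\<close>. The start \<open>x\<close> gets an
  exception in \<open>room\<close> because it may itself be forbidden.\<close>

lemma descent:
  assumes V: "finite V" and rk: "ranking V E r h \<rho>" and fin: "finite D" "finite F"
    and x: "x \<in> V"
    and room: "\<And>z. z \<in> V \<Longrightarrow> z = x \<or> z \<notin> F \<Longrightarrow> card (outs D z) + card F < r"
  shows "\<exists>p. p \<noteq> [] \<and> hd p = x \<and> \<rho> (last p) = 0 \<and> path_edges p \<subseteq> E - D \<and> set (tl p) \<inter> F = {} \<and>
    set p \<subseteq> V \<and> distinct p \<and> length p \<le> h + 1"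
proof -
  have "\<exists>p. p \<noteq> [] \<and> hd p = y \<and> \<rho> (last p) = 0 \<and> path_edges p \<subseteq> E - D \<and> set (tl p) \<inter> F = {} \<and>
      set p \<subseteq> V \<and> (\<forall>(a, b)\<in>path_edges p. \<rho> b < \<rho> a)" if "y \<in> V" "y = x \<or> y \<notin> F" for y
    using that
  proof (induction "\<rho> y" arbitrary: y rule: less_induct)
    case less
    show ?case
    proof (cases "\<rho> y = 0")
      case True
      then show ?thesis using less.prems by (intro exI[of _ "[y]"]) auto
    next
      case False
      let ?S = "{z\<in>V. (y, z) \<in> E \<and> \<rho> z < \<rho> y}"
      have "card (outs D y \<union> F) < card ?S"
      proof -
        have "card (outs D y \<union> F) \<le> card (outs D y) + card F" by (rule card_Un_le)
        also have "\<dots> < r" by (rule room) (use less.prems in auto)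
        also have "\<dots> \<le> card ?S" using rk False less.prems by (simp add: ranking_def)
        finally show ?thesis .
      qed
      then have "\<not> ?S \<subseteq> outs D y \<union> F"
        using card_mono[of "outs D y \<union> F" ?S] fin by auto
      then obtain z where z: "z \<in> V" "(y, z) \<in> E" "\<rho> z < \<rho> y" "(y, z) \<notin> D" "z \<notin> F"
        by (auto simp: outs_def)
      from less.hyps[OF z(3,1)] z(5) obtain p where p: "p \<noteq> []" "hd p = z" "\<rho> (last p) = 0"
        "path_edges p \<subseteq> E - D" "set (tl p) \<inter> F = {}" "set p \<subseteq> V" "\<forall>(a, b)\<in>path_edges p. \<rho> b < \<rho> a"
        by blast
      obtain p' where p': "p = z # p'" using p by (cases p) auto
      show ?thesis
        by (rule exI[of _ "y # p"]) (use p z less.prems in \<open>auto simp: p'\<close>)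
    qed
  qed
  from this[OF x] obtain p where p: "p \<noteq> []" "hd p = x" "\<rho> (last p) = 0"
    "path_edges p \<subseteq> E - D" "set (tl p) \<inter> F = {}" "set p \<subseteq> V" "\<forall>(a, b)\<in>path_edges p. \<rho> b < \<rho> a"
    by blast
  \<comment> \<open>Ranks fall along \<open>p\<close>, so they rise along \<open>rev p\<close>,
    which bounds the length by the number of possible ranks.\<close>
  have inc: "\<rho> a < \<rho> b" if "(a, b) \<in> path_edges (rev p)" for a b
    using p(7) that by (auto simp: path_edges_rev)
  have "distinct (rev p)" by (rule increasing_path_distinct) (rule inc)
  moreover have "length (rev p) \<le> h + 1"
    by (rule increasing_path_length[of _ \<rho>], rule inc) (use p(6) rk in \<open>auto simp: ranking_def\<close>)
  ultimately show ?thesis using p by (intro exI[of _ p]) auto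
qed

text \<open>The two halves are kept apart, since a crossing later attaches them to different paths.
  That they form one path is expressed by the distinctness of \<open>a @ tl b\<close>.\<close>

definition through :: "'a set \<Rightarrow> ('a \<times> 'a) set \<Rightarrow> ('a \<Rightarrow> nat) \<Rightarrow> ('a \<Rightarrow> nat) \<Rightarrow> nat \<Rightarrow> 'a \<Rightarrow> 'a list \<Rightarrow> 'a
    list \<Rightarrow> bool" where
  "through V E \<rho> \<sigma> h w a b \<longleftrightarrow> a \<noteq> [] \<and> b \<noteq> [] \<and> last a = w \<and> hd b = w \<and> \<sigma> (hd a) = 0 \<and> \<rho> (last b) = 0 \<and>
     distinct (a @ tl b) \<and> path_edges a \<union> path_edges b \<subseteq> E \<and> set a \<union> set b \<subseteq> V \<and>
     length a \<le> h + 1 \<and> length b \<le> h + 1"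

text \<open>The pair \<open>(w, i)\<close> indexes the \<open>i\<close>-th path reserved for
  \<open>w\<close>, and the paths are chosen one after another. All of them together visit at most
  \<open>card V * s * (2 * h + 2)\<close> vertices with multiplicity, so at most \<open>c\<close>
  vertices ever carry \<open>cap\<close> paths. A new path avoids these and the earlier paths of the
  same \<open>w\<close>. In \<open>room\<close>, \<open>cap + s\<close> counts the used arcs at a
  vertex, \<open>c + s * (2 * h + 2)\<close> the forbidden vertices, and \<open>h + 1\<close> the
  half that is built first.\<close>

lemma through_paths:
  fixes V :: "'a set"
  assumes V: "finite V" and rk: "ranking V E r h \<rho>" "ranking V (E\<inverse>) r h \<sigma>"
    and c: "card V * s * (2 * h + 2) \<le> cap * c" "0 < cap"
    and r: "cap + s + c + s * (2 * h + 2) + (h + 1) < r"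
  shows "\<exists>a b. (\<forall>j\<in>V \<times> {..<s}. through V E \<rho> \<sigma> h (fst j) (a j) (b j)) \<and>
    (\<forall>j\<in>V \<times> {..<s}. \<forall>j'\<in>V \<times> {..<s}. j \<noteq> j' \<longrightarrow>
       (path_edges (a j) \<union> path_edges (b j)) \<inter> (path_edges (a j') \<union> path_edges (b j')) = {} \<and>
       (fst j = fst j' \<longrightarrow> (set (a j) \<union> set (b j)) \<inter> (set (a j') \<union> set (b j')) \<subseteq> {fst j})) \<and>
    (\<forall>v. card {j\<in>V \<times> {..<s}. v \<in> set (a j) \<union> set (b j)} \<le> cap + s)"
proof -
  \<comment> \<open>The load bound has a second term because a path for \<open>w\<close> has to
    visit \<open>w\<close> even when \<open>w\<close> is already full.\<close>
  define good where "good J a b \<longleftrightarrow> (\<forall>j\<in>J. through V E \<rho> \<sigma> h (fst j) (a j) (b j)) \<and>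
    (\<forall>j\<in>J. \<forall>j'\<in>J. j \<noteq> j' \<longrightarrow>
       (path_edges (a j) \<union> path_edges (b j)) \<inter> (path_edges (a j') \<union> path_edges (b j')) = {} \<and>
       (fst j = fst j' \<longrightarrow> (set (a j) \<union> set (b j)) \<inter> (set (a j') \<union> set (b j')) \<subseteq> {fst j})) \<and>
    (\<forall>v. card {j\<in>J. v \<in> set (a j) \<union> set (b j)} \<le> cap + card {j\<in>J. fst j = v})"
    for J :: "('a \<times> nat) set" and a b
  have step: "\<exists>a' b'. good (insert j J) a' b'"
    if J: "finite J" "insert j J \<subseteq> V \<times> {..<s}" "j \<notin> J" "good J a b" for J j a b
  proof -
    define w where "w = fst j"
    have w: "w \<in> V" using J by (auto simp: w_def)
    define vs where "vs i = set (a i) \<union> set (b i)" for i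
    have thr: "through V E \<rho> \<sigma> h (fst i) (a i) (b i)" if "i \<in> J" for i using J(4) that by (simp add:
        good_def)
    have fibre: "card {i\<in>J. fst i = v} \<le> s" for v
    proof -
      have "{i\<in>J. fst i = v} \<subseteq> Pair v ` {..<s}" using J(2) by auto
      then have "card {i\<in>J. fst i = v} \<le> card (Pair v ` {..<s})" by (intro card_mono) auto
      also have "\<dots> \<le> s" using card_image_le[of "{..<s}" "Pair v"] by simp
      finally show ?thesis .
    qed
    have load: "card {i\<in>J. v \<in> vs i} \<le> cap + card {i\<in>J. fst i = v}" for v
      using J(4) by (simp add: good_def vs_def)
    have cvs: "card (vs i) \<le> 2 * h + 2" if "i \<in> J" for i
    proof -
      have "card (vs i) \<le> card (set (a i)) + card (set (b i))" unfolding vs_def by (rule card_Un_le)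
      also have "\<dots> \<le> length (a i) + length (b i)" by (intro add_mono card_length)
      also have "\<dots> \<le> 2 * h + 2" using thr[OF that] by (simp add: through_def)
      finally show ?thesis .
    qed
    define D where "D = (\<Union>i\<in>J. path_edges (a i @ tl (b i)))"
    have pe: "path_edges (a i @ tl (b i)) = path_edges (a i) \<union> path_edges (b i)" if "i \<in> J" for i
      using thr[OF that] by (intro path_edges_join) (auto simp: through_def)
    have sv: "set (a i @ tl (b i)) = vs i" if "i \<in> J" for i
    proof -
      have "hd (b i) \<in> set (a i)" using thr[OF that] last_in_set[of "a i"] by (auto simp: through_def)
      then show ?thesis using thr[OF that] by (cases "b i") (auto simp: through_def vs_def)
    qed
    have finD: "finite D" using J(1) by (auto simp: D_def)
    have Dload: "card (outs D z) \<le> card {i\<in>J. z \<in> vs i} \<and> card (ins D z) \<le> card {i\<in>J. z \<in> vs i}" for z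
    proof -
      have one: "card (outs (path_edges (a i @ tl (b i))) z) \<le> of_bool (z \<in> vs i)"
        "card (ins (path_edges (a i @ tl (b i))) z) \<le> of_bool (z \<in> vs i)" if "i \<in> J" for i
      proof -
        have d: "distinct (a i @ tl (b i))" "a i @ tl (b i) \<noteq> []" using thr[OF that] by (auto simp:
            through_def)
        show "card (outs (path_edges (a i @ tl (b i))) z) \<le> of_bool (z \<in> vs i)"
          "card (ins (path_edges (a i @ tl (b i))) z) \<le> of_bool (z \<in> vs i)"
          using card_outs_path[OF d, of z] card_ins_path[OF d, of z] sv[OF that] by (auto simp del:
              set_append)
      qed
      have "outs D z = (\<Union>i\<in>J. outs (path_edges (a i @ tl (b i))) z)"
        "ins D z = (\<Union>i\<in>J. ins (path_edges (a i @ tl (b i))) z)"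
        by (auto simp: D_def outs_def ins_def)
      then have "card (outs D z) \<le> (\<Sum>i\<in>J. card (outs (path_edges (a i @ tl (b i))) z))"
        "card (ins D z) \<le> (\<Sum>i\<in>J. card (ins (path_edges (a i @ tl (b i))) z))"
        using card_UN_le[OF J(1)] by simp_all
      moreover have "(\<Sum>i\<in>J. of_bool (z \<in> vs i)) = card {i\<in>J. z \<in> vs i}"
        using J(1) by (simp add: of_bool_def sum.If_cases Int_def)
      ultimately show ?thesis using sum_mono[OF one(1)] sum_mono[OF one(2)] by fastforce
    qed
    \<comment> \<open>Full vertices, together with everything on earlier paths of the same
      \<open>w\<close>.\<close>
    define F where "F = {v\<in>V. cap \<le> card {i\<in>J. v \<in> vs i}} \<union> (\<Union>i\<in>{i\<in>J. fst i = w}. vs i)"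
    have finF: "finite F" using J(1) V by (auto simp: F_def vs_def)
    have cardF: "card F \<le> c + s * (2 * h + 2)"
    proof -
      let ?H = "{v\<in>V. cap \<le> card {i\<in>J. v \<in> vs i}}"
      have cJ: "card J \<le> card V * s"
        using card_mono[of "V \<times> {..<s}" J] J V by (simp add: card_cartesian_product)
      have "cap * card ?H = (\<Sum>v\<in>?H. cap)" by simp
      also have "\<dots> \<le> (\<Sum>v\<in>?H. card {i\<in>J. v \<in> vs i})" by (rule sum_mono) auto
      also have "\<dots> \<le> (\<Sum>v\<in>V. card {i\<in>J. v \<in> vs i})" by (rule sum_mono2) (use V in auto)
      also have "\<dots> = (\<Sum>i\<in>J. card {v\<in>V. v \<in> vs i})" by (rule sum_card_relation) (use V J in auto)
      also have "\<dots> \<le> (\<Sum>i\<in>J. 2 * h + 2)"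
      proof (rule sum_mono)
        fix i assume "i \<in> J"
        have "card {v\<in>V. v \<in> vs i} \<le> card (vs i)" by (rule card_mono) (auto simp: vs_def)
        then show "card {v\<in>V. v \<in> vs i} \<le> 2 * h + 2" using cvs[OF \<open>i \<in> J\<close>] by simp
      qed
      also have "\<dots> = card J * (2 * h + 2)" by simp
      also have "\<dots> \<le> card V * s * (2 * h + 2)" by (rule mult_right_mono[OF cJ]) simp
      also have "\<dots> \<le> cap * c" by (rule c)
      finally have "card ?H \<le> c" using c(2) by simp
      moreover have "card (\<Union>i\<in>{i\<in>J. fst i = w}. vs i) \<le> s * (2 * h + 2)"
      proof -
        have "card (\<Union>i\<in>{i\<in>J. fst i = w}. vs i) \<le> (\<Sum>i\<in>{i\<in>J. fst i = w}. card (vs i))"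
          by (rule card_UN_le) (use J in auto)
        also have "\<dots> \<le> (\<Sum>i\<in>{i\<in>J. fst i = w}. 2 * h + 2)" by (rule sum_mono) (use cvs in auto)
        also have "\<dots> = card {i\<in>J. fst i = w} * (2 * h + 2)" by simp
        also have "\<dots> \<le> s * (2 * h + 2)" by (rule mult_right_mono[OF fibre]) simp
        finally show ?thesis .
      qed
      moreover have "card F \<le> card ?H + card (\<Union>i\<in>{i\<in>J. fst i = w}. vs i)"
        unfolding F_def by (rule card_Un_le)
      ultimately show ?thesis by linarith
    qed
    have Dz: "card (outs D z) \<le> cap + s" "card (ins D z) \<le> cap + s" for z
      using Dload[of z] load[of z] fibre[of z] by linarith+
    obtain q where q: "q \<noteq> []" "hd q = w" "\<rho> (last q) = 0" "path_edges q \<subseteq> E - D" "set (tl q) \<inter> F = {}"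
      "set q \<subseteq> V" "distinct q" "length q \<le> h + 1"
    proof -
      have "\<exists>q. q \<noteq> [] \<and> hd q = w \<and> \<rho> (last q) = 0 \<and> path_edges q \<subseteq> E - D \<and> set (tl q) \<inter> F = {} \<and>
        set q \<subseteq> V \<and> distinct q \<and> length q \<le> h + 1"
      proof (rule descent[OF V rk(1) finD finF w])
        show "card (outs D z) + card F < r" for z using Dz(1)[of z] cardF r by linarith
      qed
      then show ?thesis using that by blast
    qed
    \<comment> \<open>The incoming half is a descent for the converse arcs. It must also avoid the
      outgoing half \<open>q\<close>, so that both together form a path.\<close>
    obtain p where p: "p \<noteq> []" "hd p = w" "\<sigma> (last p) = 0" "path_edges p \<subseteq> E\<inverse> - D\<inverse>"
      "set (tl p) \<inter> (F \<union> set q) = {}" "set p \<subseteq> V" "distinct p" "length p \<le> h + 1"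
    proof -
      have "\<exists>q'. q' \<noteq> [] \<and> hd q' = w \<and> \<sigma> (last q') = 0 \<and> path_edges q' \<subseteq> E\<inverse> - D\<inverse> \<and> set (tl q') \<inter> (F
          \<union> set q) = {} \<and>
        set q' \<subseteq> V \<and> distinct q' \<and> length q' \<le> h + 1"
      proof (rule descent[OF V rk(2) _ _ w])
        show "card (outs (D\<inverse>) z) + card (F \<union> set q) < r" for z
        proof -
          have "card (F \<union> set q) \<le> card F + length q"
            using card_Un_le[of F "set q"] card_length[of q] by linarith
          then show ?thesis using Dz(2)[of z] cardF r q(8) by (simp add: outs_converse)
        qed
      qed (use finD finF in auto)
      then show ?thesis using that by blast
    qed
    define a' where "a' = a(j := rev p)"
    define b' where "b' = b(j := q)"
    have same: "a' i = a i" "b' i = b i" if "i \<in> J" for i using that J(3) by (auto simp: a'_def b'_def)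
    have new: "a' j = rev p" "b' j = q" by (simp_all add: a'_def b'_def)
    have sp: "set p = insert w (set (tl p))" using p(1,2) by (cases p) auto
    have sq: "set q = insert w (set (tl q))" using q(1,2) by (cases q) auto
    have wq: "w \<notin> set (tl q)" using q(1,2,7) by (cases q) auto
    have jthr: "through V E \<rho> \<sigma> h w (rev p) q"
    proof -
      have "distinct (rev p @ tl q)" using p(5,7) q(7) wq sp sq by (auto simp: distinct_tl)
      then show ?thesis
        using p q by (auto simp: through_def last_rev hd_rev path_edges_rev)
    qed
    have newF: "v \<notin> F" if "v \<in> set (rev p) \<union> set q" "v \<noteq> w" for v
      using that sp sq p(5) q(5) by auto
    have disj: "(path_edges (a i) \<union> path_edges (b i)) \<inter> (path_edges (rev p) \<union> path_edges q) = {} \<and>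
        (fst i = w \<longrightarrow> vs i \<inter> (set (rev p) \<union> set q) \<subseteq> {w})" if "i \<in> J" for i
    proof
      have "path_edges (rev p) \<union> path_edges q \<subseteq> - D" using p(4) q(4) by (auto simp: path_edges_rev)
      moreover have "path_edges (a i) \<union> path_edges (b i) \<subseteq> D" using pe[OF that] that by (auto simp:
          D_def)
      ultimately show "(path_edges (a i) \<union> path_edges (b i)) \<inter> (path_edges (rev p) \<union> path_edges q) =
          {}" by blast
      show "fst i = w \<longrightarrow> vs i \<inter> (set (rev p) \<union> set q) \<subseteq> {w}"
      proof (intro impI subsetI)
        fix v assume "fst i = w" "v \<in> vs i \<inter> (set (rev p) \<union> set q)"
        moreover then have "v \<in> F" using that unfolding F_def by blast
        ultimately show "v \<in> {w}" using newF by blast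
      qed
    qed
    have "good (insert j J) a' b'"
      unfolding good_def
    proof (intro conjI allI)
      show "\<forall>i\<in>insert j J. through V E \<rho> \<sigma> h (fst i) (a' i) (b' i)"
        using jthr thr by (auto simp: new same w_def)
      have old: "(path_edges (a i) \<union> path_edges (b i)) \<inter> (path_edges (a i') \<union> path_edges (b i')) = {} \<and>
          (fst i = fst i' \<longrightarrow> vs i \<inter> vs i' \<subseteq> {fst i})" if "i \<in> J" "i' \<in> J" "i \<noteq> i'" for i i'
        using J(4) that unfolding good_def vs_def by blast
      show "\<forall>i\<in>insert j J. \<forall>i'\<in>insert j J. i \<noteq> i' \<longrightarrow>
        (path_edges (a' i) \<union> path_edges (b' i)) \<inter> (path_edges (a' i') \<union> path_edges (b' i')) = {} \<and>
        (fst i = fst i' \<longrightarrow> (set (a' i) \<union> set (b' i)) \<inter> (set (a' i') \<union> set (b' i')) \<subseteq> {fst i})"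
      proof (intro ballI impI)
        fix i i' assume i: "i \<in> insert j J" "i' \<in> insert j J" "i \<noteq> i'"
        consider "i \<in> J" "i' \<in> J" | "i = j" "i' \<in> J" | "i \<in> J" "i' = j" using i by auto
        then show "(path_edges (a' i) \<union> path_edges (b' i)) \<inter> (path_edges (a' i') \<union> path_edges (b'
            i')) = {} \<and>
        (fst i = fst i' \<longrightarrow> (set (a' i) \<union> set (b' i)) \<inter> (set (a' i') \<union> set (b' i')) \<subseteq> {fst i})"
        proof cases
          case 1 then show ?thesis using old[OF 1 i(3)] by (simp add: same vs_def)
        next
          case 2 then show ?thesis using disj[OF 2(2)] 2 by (auto simp: same new vs_def w_def
              Int_commute)
        next
          case 3 then show ?thesis using disj[OF 3(1)] by (simp add: same new vs_def w_def)
        qed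
      qed
      fix v
      have A: "{i\<in>insert j J. v \<in> set (a' i) \<union> set (b' i)} =
          (if v \<in> set (rev p) \<union> set q then insert j {i\<in>J. v \<in> vs i} else {i\<in>J. v \<in> vs i})"
      proof -
        have "{i\<in>J. v \<in> set (a' i) \<union> set (b' i)} = {i\<in>J. v \<in> vs i}"
          by (intro Collect_cong conj_cong refl) (simp add: same vs_def)
        then show ?thesis
          using Collect_insert_if[of j J "\<lambda>i. v \<in> set (a' i) \<union> set (b' i)"] by (simp only: new)
      qed
      have B: "{i\<in>insert j J. fst i = v} = (if v = w then insert j {i\<in>J. fst i = v} else {i\<in>J. fst i
          = v})"
        using Collect_insert_if[of j J "\<lambda>i. fst i = v"] by (simp add: w_def eq_commute)
      show "card {i\<in>insert j J. v \<in> set (a' i) \<union> set (b' i)} \<le> cap + card {i\<in>insert j J. fst i = v}"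
      \<comment> \<open>At \<open>w\<close> both sides of the load bound grow by at most one on the
        left and exactly one on the right. Any other vertex of the new path lies outside
        \<open>F\<close> and so had load below \<open>cap\<close>.\<close>
      proof (cases "v = w")
        case True
        have "card {i\<in>insert j J. v \<in> set (a' i) \<union> set (b' i)} \<le> Suc (card {i\<in>J. v \<in> vs i})"
          unfolding A using J(1,3) by auto
        moreover have "card {i\<in>insert j J. fst i = v} = Suc (card {i\<in>J. fst i = v})"
          unfolding B using J(1,3) True by simp
        ultimately show ?thesis using load[of v] by simp
      next
        case False
        show ?thesis
        proof (cases "v \<in> set (rev p) \<union> set q")
          case True
          then have "v \<notin> F" "v \<in> V" using newF False p(6) q(6) by auto
          then have "card {i\<in>J. v \<in> vs i} < cap" by (auto simp: F_def)
          moreover have "card {i\<in>insert j J. v \<in> set (a' i) \<union> set (b' i)} \<le> Suc (card {i\<in>J. v \<in> vs i})"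
            unfolding A using J(1,3) by auto
          ultimately show ?thesis by linarith
        next
          case nin: False
          then show ?thesis unfolding A B using load[of v] False by auto
        qed
      qed
    qed
    then show ?thesis by blast
  qed
  have ex: "J \<subseteq> V \<times> {..<s} \<Longrightarrow> \<exists>a b. good J a b" if "finite J" for J
    using that
  proof (induction J rule: finite_induct)
    case empty then show ?case by (auto simp: good_def)
  next
    case (insert j J) then show ?case using step[of J j] by auto
  qed
  obtain a b where ab: "good (V \<times> {..<s}) a b" using ex[of "V \<times> {..<s}"] V by blast
  have "card {j\<in>V \<times> {..<s}. fst j = v} \<le> s" for v
  proof -
    have "{j\<in>V \<times> {..<s}. fst j = v} \<subseteq> Pair v ` {..<s}" by auto
    then have "card {j\<in>V \<times> {..<s}. fst j = v} \<le> card (Pair v ` {..<s})" by (intro card_mono) auto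
    also have "\<dots> \<le> s" using card_image_le[of "{..<s}" "Pair v"] by simp
    finally show ?thesis .
  qed
  moreover have "card {j\<in>V \<times> {..<s}. v \<in> set (a j) \<union> set (b j)} \<le> cap + card {j\<in>V \<times> {..<s}. fst j =
      v}" for v
    using ab unfolding good_def by (elim conjE allE)
  ultimately have "card {j\<in>V \<times> {..<s}. v \<in> set (a j) \<union> set (b j)} \<le> cap + s" for v
    by (meson add_left_mono order_trans)
  with ab show ?thesis unfolding good_def by (intro exI[of _ a] exI[of _ b]) simp
qed

section \<open>Crossing with reserved paths\<close>

lemma path_dec_verts:
  assumes "path_dec G Q" "G \<subseteq> V \<times> V" "q \<in> Q"
  shows "set q \<subseteq> V"
proof
  fix x assume "x \<in> set q"
  moreover have "simple_path q" "path_edges q \<subseteq> G" using assms by (auto simp: path_dec_def)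
  ultimately show "x \<in> V" using path_edges_covers[of q x] assms(2) by (fastforce simp: simple_path_def)
qed

text \<open>\<open>P\<close> says that \<open>w\<close> is a vertex where paths should start. Then
  no fewer paths start than end at \<open>w\<close>, so every end can be paired with its own start;
  in the other case every start is paired with an end. The wrong kind is exhausted in this way, and
  the bound \<open>s\<close> on its number bounds the number of crossings at
  \<open>w\<close>.\<close>

lemma end_matching:
  assumes Q: "path_dec G Q"
    and pos: "P \<Longrightarrow> 0 \<le> arc_excess G w \<and> card {q\<in>Q. last q = w} \<le> s"
    and neg: "\<not> P \<Longrightarrow> arc_excess G w \<le> 0 \<and> card {q\<in>Q. hd q = w} \<le> s"
  shows "\<exists>X Y g. X \<subseteq> {q\<in>Q. last q = w} \<and> Y \<subseteq> {q\<in>Q. hd q = w} \<and> bij_betw g X Y \<and> card X \<le> s \<and>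
    (P \<longrightarrow> X = {q\<in>Q. last q = w}) \<and> (\<not> P \<longrightarrow> Y = {q\<in>Q. hd q = w})"
proof -
  let ?X = "{q\<in>Q. last q = w}" and ?Y = "{q\<in>Q. hd q = w}"
  have fin: "finite ?X" "finite ?Y" using Q by (auto simp: path_dec_def)
  have ex: "arc_excess G w = int (card ?Y) - int (card ?X)" by (rule path_dec_arc_excess[OF Q])
  show ?thesis
  proof (cases P)
    case True
    then have "card ?X \<le> card ?Y" using pos ex by linarith
    then obtain Y where Y: "Y \<subseteq> ?Y" "card Y = card ?X" by (rule obtain_subset_with_card_n)
    have "finite Y" using Y(1) fin(2) by (rule finite_subset)
    from finite_same_card_bij[OF fin(1) this Y(2)[symmetric]] obtain g where "bij_betw g ?X Y" ..
    then show ?thesis using True Y pos by (intro exI[of _ ?X] exI[of _ Y] exI[of _ g]) auto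
  next
    case False
    then have "card ?Y \<le> card ?X" using neg ex by linarith
    then obtain X where X: "X \<subseteq> ?X" "card X = card ?Y" by (rule obtain_subset_with_card_n)
    have "finite X" using X(1) fin(1) by (rule finite_subset)
    from finite_same_card_bij[OF this fin(2) X(2)] obtain g where "bij_betw g X ?Y" ..
    then show ?thesis using False X neg by (intro exI[of _ X] exI[of _ ?Y] exI[of _ g]) auto
  qed
qed

text \<open>Choose in every offending \<open>W i\<close> a point of \<open>S\<close> other than
  \<open>w\<close>. These points are distinct because the sets meet only in \<open>w\<close>. Hence
  a small \<open>S\<close> spoils few reserved paths at \<open>w\<close>.\<close>

lemma disjoint_sets_card_le:
  assumes "finite I" "finite S"
    and "\<And>i j. i \<in> I \<Longrightarrow> j \<in> I \<Longrightarrow> i \<noteq> j \<Longrightarrow> W i \<inter> W j \<subseteq> {w}"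
  shows "card {i\<in>I. \<not> W i \<inter> S \<subseteq> {w}} \<le> card S"
proof -
  define f where "f i = (SOME x. x \<in> W i \<inter> S - {w})" for i
  have f: "f i \<in> W i \<inter> S - {w}" if "i \<in> {i\<in>I. \<not> W i \<inter> S \<subseteq> {w}}" for i
    unfolding f_def by (rule someI_ex) (use that in auto)
  have "inj_on f {i\<in>I. \<not> W i \<inter> S \<subseteq> {w}}"
  proof (rule inj_onI, rule ccontr)
    fix i j assume ij: "i \<in> {i\<in>I. \<not> W i \<inter> S \<subseteq> {w}}" "j \<in> {i\<in>I. \<not> W i \<inter> S \<subseteq> {w}}" "f i = f j" "i \<noteq> j"
    have "f i \<in> W i \<inter> W j" "f i \<noteq> w" using f[OF ij(1)] f[OF ij(2)] ij(3) by auto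
    then show False using assms(3)[of i j] ij by auto
  qed
  moreover have "f ` {i\<in>I. \<not> W i \<inter> S \<subseteq> {w}} \<subseteq> S" using f by blast
  ultimately show ?thesis using assms(2) by (rule card_inj_on_le)
qed

text \<open>
  If one path ends and another one starts at \<open>w\<close>, then a third path through \<open>w\<close>
  can be cut at \<open>w\<close> and its two halves glued to them.
\<close>
lemma crossing:
  fixes V :: "'a set"
  assumes V: "finite V" and E: "E \<subseteq> V \<times> V"
    and thr: "\<And>j. j \<in> V \<times> {..<s'} \<Longrightarrow> through V E \<rho> \<sigma> h (fst j) (a j) (b j)"
    and dis: "\<And>j j'. j \<in> V \<times> {..<s'} \<Longrightarrow> j' \<in> V \<times> {..<s'} \<Longrightarrow> j \<noteq> j' \<Longrightarrow>
       (path_edges (a j) \<union> path_edges (b j)) \<inter> (path_edges (a j') \<union> path_edges (b j')) = {} \<and>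
       (fst j = fst j' \<longrightarrow> (set (a j) \<union> set (b j)) \<inter> (set (a j') \<union> set (b j')) \<subseteq> {fst j})"
    and Pos: "\<And>x. x \<in> V \<Longrightarrow> \<sigma> x = 0 \<Longrightarrow> Pos x" "\<And>x. x \<in> V \<Longrightarrow> \<rho> x = 0 \<Longrightarrow> \<not> Pos x"
    and G: "G = E - (\<Union>j\<in>V \<times> {..<s'}. path_edges (a j) \<union> path_edges (b j))"
    and Q: "path_dec G Q" "\<And>q. q \<in> Q \<Longrightarrow> length q \<le> l + 1"
    and pos: "\<And>w. w \<in> V \<Longrightarrow> Pos w \<Longrightarrow> 0 \<le> arc_excess G w \<and> card {q\<in>Q. last q = w} \<le> s"
    and neg: "\<And>w. w \<in> V \<Longrightarrow> \<not> Pos w \<Longrightarrow> arc_excess G w \<le> 0 \<and> card {q\<in>Q. hd q = w} \<le> s"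
    and s: "s + 2 * (l + 1) + 2 * (h + 1) < s'"
  shows "\<exists>Q'. path_dec E Q' \<and> (\<forall>q\<in>Q'. Pos (hd q) \<and> \<not> Pos (last q))"
proof -
  let ?J = "V \<times> {..<s'}"
  have GV: "G \<subseteq> V \<times> V" using E G by auto
  have finQ: "finite Q" and dp: "\<And>q. q \<in> Q \<Longrightarrow> simple_path q" using Q by (auto simp: path_dec_def)
  have qV: "hd q \<in> V" "last q \<in> V" if "q \<in> Q" for q
    using path_dec_verts[OF Q(1) GV that] dp[OF that] by auto
  define \<Phi> where "\<Phi> w X Y g \<longleftrightarrow> X \<subseteq> {q\<in>Q. last q = w} \<and> Y \<subseteq> {q\<in>Q. hd q = w} \<and> bij_betw g X Y \<and> card X
      \<le> s \<and>
    (Pos w \<longrightarrow> X = {q\<in>Q. last q = w}) \<and> (\<not> Pos w \<longrightarrow> Y = {q\<in>Q. hd q = w})" for w X Y g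
  have ex: "\<forall>w\<in>V. \<exists>X Y g. \<Phi> w X Y g"
  proof
    fix w assume w: "w \<in> V"
    show "\<exists>X Y g. \<Phi> w X Y g"
      unfolding \<Phi>_def by (rule end_matching[OF Q(1) pos[OF w] neg[OF w]])
  qed
  obtain X where exX: "\<forall>w\<in>V. \<exists>Y g. \<Phi> w (X w) Y g" by (rule exE[OF bchoice[OF ex]])
  obtain Y where exY: "\<forall>w\<in>V. \<exists>g. \<Phi> w (X w) (Y w) g" by (rule exE[OF bchoice[OF exX]])
  obtain g where "\<forall>w\<in>V. \<Phi> w (X w) (Y w) (g w)" by (rule exE[OF bchoice[OF exY]])
  then have XY: "X w \<subseteq> {q\<in>Q. last q = w} \<and> Y w \<subseteq> {q\<in>Q. hd q = w} \<and>
    bij_betw (g w) (X w) (Y w) \<and> card (X w) \<le> s \<and>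
    (Pos w \<longrightarrow> X w = {q\<in>Q. last q = w}) \<and> (\<not> Pos w \<longrightarrow> Y w = {q\<in>Q. hd q = w})" if "w \<in> V" for w
    using that by (simp add: \<Phi>_def)
  \<comment> \<open>\<open>D\<close> collects the paths whose end will be crossed away, and
    \<open>f q\<close> is the path starting where \<open>q\<close> ends that is treated together
    with \<open>q\<close>. By \<open>total\<close> and \<open>onto\<close>, all ends and starts of
    the wrong kind take part.\<close>
  define D where "D = {q\<in>Q. q \<in> X (last q)}"
  define f where "f q = g (last q) q" for q
  have fY: "f q \<in> Y (last q)" if "q \<in> D" for q
  proof -
    have "q \<in> X (last q)" "bij_betw (g (last q)) (X (last q)) (Y (last q))"
      using XY[of "last q"] that qV(2)[of q] by (simp_all add: D_def)
    then show ?thesis unfolding f_def by (metis bij_betw_apply)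
  qed
  have fQ: "f q \<in> Q" and hd_f: "hd (f q) = last q" if "q \<in> D" for q
    using fY[OF that] XY[of "last q"] that qV(2)[of q] by (auto simp: D_def)
  have inj_f: "q = q'" if "q \<in> D" "q' \<in> D" "f q = f q'" for q q'
  proof -
    have eq: "last q = last q'" using hd_f that by metis
    have "inj_on (g (last q)) (X (last q))" using XY[of "last q"] that qV(2)[of q] by (auto simp:
        D_def bij_betw_def)
    then show ?thesis using that eq by (auto simp: D_def f_def inj_on_def)
  qed
  have onto: "q \<in> f ` D" if q: "q \<in> Q" "\<not> Pos (hd q)" for q
  proof -
    let ?w = "hd q"
    have "q \<in> g ?w ` X ?w" using XY[OF qV(1)[OF q(1)]] q by (auto simp: bij_betw_def)
    then obtain p where "p \<in> X ?w" "q = g ?w p" by auto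
    moreover have "p \<in> Q" "last p = ?w" using XY[OF qV(1)[OF q(1)]] \<open>p \<in> X ?w\<close> by auto
    ultimately show ?thesis by (auto simp: D_def f_def intro!: image_eqI[of _ _ p])
  qed
  have total: "q \<in> D" if "q \<in> Q" "Pos (last q)" for q
    using XY[OF qV(2)[OF that(1)]] that by (auto simp: D_def)
  have DQ: "D \<subseteq> Q" and finD: "finite D" using finQ by (auto simp: D_def)
  \<comment> \<open>\<open>\<pi> q\<close> selects the reserved path at \<open>last q\<close>: its
    rear half will follow \<open>q\<close> and its front half will precede \<open>f q\<close>. The
    clause for \<open>f q \<in> D'\<close> concerns the two halves attached to the same path
    \<open>f q\<close>, one at each end.\<close>
  define ok where "ok D' \<pi> \<longleftrightarrow> (\<forall>q\<in>D'. \<pi> q < s' \<and> set (b (last q, \<pi> q)) \<inter> set q \<subseteq> {last q} \<and>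
      set (a (last q, \<pi> q)) \<inter> set (f q) \<subseteq> {last q} \<and>
      (f q \<in> D' \<longrightarrow> set (a (last q, \<pi> q)) \<inter> set (b (last (f q), \<pi> (f q))) = {})) \<and>
    (\<forall>q\<in>D'. \<forall>q'\<in>D'. q \<noteq> q' \<longrightarrow> last q = last q' \<longrightarrow> \<pi> q \<noteq> \<pi> q')" for D' and \<pi> :: "'a list \<Rightarrow> nat"
  have step: "\<exists>\<pi>'. ok (insert q D') \<pi>'" if D': "insert q D' \<subseteq> D" "q \<notin> D'" "ok D' \<pi>" for q D' \<pi>
  proof -
    let ?w = "last q"
    have qD: "q \<in> D" and qQ: "q \<in> Q" using D'(1) DQ by auto
    have w: "?w \<in> V" using qV(2)[OF qQ] .
    have finD': "finite D'" by (rule finite_subset[OF _ finD]) (use D'(1) in auto)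
    have okD: "\<pi> p < s' \<and> set (b (last p, \<pi> p)) \<inter> set p \<subseteq> {last p} \<and>
      set (a (last p, \<pi> p)) \<inter> set (f p) \<subseteq> {last p} \<and>
      (f p \<in> D' \<longrightarrow> set (a (last p, \<pi> p)) \<inter> set (b (last (f p), \<pi> (f p))) = {})" if "p \<in> D'" for p
      using D'(3) that unfolding ok_def by blast
    \<comment> \<open>\<open>SB\<close> is the rear half already attached to \<open>f q\<close>, and
      \<open>SA\<close> is the front half already attached to \<open>q\<close>. The new halves have
      to miss them, as well as \<open>q\<close> and \<open>f q\<close>, except at
      \<open>?w\<close>.\<close>
    define SB where "SB = (if f q \<in> D' then set (b (last (f q), \<pi> (f q))) else {})"
    define SA where "SA = (\<Union>p\<in>{p\<in>D'. f p = q}. set (a (last p, \<pi> p)))"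
    define S where "S = set q \<union> set (f q) \<union> SB \<union> SA"
    have jJ: "(last p, \<pi> p) \<in> ?J" if "p \<in> D'" for p
    proof -
      have "p \<in> Q" using D'(1) DQ that by blast
      then show ?thesis using qV(2)[of p] okD[OF that] by simp
    qed
    have cSB: "card SB \<le> h + 1"
    proof (cases "f q \<in> D'")
      case True
      then show ?thesis using thr[OF jJ[OF True]] card_length[of "b (last (f q), \<pi> (f q))"]
        by (auto simp: SB_def through_def)
    qed (simp add: SB_def)
    have cSA: "card SA \<le> h + 1"
    proof (cases "\<exists>p\<in>D'. f p = q")
      case True
      then obtain p where p: "p \<in> D'" "f p = q" by auto
      then have "{p\<in>D'. f p = q} = {p}" using inj_f D'(1) by blast
      then have "SA = set (a (last p, \<pi> p))" by (simp add: SA_def)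
      then show ?thesis using thr[OF jJ[OF p(1)]] card_length[of "a (last p, \<pi> p)"]
        by (auto simp: through_def)
    next
      case False
      then have "SA = {}" by (auto simp: SA_def)
      then show ?thesis by simp
    qed
    have cq: "card (set q) \<le> l + 1" "card (set (f q)) \<le> l + 1"
      using card_length[of q] card_length[of "f q"] Q(2)[OF qQ] Q(2)[OF fQ[OF qD]] by linarith+
    have "card S \<le> card (set q) + card (set (f q)) + card SB + card SA"
      unfolding S_def using card_Un_le[of "set q \<union> set (f q) \<union> SB" SA]
        card_Un_le[of "set q \<union> set (f q)" SB] card_Un_le[of "set q" "set (f q)"] by linarith
    also have "\<dots> \<le> (l + 1) + (l + 1) + (h + 1) + (h + 1)" by (intro add_mono cq cSB cSA)
    finally have cS: "card S \<le> 2 * (l + 1) + 2 * (h + 1)" by simp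
    have finS: "finite S" using finD' by (auto simp: S_def SB_def SA_def)
    \<comment> \<open>Two kinds of indices are excluded: those taken by other paths ending at
      \<open>?w\<close>, at most \<open>s\<close> in number, and those whose reserved path meets
      \<open>S\<close> off \<open>?w\<close>, at most \<open>card S\<close>.\<close>
    let ?I1 = "\<pi> ` {p\<in>D'. last p = ?w}"
    let ?I2 = "{i\<in>{..<s'}. \<not> (set (a (?w, i)) \<union> set (b (?w, i))) \<inter> S \<subseteq> {?w}}"
    have cI1: "card ?I1 \<le> s"
    proof -
      have "card ?I1 \<le> card {p\<in>D'. last p = ?w}" by (rule card_image_le) (use finD' in auto)
      also have "\<dots> \<le> card (X ?w)"
        by (rule card_mono) (use XY[OF w] finQ D'(1) in \<open>auto simp: D_def intro: finite_subset[of _ Q]\<close>)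
      also have "\<dots> \<le> s" using XY[OF w] by simp
      finally show ?thesis .
    qed
    have cI2: "card ?I2 \<le> card S"
    proof (rule disjoint_sets_card_le)
      fix i j assume "i \<in> {..<s'}" "j \<in> {..<s'}" "i \<noteq> j"
      then show "(set (a (?w, i)) \<union> set (b (?w, i))) \<inter> (set (a (?w, j)) \<union> set (b (?w, j))) \<subseteq> {?w}"
        using dis[of "(?w, i)" "(?w, j)"] w by simp
    qed (use finS in auto)
    have "card (?I1 \<union> ?I2) \<le> card ?I1 + card ?I2" by (rule card_Un_le)
    also have "\<dots> \<le> s + (2 * (l + 1) + 2 * (h + 1))"
      by (intro add_mono cI1 order_trans[OF cI2 cS])
    also have "\<dots> < card {..<s'}" using s by simp
    finally have small: "card (?I1 \<union> ?I2) < card {..<s'}" .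
    have "\<not> {..<s'} \<subseteq> ?I1 \<union> ?I2"
    proof
      assume "{..<s'} \<subseteq> ?I1 \<union> ?I2"
      from card_mono[OF _ this] small show False using finD' by simp
    qed
    then obtain i where i: "i < s'" "i \<notin> ?I1" "i \<notin> ?I2" by auto
    have iS: "(set (a (?w, i)) \<union> set (b (?w, i))) \<inter> S \<subseteq> {?w}" using i by auto
    define \<pi>' where "\<pi>' = \<pi>(q := i)"
    have old: "\<pi>' p = \<pi> p" if "p \<in> D'" for p using that D'(2) by (auto simp: \<pi>'_def)
    have new: "\<pi>' q = i" by (simp add: \<pi>'_def)
    have fne: "f q \<noteq> q" using hd_f[OF qD] simple_path_hd_last[OF dp[OF qQ]] by auto
    have "ok (insert q D') \<pi>'"
      unfolding ok_def
    proof (intro conjI ballI impI)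
      fix p assume p: "p \<in> insert q D'"
      show "\<pi>' p < s'" using p i okD old new by auto
      show "set (b (last p, \<pi>' p)) \<inter> set p \<subseteq> {last p}"
        using p iS okD[of p] old[of p] new by (auto simp: S_def)
      show "set (a (last p, \<pi>' p)) \<inter> set (f p) \<subseteq> {last p}"
        using p iS okD[of p] old[of p] new by (auto simp: S_def)
      show "set (a (last p, \<pi>' p)) \<inter> set (b (last (f p), \<pi>' (f p))) = {}" if fp: "f p \<in> insert q D'"
      proof -
        consider "p \<in> D'" "f p \<in> D'" | "p = q" "f p \<in> D'" | "p \<in> D'" "f p = q"
          using p fp fne D'(2) by auto
        then show ?thesis
        proof cases
          case 1 then show ?thesis using okD[of p] old by simp
        next
          case 2
          \<comment> \<open>The choice of \<open>i\<close> still permits a common vertex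
            \<open>?w\<close>. It is ruled out because the old rear half meets \<open>f q\<close>
            only at its last vertex, whereas \<open>?w\<close> is its first. The remaining case is
            the mirror image.\<close>
          have "?w \<in> set (f q)" using hd_f[OF qD] dp[OF fQ[OF qD]] by (metis simple_path_ne hd_in_set)
          moreover have "set (b (last (f q), \<pi> (f q))) \<inter> set (f q) \<subseteq> {last (f q)}" using okD[of "f
              q"] 2 by simp
          moreover have "last (f q) \<noteq> ?w" using simple_path_hd_last[OF dp[OF fQ[OF qD]]] hd_f[OF qD]
              by simp
          ultimately have "?w \<notin> set (b (last (f q), \<pi> (f q)))" by auto
          moreover have "set (b (last (f q), \<pi> (f q))) \<subseteq> S" using 2 by (auto simp: S_def SB_def)
          ultimately show ?thesis using iS 2 old new by auto
        next
          case 3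
          have "?w \<in> set q" using dp[OF qQ] by (metis simple_path_ne last_in_set)
          moreover have "set (a (last p, \<pi> p)) \<inter> set q \<subseteq> {last p}" using okD[of p] 3 by auto
          moreover have "last p \<noteq> ?w" using simple_path_hd_last[OF dp[OF qQ]] hd_f[of p] 3 D'(1) by auto
          ultimately have "?w \<notin> set (a (last p, \<pi> p))" by auto
          moreover have "set (a (last p, \<pi> p)) \<subseteq> S" using 3 by (auto simp: S_def SA_def)
          ultimately show ?thesis using iS 3 old new by auto
        qed
      qed
      fix p' assume p': "p' \<in> insert q D'" "p \<noteq> p'" "last p = last p'"
      have "\<pi> p \<noteq> \<pi> p'" if "p \<in> D'" "p' \<in> D'"
        using D'(3) that p' unfolding ok_def by blast
      moreover have "\<pi> r \<noteq> i" if "r \<in> D'" "last r = ?w" for r using i(2) that by blast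
      ultimately show "\<pi>' p \<noteq> \<pi>' p'" using p p' old new by (metis insert_iff)
    qed
    then show ?thesis by blast
  qed
  have "D' \<subseteq> D \<Longrightarrow> \<exists>\<pi>. ok D' \<pi>" if "finite D'" for D'
    using that
  proof (induction D' rule: finite_induct)
    case empty then show ?case by (simp add: ok_def)
  next
    case (insert q D')
    then obtain \<pi> where "ok D' \<pi>" by auto
    then show ?case using step insert by blast
  qed
  then obtain \<pi> where \<pi>: "ok D \<pi>" using finD by blast
  define idx where "idx q = (last q, \<pi> q)" for q
  have idx: "idx q \<in> ?J" if "q \<in> D" for q
    using \<pi> that qV(2)[of q] DQ by (auto simp: idx_def ok_def)
  have okD: "set (b (idx q)) \<inter> set q \<subseteq> {last q}" "set (a (idx q)) \<inter> set (f q) \<subseteq> {last q}"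
    "f q \<in> D \<Longrightarrow> set (a (idx q)) \<inter> set (b (idx (f q))) = {}" if "q \<in> D" for q
    using \<pi> that unfolding ok_def idx_def by blast+
  have inj_idx: "q = q'" if "q \<in> D" "q' \<in> D" "idx q = idx q'" for q q'
    using \<pi> that unfolding ok_def idx_def by blast
  have thr': "a j \<noteq> []" "b j \<noteq> []" "last (a j) = fst j" "hd (b j) = fst j" "distinct (a j @ tl (b j))"
     "distinct (a j)" "distinct (b j)" "Pos (hd (a j))" "\<not> Pos (last (b j))"
     "path_edges (a j) \<subseteq> E" "path_edges (b j) \<subseteq> E" "path_edges (a j) \<inter> path_edges (b j) = {}"
    if "j \<in> ?J" for j
  proof -
    note t = thr[OF that, unfolded through_def]
    show 1: "a j \<noteq> []" "b j \<noteq> []" "last (a j) = fst j" "hd (b j) = fst j" "distinct (a j @ tl (b j))"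
     "distinct (a j)" "path_edges (a j) \<subseteq> E" "path_edges (b j) \<subseteq> E" using t by auto
    have "hd (a j) \<in> V" "last (b j) \<in> V" using t by (auto dest: hd_in_set last_in_set)
    then show "Pos (hd (a j))" "\<not> Pos (last (b j))" using t Pos by auto
    have "hd (b j) \<in> set (a j)" using 1 by (metis last_in_set)
    then show "distinct (b j)" using 1 by (cases "b j") auto
    show "path_edges (a j) \<inter> path_edges (b j) = {}"
    proof (rule ccontr)
      assume "\<not> ?thesis"
      then obtain x y where xy: "(x, y) \<in> path_edges (a j)" "(x, y) \<in> path_edges (b j)" by auto
      have "y \<in> set (tl (b j))"
        using path_edges_verts[OF xy(2)] path_edges_not_hd[OF \<open>distinct (b j)\<close> xy(2)] 1 by (cases "b
            j") auto
      then show False using path_edges_verts[OF xy(1)] 1 by auto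
    qed
  qed
  \<comment> \<open>Where no half is attached, a one-vertex list takes its place, so that one
    formula glues all paths.\<close>
  define front where "front q = (if q \<in> f ` D then a (idx (the_inv_into D f q)) else [hd q])" for q
  define rear where "rear q = (if q \<in> D then b (idx q) else [last q])" for q
  have front_f: "front (f p) = a (idx p)" if "p \<in> D" for p
    using that inj_f by (auto simp: front_def the_inv_into_f_f inj_on_def)
  have front0: "front q \<noteq> [] \<and> last (front q) = hd q \<and> distinct (front q) \<and> set (front q) \<inter> set q \<subseteq>
      {hd q} \<and> Pos (hd (front q))" if "q \<in> Q" for q
  proof (cases "q \<in> f ` D")
      case True
      then obtain p where p: "p \<in> D" "q = f p" by auto
      show "front q \<noteq> [] \<and> last (front q) = hd q \<and> distinct (front q) \<and> set (front q) \<inter> set q \<subseteq> {hd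
          q} \<and> Pos (hd (front q))"
        using thr'[OF idx[OF p(1)]] okD[OF p(1)] hd_f[OF p(1)] by (simp add: p front_f) (simp add:
            idx_def)
    next
      case False
      then show "front q \<noteq> [] \<and> last (front q) = hd q \<and> distinct (front q) \<and> set (front q) \<inter> set q \<subseteq>
          {hd q} \<and> Pos (hd (front q))"
        using onto[OF that] by (auto simp: front_def)
  qed
  have front: "front q \<noteq> []" "last (front q) = hd q" "distinct (front q)" "set (front q) \<inter> set q \<subseteq>
      {hd q}"
      "Pos (hd (front q))" if "q \<in> Q" for q
    using front0[OF that] by simp_all
  have rear0: "rear q \<noteq> [] \<and> hd (rear q) = last q \<and> distinct (rear q) \<and> set (rear q) \<inter> set q \<subseteq> {last
      q} \<and> \<not> Pos (last (rear q))" if "q \<in> Q" for q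
  proof (cases "q \<in> D")
      case True
      then show "rear q \<noteq> [] \<and> hd (rear q) = last q \<and> distinct (rear q) \<and> set (rear q) \<inter> set q \<subseteq>
          {last q} \<and> \<not> Pos (last (rear q))"
        using thr'[OF idx[OF True]] okD[OF True] by (simp add: rear_def) (simp add: idx_def)
    next
      case False
      then show "rear q \<noteq> [] \<and> hd (rear q) = last q \<and> distinct (rear q) \<and> set (rear q) \<inter> set q \<subseteq>
          {last q} \<and> \<not> Pos (last (rear q))"
        using total[OF that] by (auto simp: rear_def)
  qed
  have rear: "rear q \<noteq> []" "hd (rear q) = last q" "distinct (rear q)" "set (rear q) \<inter> set q \<subseteq> {last q}"
      "\<not> Pos (last (rear q))" if "q \<in> Q" for q
    using rear0[OF that] by simp_all
  have front_rear: "set (front q) \<inter> set (rear q) = {}" if "q \<in> Q" for q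
  proof -
    have ne: "hd q \<noteq> last q" using simple_path_hd_last[OF dp[OF that]] .
    have lastq: "last q \<in> set q" "hd q \<in> set q" using dp[OF that] by (metis simple_path_ne
        last_in_set, metis simple_path_ne hd_in_set)
    show ?thesis
    proof (cases "q \<in> f ` D \<and> q \<in> D")
      case True
      then obtain p where p: "p \<in> D" "q = f p" by auto
      then show ?thesis using okD(3)[OF p(1)] True by (simp add: front_f rear_def)
    next
      case False
      then have "front q = [hd q] \<or> rear q = [last q]" by (auto simp: front_def rear_def)
      then show ?thesis using front(4)[OF that] rear(4)[OF that] ne lastq by auto
    qed
  qed
  define glue where "glue q = (front q @ tl q) @ tl (rear q)" for q
  have glue: "simple_path (glue q)" "hd (glue q) = hd (front q)" "last (glue q) = last (rear q)"
    "path_edges (glue q) = path_edges (front q) \<union> path_edges q \<union> path_edges (rear q)" if q: "q \<in> Q"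
        for q
  proof -
    have d: "distinct q" "2 \<le> length q" "q \<noteq> []" using dp[OF q] by (auto simp: simple_path_def)
    obtain x q' where xq: "q = x # q'" "q' \<noteq> []" using d that by (cases q; cases "tl q") auto
    obtain z b' where zb: "rear q = z # b'" using rear(1)[OF q] by (cases "rear q") auto
    have z: "z = last q'" using rear(2)[OF q] zb xq by simp
    show "hd (glue q) = hd (front q)" using front(1)[OF q] by (simp add: glue_def)
    show "last (glue q) = last (rear q)" using xq zb z by (simp add: glue_def)
    have "x \<notin> set q'" "z \<in> set q'" "z \<notin> set b'" "distinct b'"
      using d xq z rear(3)[OF q] zb by auto
    then have "distinct (glue q)"
      using front(1,3,4)[OF q] rear(4)[OF q] front_rear[OF q] d xq zb z by (auto simp: glue_def)
    moreover have "2 \<le> length (glue q)"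
    proof -
      have "0 < length (front q)" "0 < length q'" using front(1)[OF q] xq(2) by simp_all
      then have "2 \<le> length (front q) + length q' + length b'" by linarith
      moreover have "length (glue q) = length (front q) + length q' + length b'"
        unfolding glue_def zb by (simp add: xq(1))
      ultimately show ?thesis by linarith
    qed
    ultimately show "simple_path (glue q)" by (simp add: simple_path_def)
    have "path_edges (front q @ tl q) = path_edges (front q) \<union> path_edges q"
      using front(1,2)[OF q] d by (intro path_edges_join) auto
    moreover have "path_edges (glue q) = path_edges (front q @ tl q) \<union> path_edges (rear q)"
      unfolding glue_def using front(1)[OF q] rear(1,2)[OF q] xq by (intro path_edges_join) auto
    ultimately show "path_edges (glue q) = path_edges (front q) \<union> path_edges q \<union> path_edges (rear
        q)" by simp
  qed
  \<comment> \<open>Pieces are the paths of \<open>Q\<close> and the halves of reserved paths, and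
    \<open>K i\<close> lists the pieces of the final path \<open>P i\<close>. The sets
    \<open>K i\<close> partition the pieces, so disjointness and union carry over from pieces to
    final paths. Reserved paths not involved in any crossing stay whole.\<close>
  define I :: "('a list + 'a \<times> nat) set" where "I = Inl ` Q \<union> Inr ` (?J - idx ` D)"
  define P where "P i = (case i of Inl q \<Rightarrow> glue q | Inr j \<Rightarrow> a j @ tl (b j))" for i
  define piece where "piece x = (case x of Inl q \<Rightarrow> path_edges q
      | Inr (j, c) \<Rightarrow> if c then path_edges (a j) else path_edges (b j))" for x :: "'a list + ('a \<times>
          nat) \<times> bool"
  define K where "K i = (case i of
      Inl q \<Rightarrow> {Inl q} \<union> {Inr (idx p, True) |p. p \<in> D \<and> f p = q} \<union> {Inr (idx p, False) |p. p \<in> D \<and> p = q}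
    | Inr j \<Rightarrow> {Inr (j, True), Inr (j, False)})" for i
  let ?pieces = "Inl ` Q \<union> Inr ` (?J \<times> (UNIV :: bool set))"
  have K_sub: "K i \<subseteq> ?pieces" if "i \<in> I" for i
    using that idx by (fastforce simp: I_def K_def)
  have K_disj: "K i \<inter> K i' = {}" if "i \<in> I" "i' \<in> I" "i \<noteq> i'" for i i'
    using that by (auto simp: I_def K_def dest: inj_idx)
  have K_cover: "?pieces \<subseteq> (\<Union>i\<in>I. K i)"
  proof
    fix x assume "x \<in> ?pieces"
    then consider q where "q \<in> Q" "x = Inl q" | j c where "j \<in> ?J" "x = Inr (j, c)" by auto
    then show "x \<in> (\<Union>i\<in>I. K i)"
    proof cases
      case 1 then show ?thesis by (intro UN_I[of "Inl q"]) (auto simp: I_def K_def)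
    next
      case 2
      show ?thesis
      proof (cases "j \<in> idx ` D")
        case True
        then obtain q where q: "q \<in> D" "j = idx q" by auto
        show ?thesis
        proof (cases c)
          case True then show ?thesis
            using q 2 fQ[OF q(1)] by (intro UN_I[of "Inl (f q)"]) (auto simp: I_def K_def)
        next
          case False then show ?thesis
            using q 2 DQ by (intro UN_I[of "Inl q"]) (auto simp: I_def K_def)
        qed
      next
        case False then show ?thesis using 2 by (intro UN_I[of "Inr j"]) (auto simp: I_def K_def)
      qed
    qed
  qed
  have P_edges: "path_edges (P i) = (\<Union>x\<in>K i. piece x)" if "i \<in> I" for i
  proof (cases i)
    case (Inl q)
    then have q: "q \<in> Q" using that by (auto simp: I_def)
    have "path_edges (front q) = (\<Union>p\<in>{p\<in>D. f p = q}. path_edges (a (idx p)))"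
    proof (cases "q \<in> f ` D")
      case True
      then obtain p where p: "p \<in> D" "q = f p" by auto
      then have "{p\<in>D. f p = q} = {p}" using inj_f by auto
      then show ?thesis by (simp add: p front_f)
    qed (auto simp: front_def)
    moreover have "path_edges (rear q) = (\<Union>p\<in>{p\<in>D. p = q}. path_edges (b (idx p)))"
      by (auto simp: rear_def)
    ultimately show ?thesis using glue(4)[OF q] Inl by (auto simp: P_def K_def piece_def)
  next
    case (Inr j)
    then have "j \<in> ?J" using that by (auto simp: I_def)
    then show ?thesis using Inr path_edges_join[of "a j" "b j"] thr'(1-4)[of j] by (auto simp: P_def
        K_def piece_def)
  qed
  have piece_disj: "piece x \<inter> piece y = {}" if "x \<in> ?pieces" "y \<in> ?pieces" "x \<noteq> y" for x y
  proof -
    have QQ: "path_edges q \<inter> path_edges q' = {}" if "q \<in> Q" "q' \<in> Q" "q \<noteq> q'" for q q'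
      using Q(1) that by (auto simp: path_dec_def)
    have QG: "path_edges q \<subseteq> G" if "q \<in> Q" for q using Q(1) that by (auto simp: path_dec_def)
    have Gj: "piece (Inr (j, c)) \<inter> G = {}" if "j \<in> ?J" for j c
      unfolding G piece_def using that by auto
    have jj: "piece (Inr (j, c)) \<inter> piece (Inr (j', c')) = {}" if "j \<in> ?J" "j' \<in> ?J" "(j, c) \<noteq> (j',
        c')" for j j' c c'
    proof (cases "j = j'")
      case True then show ?thesis using thr'(12)[OF that(1)] that(3) by (auto simp: piece_def)
    next
      case False
      have "piece (Inr (j, c)) \<subseteq> path_edges (a j) \<union> path_edges (b j)"
        "piece (Inr (j', c')) \<subseteq> path_edges (a j') \<union> path_edges (b j')" by (auto simp: piece_def)
      then show ?thesis using dis[OF that(1,2) False] by blast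
    qed
    have Qj: "piece (Inl q) \<inter> piece (Inr (j, c)) = {}" if "q \<in> Q" "j \<in> ?J" for q j c
      using QG[OF that(1)] Gj[OF that(2), of c] by (auto simp: piece_def)
    have PP: "piece (Inl q) \<inter> piece (Inl q') = {}" if "q \<in> Q" "q' \<in> Q" "q \<noteq> q'" for q q'
      using QQ[OF that] by (simp add: piece_def)
    from \<open>x \<in> ?pieces\<close> consider q where "q \<in> Q" "x = Inl q" | j c where "j \<in> ?J" "x = Inr (j, c)" by
        auto
    then show ?thesis
    proof cases
      case x: 1
      from \<open>y \<in> ?pieces\<close> consider q' where "q' \<in> Q" "y = Inl q'" | j' c' where "j' \<in> ?J" "y = Inr
          (j', c')" by auto
      then show ?thesis using x PP Qj that(3) by cases auto
    next
      case x: 2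
      from \<open>y \<in> ?pieces\<close> consider q' where "q' \<in> Q" "y = Inl q'" | j' c' where "j' \<in> ?J" "y = Inr
          (j', c')" by auto
      then show ?thesis
      proof cases
        case 1 then show ?thesis using x Qj[of q' j c] by (auto simp: Int_commute)
      next
        case 2 then show ?thesis using x jj[of j j' c c'] that(3) by auto
      qed
    qed
  qed
  have piece_UN: "(\<Union>x\<in>?pieces. piece x) = E"
  proof -
    have "(\<Union>x\<in>?pieces. piece x) = (\<Union>q\<in>Q. path_edges q) \<union> (\<Union>j\<in>?J. path_edges (a j) \<union> path_edges (b j))"
    proof -
      have "(\<Union>x\<in>?pieces. piece x) = (\<Union>q\<in>Q. piece (Inl q)) \<union> (\<Union>j\<in>?J. \<Union>c. piece (Inr (j, c)))"
        by blast
      moreover have "(\<Union>c. piece (Inr (j, c))) = path_edges (a j) \<union> path_edges (b j)" for j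
        by (auto simp: piece_def UNIV_bool)
      ultimately show ?thesis by (simp add: piece_def)
    qed
    also have "(\<Union>q\<in>Q. path_edges q) = G" using Q(1) by (simp add: path_dec_def)
    also have "G \<union> (\<Union>j\<in>?J. path_edges (a j) \<union> path_edges (b j)) = E"
      unfolding G using thr'(10,11) by blast
    finally show ?thesis .
  qed
  have "path_dec E (P ` I)"
  proof (rule path_dec_UN)
    show "finite I" using finQ V by (auto simp: I_def)
    show "simple_path (P i)" if "i \<in> I" for i
    proof (cases i)
      case (Inl q) then show ?thesis using that glue(1) by (auto simp: I_def P_def)
    next
      case (Inr j)
      then have j: "j \<in> ?J" using that by (auto simp: I_def)
      \<comment> \<open>The two ends differ in kind, which excludes a reserved path reduced to the
        single vertex \<open>fst j\<close>.\<close>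
      have "hd (a j) \<noteq> last (b j)" using thr'(8,9)[OF j] by auto
      then have "2 \<le> length (a j @ tl (b j))"
        using thr'(1-4)[OF j] by (cases "a j"; cases "b j") (auto simp: Suc_le_eq split: if_splits)
      then show ?thesis using thr'(5)[OF j] Inr by (simp add: P_def simple_path_def)
    qed
    show "path_edges (P i) \<inter> path_edges (P i') = {}" if "i \<in> I" "i' \<in> I" "i \<noteq> i'" for i i'
    proof -
      have "piece x \<inter> piece y = {}" if "x \<in> K i" "y \<in> K i'" for x y
        by (rule piece_disj) (use that K_sub[OF \<open>i \<in> I\<close>] K_sub[OF \<open>i' \<in> I\<close>] K_disj[OF \<open>i \<in> I\<close> \<open>i' \<in>
            I\<close> \<open>i \<noteq> i'\<close>] in blast)+
      then show ?thesis unfolding P_edges[OF that(1)] P_edges[OF that(2)] by blast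
    qed
    have "(\<Union>i\<in>I. path_edges (P i)) = (\<Union>i\<in>I. \<Union>x\<in>K i. piece x)" using P_edges by simp
    also have "\<dots> = (\<Union>x\<in>(\<Union>i\<in>I. K i). piece x)" by blast
    also have "(\<Union>i\<in>I. K i) = ?pieces" using K_sub K_cover by blast
    finally show "(\<Union>i\<in>I. path_edges (P i)) = E" using piece_UN by simp
  qed
  moreover have "Pos (hd (P i)) \<and> \<not> Pos (last (P i))" if "i \<in> I" for i
  proof (cases i)
    case (Inl q)
    then have "q \<in> Q" using that by (auto simp: I_def)
    then show ?thesis using Inl glue(2,3) front(5) rear(5) by (simp add: P_def)
  next
    case (Inr j)
    then have j: "j \<in> ?J" using that by (auto simp: I_def)
    have "last (a j @ tl (b j)) = last (b j)" using thr'(1-4)[OF j] by (cases "b j") auto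
    then show ?thesis using thr'(1,8,9)[OF j] Inr by (simp add: P_def)
  qed
  ultimately show ?thesis by blast
qed

section \<open>Balanced colourings\<close>

text \<open>The second-order estimate for the moment method; its linear term will vanish when summed
  over the colours.\<close>

lemma exp_le_quadratic:
  fixes y :: real
  assumes "\<bar>y\<bar> \<le> 1"
  shows "exp y \<le> 1 + y + y\<^sup>2"
proof (cases "0 \<le> y")
  case True
  then show ?thesis using exp_bound[of y] assms by simp
next
  case False
  define z where "z = - y"
  have z: "0 \<le> z" "z \<le> 1" using False assms by (auto simp: z_def)
  \<comment> \<open>For negative \<open>y\<close> it suffices that \<open>1 - z + z ^ 2\<close>
    times the quadratic Taylor bound of \<open>exp z\<close> is at least 1. All terms of the product
    after the constant have nonnegative coefficients.\<close>
  have "1 + z + z\<^sup>2 / 2 \<le> exp z" using z exp_lower_Taylor_quadratic[of z] by simp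
  moreover have "0 \<le> 1 - z + z\<^sup>2" using z by simp
  ultimately have le: "(1 - z + z\<^sup>2) * (1 + z + z\<^sup>2 / 2) \<le> (1 - z + z\<^sup>2) * exp z"
    by (rule mult_left_mono)
  have "0 \<le> (z\<^sup>2 + z ^ 3 + z ^ 4) / 2" using z by simp
  then have "1 \<le> 1 + (z\<^sup>2 + z ^ 3 + z ^ 4) / 2" by simp
  also have "\<dots> = (1 - z + z\<^sup>2) * (1 + z + z\<^sup>2 / 2)"
    by (simp add: field_simps power2_eq_square power3_eq_cube power4_eq_xxxx)
  also note le
  finally have "1 \<le> (1 - z + z\<^sup>2) * exp z" .
  then have "exp (- z) \<le> 1 - z + z\<^sup>2" by (simp add: exp_minus field_simps)
  then show ?thesis by (simp add: z_def)
qed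

text \<open>The method of conditional expectations: vertices are coloured one at a time, and some
  colour does no worse than the average over the \<open>k\<close> colours. The weights
  \<open>u\<close> absorb the factors already fixed, which is why they vary in the
  induction.\<close>

lemma weighted_choice:
  fixes g :: "'i \<Rightarrow> 'a \<Rightarrow> nat \<Rightarrow> real"
  assumes V: "finite V" and I: "finite I" and k: "0 < k"
    and g: "\<And>i x c. 0 \<le> g i x c" and M: "\<And>i x. (\<Sum>c<k. g i x c) \<le> real k * M"
    and u: "\<And>i. 0 \<le> u i"
  shows "\<exists>f. (\<forall>x\<in>V. f x < k) \<and> (\<Sum>i\<in>I. u i * (\<Prod>x\<in>V. g i x (f x))) \<le> (\<Sum>i\<in>I. u i) * M ^ card V"
  using V u
proof (induction V arbitrary: u rule: finite_induct)
  case empty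
  then show ?case by auto
next
  case (insert x V)
  have "\<exists>c<k. (\<Sum>i\<in>I. u i * g i x c) \<le> M * (\<Sum>i\<in>I. u i)"
  proof (rule ccontr)
    assume "\<not> ?thesis"
    then have "(\<Sum>c<k. M * (\<Sum>i\<in>I. u i)) < (\<Sum>c<k. \<Sum>i\<in>I. u i * g i x c)"
      by (intro sum_strict_mono) (use k in \<open>auto simp: not_le\<close>)
    also have "\<dots> = (\<Sum>i\<in>I. u i * (\<Sum>c<k. g i x c))"
      by (subst sum.swap) (simp add: sum_distrib_left)
    also have "\<dots> \<le> (\<Sum>i\<in>I. u i * (real k * M))"
      by (intro sum_mono mult_left_mono M insert.prems)
    also have "\<dots> = (\<Sum>c<k. M * (\<Sum>i\<in>I. u i))" by (simp add: sum_distrib_left mult_ac)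
    finally show False by simp
  qed
  then obtain c where c: "c < k" "(\<Sum>i\<in>I. u i * g i x c) \<le> M * (\<Sum>i\<in>I. u i)" by blast
  have M0: "0 \<le> M"
  proof -
    have "0 \<le> (\<Sum>c<k. g i x c)" for i by (intro sum_nonneg g)
    then have "0 \<le> real k * M" using M[of undefined x] order_trans by blast
    then show ?thesis using k by (simp add: zero_le_mult_iff)
  qed
  obtain f where f: "\<forall>y\<in>V. f y < k"
    "(\<Sum>i\<in>I. u i * g i x c * (\<Prod>y\<in>V. g i y (f y))) \<le> (\<Sum>i\<in>I. u i * g i x c) * M ^ card V"
    using insert.IH[of "\<lambda>i. u i * g i x c"] insert.prems g by auto
  let ?f = "f(x := c)"
  have "(\<Prod>y\<in>insert x V. g i y (?f y)) = g i x c * (\<Prod>y\<in>V. g i y (f y))" for i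
  proof -
    have "(\<Prod>y\<in>V. g i y (?f y)) = (\<Prod>y\<in>V. g i y (f y))"
      by (rule prod.cong) (use insert.hyps in auto)
    then show ?thesis using insert.hyps by simp
  qed
  then have "(\<Sum>i\<in>I. u i * (\<Prod>y\<in>insert x V. g i y (?f y))) = (\<Sum>i\<in>I. u i * g i x c * (\<Prod>y\<in>V. g i y (f y)))"
    by (simp add: mult.assoc)
  also have "\<dots> \<le> (\<Sum>i\<in>I. u i * g i x c) * M ^ card V" by (rule f)
  also have "\<dots> \<le> M * (\<Sum>i\<in>I. u i) * M ^ card V" by (rule mult_right_mono[OF c(2)]) (use M0 in simp)
  also have "\<dots> = (\<Sum>i\<in>I. u i) * M ^ card (insert x V)" using insert.hyps by (simp add: mult_ac)
  finally show ?case using f c by (intro exI[of _ ?f]) auto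
qed

text \<open>The Chernoff bound for a random colouring, derandomised by \<open>weighted_choice\<close>.\<close>
lemma balanced_coloring:
  fixes S :: "'i \<Rightarrow> 'a set" and t \<mu> :: real
  assumes V: "finite V" and I: "finite I" and k: "0 < k" and \<mu>: "0 \<le> \<mu>" "\<mu> \<le> 1"
    and t: "2 * real (card I) * real k * exp (\<mu>\<^sup>2 * real (card V)) < exp (\<mu> * t)"
  shows "\<exists>f. (\<forall>x\<in>V. f x < k) \<and> (\<forall>i\<in>I. \<forall>j<k.
    \<bar>real (card {x\<in>V. x \<in> S i \<and> f x = j}) - real (card {x\<in>V. x \<in> S i}) / real k\<bar> < t)"
proof -
  \<comment> \<open>The centred indicator that \<open>x\<close>, as a member of \<open>S i\<close>,
    gets colour \<open>j\<close>, scaled by plus or minus \<open>\<mu>\<close>. The sign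
    \<open>e\<close> handles both tails at once and causes the factor 2 in \<open>t\<close>.\<close>
  define y where "y i x c = (case i of (i, j, e) \<Rightarrow>
    (if e then \<mu> else - \<mu>) * of_bool (x \<in> S i) * (of_bool (c = j) - 1 / real k))" for i x and c :: nat
  let ?I = "I \<times> {..<k} \<times> (UNIV :: bool set)"
  \<comment> \<open>\<open>weighted_choice\<close> requires its average bound for every index, hence
    the value 0 outside \<open>?I\<close>.\<close>
  let ?g = "\<lambda>i x c. if i \<in> ?I then exp (y i x c) else 0"
  have finI: "finite ?I" using I by simp
  have M: "(\<Sum>c<k. ?g i x c) \<le> real k * exp (\<mu>\<^sup>2)" for i x
  proof (cases "i \<in> ?I")
    case True
    then obtain i' j e where i: "i = (i', j, e)" "j < k" by auto
    define s where "s = (if e then \<mu> else - \<mu>) * of_bool (x \<in> S i')"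
    have s: "\<bar>s\<bar> \<le> \<mu>" using \<mu> by (auto simp: s_def)
    have yy: "y i x c = s * (of_bool (c = j) - 1 / real k)" for c by (simp add: y_def i s_def)
    have fac: "\<bar>of_bool (c = j) - 1 / real k\<bar> \<le> 1" for c using k by (auto simp: field_simps)
    have ya: "\<bar>y i x c\<bar> \<le> \<mu>" for c
      unfolding yy abs_mult using mult_mono[OF s fac[of c]] \<mu> by simp
    have "(\<Sum>c<k. ?g i x c) = (\<Sum>c<k. exp (y i x c))" using True by simp
    also have "\<dots> \<le> (\<Sum>c<k. 1 + y i x c + \<mu>\<^sup>2)"
    proof (rule sum_mono)
      fix c
      have "exp (y i x c) \<le> 1 + y i x c + (y i x c)\<^sup>2"
        by (rule exp_le_quadratic) (use ya[of c] \<mu> in simp)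
      also have "(y i x c)\<^sup>2 \<le> \<mu>\<^sup>2" using ya[of c] \<mu> by (metis abs_le_square_iff abs_of_nonneg)
      finally show "exp (y i x c) \<le> 1 + y i x c + \<mu>\<^sup>2" by simp
    qed
    also have "\<dots> = real k * (1 + \<mu>\<^sup>2) + (\<Sum>c<k. y i x c)" by (simp add: sum.distrib algebra_simps)
    \<comment> \<open>The centred indicator sums to zero because \<open>j < k\<close>, so only the
      quadratic term survives.\<close>
    also have "(\<Sum>c<k. y i x c) = s * ((\<Sum>c<k. of_bool (c = j)) - 1)"
      unfolding yy using k by (simp add: sum_subtractf flip: sum_distrib_left)
    also have "(\<Sum>c<k. of_bool (c = j)) = (1::real)" using i by (simp add: of_bool_def)
    also have "real k * (1 + \<mu>\<^sup>2) + s * (1 - 1) \<le> real k * exp (\<mu>\<^sup>2)"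
      using exp_ge_add_one_self[of "\<mu>\<^sup>2"] by (simp add: mult_left_mono)
    finally show ?thesis .
  qed auto
  have "\<exists>f. (\<forall>x\<in>V. f x < k) \<and>
    (\<Sum>i\<in>?I. 1 * (\<Prod>x\<in>V. ?g i x (f x))) \<le> (\<Sum>i\<in>?I. 1) * exp (\<mu>\<^sup>2) ^ card V"
    by (rule weighted_choice[OF V finI k _ M]) simp_all
  then obtain f where f: "\<forall>x\<in>V. f x < k"
    and le: "(\<Sum>i\<in>?I. 1 * (\<Prod>x\<in>V. ?g i x (f x))) \<le> (\<Sum>i\<in>?I. 1) * exp (\<mu>\<^sup>2) ^ card V"
    by blast
  have total: "(\<Sum>i\<in>?I. \<Prod>x\<in>V. ?g i x (f x)) < exp (\<mu> * t)"
  proof -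
    have "(\<Sum>i\<in>?I. \<Prod>x\<in>V. ?g i x (f x)) \<le> real (card ?I) * exp (\<mu>\<^sup>2) ^ card V" using le by simp
    also have "\<dots> = 2 * real (card I) * real k * exp (\<mu>\<^sup>2 * real (card V))"
      by (simp add: card_cartesian_product exp_of_nat_mult mult_ac)
    finally show ?thesis using t by simp
  qed
  \<comment> \<open>Each signed deviation, multiplied by \<open>\<mu>\<close>, is the exponent of
    one summand of a nonnegative sum that is below \<open>exp (\<mu> * t)\<close> in total.\<close>
  have dev: "(if e then \<mu> else - \<mu>) * (real (card {x\<in>V. x \<in> S i \<and> f x = j}) - real (card {x\<in>V. x \<in> S
      i}) / real k) < \<mu> * t"
    if "i \<in> I" "j < k" for i j e
  proof -
    let ?i = "(i, j, e)" and ?s = "if e then \<mu> else - \<mu>"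
    have mem: "?i \<in> ?I" using that by auto
    have "(\<Prod>x\<in>V. ?g ?i x (f x)) = exp (\<Sum>x\<in>V. y ?i x (f x))" using mem V by (simp add: exp_sum)
    also have "(\<Sum>x\<in>V. y ?i x (f x)) = (\<Sum>x\<in>V. ?s * (of_bool (x \<in> S i \<and> f x = j) - of_bool (x \<in> S i) /
        real k))"
      by (rule sum.cong) (auto simp: y_def)
    also have "\<dots> = ?s * (real (card {x\<in>V. x \<in> S i \<and> f x = j}) - real (card {x\<in>V. x \<in> S i}) / real k)"
      using V by (simp add: of_bool_def sum_subtractf sum.If_cases Int_def flip: sum_distrib_left
          sum_divide_distrib)
    finally have "exp (?s * (real (card {x\<in>V. x \<in> S i \<and> f x = j}) - real (card {x\<in>V. x \<in> S i}) /
        real k)) =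
        (\<Prod>x\<in>V. ?g ?i x (f x))" by simp
    also have "\<dots> \<le> (\<Sum>i\<in>?I. \<Prod>x\<in>V. ?g i x (f x))"
      by (rule member_le_sum[OF mem]) (use finI in \<open>auto intro!: prod_nonneg\<close>)
    also have "\<dots> < exp (\<mu> * t)" by (rule total)
    finally show ?thesis by simp
  qed
  have mu_pos: "0 < \<mu>" if "I \<noteq> {}"
  proof (rule ccontr)
    assume "\<not> 0 < \<mu>"
    then have "\<mu> = 0" using \<mu> by simp
    then have "2 * real (card I) * real k < 1" using t by simp
    moreover have "1 \<le> real (card I * k)" using that I k by (simp add: Suc_le_eq card_gt_0_iff flip:
        of_nat_mult)
    ultimately show False by simp
  qed
  have "\<bar>real (card {x\<in>V. x \<in> S i \<and> f x = j}) - real (card {x\<in>V. x \<in> S i}) / real k\<bar> < t" if "i \<in> I"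
      "j < k" for i j
  proof -
    let ?d = "real (card {x\<in>V. x \<in> S i \<and> f x = j}) - real (card {x\<in>V. x \<in> S i}) / real k"
    have l: "0 < \<mu>" using mu_pos that by auto
    have "\<mu> * ?d < \<mu> * t" using dev[OF that, of True] by simp
    moreover have "\<mu> * (- ?d) < \<mu> * t" using dev[OF that, of False] by (simp add: algebra_simps)
    ultimately have "?d < t" "- ?d < t" using l by (simp_all only: mult_less_cancel_left_pos)
    then show ?thesis by simp
  qed
  then show ?thesis using f by blast
qed

section \<open>Hamilton path decompositions of complete digraphs\<close>

text \<open>
  The arc from \<open>i\<close> to \<open>j\<close> lies on the Hamilton path with index \<open>cls i j\<close>, and
  \<open>pos c i\<close> is the position of \<open>i\<close> on the path with index \<open>c\<close>.
\<close>
definition zigzag :: "nat \<Rightarrow> (nat \<Rightarrow> nat \<Rightarrow> nat) \<Rightarrow> (nat \<Rightarrow> nat \<Rightarrow> nat) \<Rightarrow> bool" where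
  "zigzag k cls pos \<longleftrightarrow>
    (\<forall>i<k. \<forall>j<k. i \<noteq> j \<longrightarrow> cls i j < k \<and> pos (cls i j) j = Suc (pos (cls i j) i)) \<and>
    (\<forall>c<k. \<forall>i<k. pos c i < k) \<and>
    (\<forall>c<k. \<forall>i<k. Suc (pos c i) < k \<longrightarrow> (\<exists>j<k. j \<noteq> i \<and> cls i j = c)) \<and>
    (\<forall>c<k. \<forall>i<k. 0 < pos c i \<longrightarrow> (\<exists>j<k. j \<noteq> i \<and> cls j i = c)) \<and>
    (\<forall>c<k. inj_on (pos c) {..<k}) \<and>
    (\<forall>i<k. inj_on (\<lambda>c. pos c i) {..<k})"

text \<open>
  Walecki's zigzag \<open>0, 1, -1, 2, -2, \<dots>\<close> modulo an even \<open>k\<close> has pairwise distinct differences,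
  so its translates decompose the complete digraph on \<open>k\<close> vertices into Hamilton paths.
\<close>
lemma zigzag_exists:
  assumes k: "even k" "0 < k"
  shows "\<exists>cls pos. zigzag k cls pos"
proof -
  define K where "K = int k"
  have K: "0 < K" "even K" using k by (auto simp: K_def)
  have neg_mod: "(- x) mod K = K - x" if "0 < x" "x < K" for x
    using that zmod_zminus1_eq_if[of x K] by simp
  define z :: "nat \<Rightarrow> int" where "z p = (if even p then - int (p div 2) else int ((p + 1) div 2))" for p
  \<comment> \<open>The inverse of \<open>z\<close> on residues: nonzero residues up to
    \<open>K / 2\<close> occur at odd places, larger ones at even places, counted down from
    \<open>K\<close>.\<close>
  define zi :: "int \<Rightarrow> nat" where "zi d = (if d = 0 then 0 else if 2 * d \<le> K then nat (2 * d - 1)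
      else nat (2 * (K - d)))" for d
  have zi: "zi d < k" "z (zi d) mod K = d" if "0 \<le> d" "d < K" for d
  proof -
    have cs: "d = 0 \<or> (0 < d \<and> 2 * d \<le> K) \<or> K < 2 * d" using that by linarith
    have "int (zi d) < K" using cs that by (elim disjE conjE) (simp_all add: zi_def)
    then show "zi d < k" by (simp add: K_def)
    consider "d = 0" | "0 < d" "2 * d \<le> K" | "K < 2 * d" using cs by blast
    then show "z (zi d) mod K = d"
    proof cases
      case 1 then show ?thesis by (simp add: zi_def z_def)
    next
      case 2
      then have e: "zi d = 2 * nat (d - 1) + 1" by (simp add: zi_def)
      have "z (zi d) = int (nat (d - 1)) + 1" unfolding e z_def by simp
      then have "z (zi d) = d" using 2 by simp
      then show ?thesis using that by simp
    next
      case 3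
      then have e: "zi d = 2 * nat (K - d)" using that by (simp add: zi_def)
      have "z (zi d) = - int (nat (K - d))" unfolding e z_def by simp
      then have "z (zi d) = d - K" using that by simp
      then have "z (zi d) mod K = (d - K) mod K" by simp
      then show ?thesis using that by simp
    qed
  qed
  have zi_z: "zi (z p mod K) = p" if "p < k" for p
  proof (cases "even p")
    case True
    then obtain q where q: "p = 2 * q" by auto
    have zp: "z p = - int q" by (simp add: z_def q)
    show ?thesis
    proof (cases "q = 0")
      case False
      have q': "0 < int q" "2 * int q < K" using False that q by (simp_all add: K_def)
      then have m: "z p mod K = K - int q" using neg_mod[of "int q"] by (simp add: zp)
      show ?thesis unfolding m using q' by (simp add: zi_def q)
    next
      case True
      then have "z p = 0" "p = 0" using zp q by simp_all
      then show ?thesis by (simp add: zi_def)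
    qed
  next
    case False
    then obtain q where q: "p = 2 * q + 1" using oddE by blast
    have zp: "z p = int q + 1" by (simp add: z_def q)
    have "2 * q + 2 \<le> k" using that q k(1) by presburger
    then have q': "2 * (int q + 1) \<le> K" by (simp add: K_def)
    then have m: "z p mod K = int q + 1" using zp by simp
    show ?thesis unfolding m using q' by (simp add: zi_def q)
  qed
  have zstep: "z (Suc p) - z p = (if even p then int p + 1 else - (int p + 1))" for p
    by (cases "even p") (auto simp: z_def elim!: evenE oddE)
  \<comment> \<open>The steps of the zigzag are 1, -2, 3, -4 and so on, as \<open>zstep\<close>
    shows. An odd difference \<open>d\<close> is therefore the step at place \<open>d - 1\<close>.
    An even \<open>d\<close> is congruent to \<open>-(K - d)\<close>, the step at place
    \<open>K - d - 1\<close>, which is odd because \<open>K\<close> is even.\<close>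
  define pd where "pd d = (if odd d then nat (d - 1) else nat (K - d - 1))" for d :: int
  \<comment> \<open>On the translate by \<open>c\<close>, vertex \<open>i\<close> stands at place
    \<open>p\<close> if \<open>i\<close> is congruent to \<open>c + z p\<close>. Solving for
    \<open>c\<close> gives \<open>cls\<close>, solving for \<open>p\<close> gives
    \<open>pos\<close>.\<close>
  define cls where "cls i j = nat ((int i - z (pd ((int j - int i) mod K))) mod K)" for i j :: nat
  define pos where "pos c i = zi ((int i - int c) mod K)" for c i :: nat
  have pd: "pd d + 1 < k" "(z (Suc (pd d)) - z (pd d)) mod K = d" if "0 < d" "d < K" for d
  proof -
    have "int (pd d) + 1 < K"
    proof (cases "odd d")
      case False
      then show ?thesis using that by (simp add: pd_def)
    qed (use that in \<open>simp add: pd_def\<close>)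
    then show "pd d + 1 < k" by (simp add: K_def)
    show "(z (Suc (pd d)) - z (pd d)) mod K = d"
    proof (cases "odd d")
      case True
      then have e: "int (pd d) = d - 1" using that by (simp add: pd_def)
      then have "even (pd d)" using True by (metis even_of_nat odd_one odd_even_add diff_add_cancel
          even_add)
      then show ?thesis using e that by (simp add: zstep)
    next
      case False
      then have e: "int (pd d) = K - d - 1" using that by (simp add: pd_def)
      then have "odd (int (pd d))" using False K by simp
      then have "odd (pd d)" by simp
      then have "z (Suc (pd d)) - z (pd d) = d - K" using e by (simp add: zstep)
      then show ?thesis using that by simp
    qed
  qed
  have cls_int: "int (cls i j) = (int i - z (pd ((int j - int i) mod K))) mod K" for i j
    using K by (simp add: cls_def)
  have diff: "0 < (int j - int i) mod K \<and> (int j - int i) mod K < K" if "i < k" "j < k" "i \<noteq> j" for i j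
  proof -
    have "(int j - int i) mod K \<noteq> 0"
    proof
      assume "(int j - int i) mod K = 0"
      then have "int j mod K = int i mod K" by (simp add: mod_eq_dvd_iff mod_0_imp_dvd)
      then show False using that by (simp add: K_def)
    qed
    then show ?thesis using K pos_mod_bound[of K "int j - int i"] pos_mod_sign[of K "int j - int i"]
        by linarith
  qed
  have main: "pos c i = p \<longleftrightarrow> (int i - int c) mod K = z p mod K" if "p < k" for c i p
  proof
    assume "pos c i = p"
    then show "(int i - int c) mod K = z p mod K"
      using zi(2)[of "(int i - int c) mod K"] K by (simp add: pos_def)
  next
    assume "(int i - int c) mod K = z p mod K"
    then show "pos c i = p" using zi_z[OF that] by (simp add: pos_def)
  qed
  have pos_lt: "pos c i < k" for c i unfolding pos_def by (rule zi(1)) (use K in auto)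
  have mod_id: "int x mod K = int x" if "x < k" for x using that by (simp add: K_def)
  have next_cls: "cls i j = c" if "i < k" "j < k" "c < k" "i \<noteq> j" "pos c j = Suc (pos c i)" for i j c
  proof -
    let ?p = "pos c i"
    have p: "Suc ?p < k" using pos_lt[of c j] that by simp
    have "(int i - int c) mod K = z ?p mod K" using main[where p = ?p and c = c and i = i, OF
        pos_lt] by simp
    moreover have "(int j - int c) mod K = z (Suc ?p) mod K" using main[where p = "Suc ?p" and c = c
        and i = j, OF p] that(5) by simp
    ultimately have "((int j - int c) - (int i - int c)) mod K = (z (Suc ?p) - z ?p) mod K" by (rule
        mod_diff_cong[rotated])
    then have d: "(int j - int i) mod K = (z (Suc ?p) - z ?p) mod K" by simp
    have "pd ((int j - int i) mod K) = ?p"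
    proof (cases "even ?p")
      case True
      then have "(int j - int i) mod K = int ?p + 1" using d p by (simp add: zstep K_def)
      then show ?thesis using True by (simp add: pd_def)
    next
      case False
      have "(int j - int i) mod K = (- (int ?p + 1)) mod K" using False d by (simp add: zstep)
      also have "\<dots> = K - (int ?p + 1)" using neg_mod[of "int ?p + 1"] p by (simp add: K_def)
      finally have e: "(int j - int i) mod K = K - (int ?p + 1)" .
      moreover have "even (K - (int ?p + 1))" using False K by simp
      ultimately show ?thesis by (simp add: pd_def)
    qed
    then have "int (cls i j) = (int i - z ?p) mod K" by (simp add: cls_int)
    also have "\<dots> = (int i - (int i - int c)) mod K"
      by (rule mod_diff_cong) (use main[OF pos_lt, of c i c i] in simp_all)
    also have "\<dots> = int c" using mod_id[OF that(3)] by simp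
    finally show ?thesis by simp
  qed
  have ex_pos: "\<exists>j<k. pos c j = p" if "p < k" for c p
  proof -
    let ?j = "nat ((int c + z p) mod K)"
    have "int ?j = (int c + z p) mod K" using K by simp
    moreover have "((int c + z p) mod K - int c) mod K = z p mod K" by (simp add: mod_diff_left_eq)
    ultimately have "pos c ?j = p" using main[where p = p and c = c and i = ?j, OF that] by simp
    moreover have "?j < k" using K by (simp add: K_def nat_less_iff)
    ultimately show ?thesis by blast
  qed
  have "zigzag k cls pos"
    unfolding zigzag_def
  proof (intro conjI allI impI)
    fix i j assume ij: "i < k" "j < k" "i \<noteq> j"
    let ?d = "(int j - int i) mod K" and ?c = "cls i j"
    let ?p = "pd ?d"
    show c: "cls i j < k" using K by (simp add: cls_def K_def nat_less_iff)
    have p: "Suc ?p < k" "(z (Suc ?p) - z ?p) mod K = ?d" using pd diff[OF ij] by simp_all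
    have ci: "(int i - int ?c) mod K = z ?p mod K"
      unfolding cls_int by (simp add: mod_diff_right_eq)
    then have pi: "pos ?c i = ?p" using main[of ?p] p(1) by simp
    have "(int j - int ?c) mod K = ((int j - int i) + (int i - int ?c)) mod K" by simp
    also have "\<dots> = ((z (Suc ?p) - z ?p) + z ?p) mod K"
      by (rule mod_add_cong) (use p(2) ci in auto)
    finally have "(int j - int ?c) mod K = z (Suc ?p) mod K" by simp
    then have "pos ?c j = Suc ?p" using main[OF p(1)] by simp
    then show "pos (cls i j) j = Suc (pos (cls i j) i)" using pi by simp
  next
    fix c i assume c: "c < k" "i < k"
    show "pos c i < k" by (rule pos_lt)
    show "\<exists>j<k. j \<noteq> i \<and> cls i j = c" if p: "Suc (pos c i) < k"
    proof -
      obtain j where j: "j < k" "pos c j = Suc (pos c i)" using ex_pos[OF p] by blast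
      then have "j \<noteq> i" by auto
      then show ?thesis using j next_cls[OF c(2) j(1) c(1)] by auto
    qed
    show "\<exists>j<k. j \<noteq> i \<and> cls j i = c" if p: "0 < pos c i"
    proof -
      have "pos c i - 1 < k" using pos_lt[of c i] by simp
      then obtain j where j: "j < k" "pos c j = pos c i - 1" using ex_pos by blast
      then have "j \<noteq> i" "pos c i = Suc (pos c j)" using p by auto
      then show ?thesis using j next_cls[OF j(1) c(2) c(1)] by auto
    qed
  next
    fix c assume "c < k"
    show "inj_on (pos c) {..<k}"
    proof (rule inj_onI)
      fix i j assume ij: "i \<in> {..<k}" "j \<in> {..<k}" "pos c i = pos c j"
      have "(int i - int c) mod K = (int j - int c) mod K" using main[where p = "pos c j" and c = c
          and i = i, OF pos_lt]
          main[where p = "pos c j" and c = c and i = j, OF pos_lt] ij(3) by simp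
      then have "int i mod K = int j mod K" by (simp add: mod_eq_dvd_iff)
      moreover have "int i mod K = int i" "int j mod K = int j" using ij mod_id by simp_all
      ultimately show "i = j" by simp
    qed
  next
    fix i assume "i < k"
    show "inj_on (\<lambda>c. pos c i) {..<k}"
    proof (rule inj_onI)
      fix c d assume cd: "c \<in> {..<k}" "d \<in> {..<k}" "pos c i = pos d i"
      have "(int i - int c) mod K = (int i - int d) mod K" using main[where p = "pos d i" and c = c
          and i = i, OF pos_lt]
          main[where p = "pos d i" and c = d and i = i, OF pos_lt] cd(3) by simp
      then have "int d mod K = int c mod K" by (simp add: mod_eq_dvd_iff)
      moreover have "int c mod K = int c" "int d mod K = int d" using cd mod_id by simp_all
      ultimately show "c = d" by simp
    qed
  qed
  then show ?thesis by blast
qed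

lemma zigzagD:
  assumes "zigzag k cls pos"
  shows "i < k \<Longrightarrow> j < k \<Longrightarrow> i \<noteq> j \<Longrightarrow> cls i j < k \<and> pos (cls i j) j = Suc (pos (cls i j) i)"
    and "c < k \<Longrightarrow> i < k \<Longrightarrow> pos c i < k"
    and "c < k \<Longrightarrow> i < k \<Longrightarrow> Suc (pos c i) < k \<Longrightarrow> \<exists>j<k. j \<noteq> i \<and> cls i j = c"
    and "c < k \<Longrightarrow> i < k \<Longrightarrow> 0 < pos c i \<Longrightarrow> \<exists>j<k. j \<noteq> i \<and> cls j i = c"
    and "c < k \<Longrightarrow> inj_on (pos c) {..<k}"
    and "i < k \<Longrightarrow> inj_on (\<lambda>c. pos c i) {..<k}"
proof -
  note z = assms[unfolded zigzag_def]
  show "i < k \<Longrightarrow> j < k \<Longrightarrow> i \<noteq> j \<Longrightarrow> cls i j < k \<and> pos (cls i j) j = Suc (pos (cls i j) i)"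
    by (rule z[THEN conjunct1, rule_format])
  show "c < k \<Longrightarrow> i < k \<Longrightarrow> pos c i < k"
    by (rule z[THEN conjunct2, THEN conjunct1, rule_format])
  show "c < k \<Longrightarrow> i < k \<Longrightarrow> Suc (pos c i) < k \<Longrightarrow> \<exists>j<k. j \<noteq> i \<and> cls i j = c"
    by (rule z[THEN conjunct2, THEN conjunct2, THEN conjunct1, rule_format])
  show "c < k \<Longrightarrow> i < k \<Longrightarrow> 0 < pos c i \<Longrightarrow> \<exists>j<k. j \<noteq> i \<and> cls j i = c"
    by (rule z[THEN conjunct2, THEN conjunct2, THEN conjunct2, THEN conjunct1, rule_format])
  show "c < k \<Longrightarrow> inj_on (pos c) {..<k}"
    by (rule z[THEN conjunct2, THEN conjunct2, THEN conjunct2, THEN conjunct2, THEN conjunct1,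
        rule_format])
  show "i < k \<Longrightarrow> inj_on (\<lambda>c. pos c i) {..<k}"
    by (rule z[THEN conjunct2, THEN conjunct2, THEN conjunct2, THEN conjunct2, THEN conjunct2,
        rule_format])
qed

text \<open>Reversing all Hamilton paths lets a bound on ends be reused as a bound on
  starts.\<close>

lemma zigzag_reverse:
  assumes "zigzag k cls pos"
  shows "zigzag k (\<lambda>i j. cls j i) (\<lambda>c i. k - 1 - pos c i)"
proof -
  note Z = zigzagD[OF assms]
  show ?thesis
    unfolding zigzag_def
  proof (intro conjI allI impI)
    fix i j assume ij: "i < k" "j < k" "i \<noteq> j"
    show "cls j i < k" using Z(1)[of j i] ij by simp
    have "pos (cls j i) i = Suc (pos (cls j i) j)" "pos (cls j i) i < k" using Z(1)[of j i] Z(2)[of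
        "cls j i" i] ij by auto
    then show "k - 1 - pos (cls j i) j = Suc (k - 1 - pos (cls j i) i)" by simp
  next
    fix c i assume c: "c < k" "i < k"
    show "k - 1 - pos c i < k" using c by simp
    show "\<exists>j<k. j \<noteq> i \<and> cls j i = c" if "Suc (k - 1 - pos c i) < k" using Z(4)[OF c] Z(2)[OF c] that
        by simp
    show "\<exists>j<k. j \<noteq> i \<and> cls i j = c" if "0 < k - 1 - pos c i" using Z(3)[OF c] that by simp
  next
    fix c assume c: "c < k"
    show "inj_on (\<lambda>i. k - 1 - pos c i) {..<k}"
    proof (rule inj_onI)
      fix i j assume ij: "i \<in> {..<k}" "j \<in> {..<k}" "k - 1 - pos c i = k - 1 - pos c j"
      then have "pos c i = pos c j" using Z(2)[OF c, of i] Z(2)[OF c, of j] by auto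
      then show "i = j" using Z(5)[OF c] ij by (auto dest: inj_onD)
    qed
  next
    fix i assume i: "i < k"
    show "inj_on (\<lambda>c. k - 1 - pos c i) {..<k}"
    proof (rule inj_onI)
      fix c d assume cd: "c \<in> {..<k}" "d \<in> {..<k}" "k - 1 - pos c i = k - 1 - pos d i"
      then have "pos c i = pos d i" using Z(2)[of c i] Z(2)[of d i] i by auto
      then show "c = d" using Z(6)[OF i] cd by (auto dest: inj_onD)
    qed
  qed
qed

section \<open>Decomposition into short paths\<close>

text \<open>In class \<open>c\<close> all arcs into \<open>w\<close> come from one colour and all
  arcs out of \<open>w\<close> go to one colour, namely the neighbours of \<open>f w\<close> on the
  Hamilton path \<open>c\<close>. By balance these numbers are within \<open>t\<close> of
  \<open>1 / k\<close> of the degrees, and the out-degree is at least the in-degree, so a class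
  lacks at most \<open>2 * t\<close> arcs out. The exception is a class whose path ends at
  \<open>f w\<close>: no arcs leave, and up to \<open>card V / k + t\<close> enter. There is at most
  one, since the positions of a fixed colour differ between the paths.\<close>

lemma zigzag_imbalance:
  fixes G :: "('a \<times> 'a) set" and t :: real
  assumes Z: "zigzag k cls pos" and k: "0 < k" and V: "finite V" and G: "G \<subseteq> V \<times> V" and w: "w \<in> V"
    and f: "\<And>x. x \<in> V \<Longrightarrow> f x < k"
    and outs: "\<And>j. j < k \<Longrightarrow> \<bar>real (card {x\<in>V. x \<in> outs G w \<and> f x = j}) - real (card (outs G w)) /
        real k\<bar> < t"
    and ins: "\<And>j. j < k \<Longrightarrow> \<bar>real (card {x\<in>V. x \<in> ins G w \<and> f x = j}) - real (card (ins G w)) / real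
        k\<bar> < t"
    and ex: "0 \<le> arc_excess G w"
  shows "real_of_int (\<Sum>c<k. max 0 (- arc_excess {e\<in>G. f (fst e) \<noteq> f (snd e) \<and> cls (f (fst e)) (f
      (snd e)) = c} w))
    \<le> 2 * t * real k + (real (card V) / real k + t)"
proof -
  define H where "H c = {e\<in>G. f (fst e) \<noteq> f (snd e) \<and> cls (f (fst e)) (f (snd e)) = c}" for c
  define i where "i = f w"
  have i: "i < k" using f w by (simp add: i_def)
  have t0: "0 < t" using outs[OF k] by linarith
  have finG: "finite G" using G V by (auto intro: finite_subset[of _ "V \<times> V"])
  have insV: "ins G w \<subseteq> V" using G by (auto simp: ins_def)
  have ins_le: "real (card (ins G w)) / real k \<le> real (card V) / real k"
    using card_mono[OF V insV] by (simp add: divide_right_mono)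
  have inb: "real (card (ins (H c) w)) \<le> real (card (ins G w)) / real k + t" if c: "c < k" for c
  proof (cases "ins (H c) w = {}")
    case True
    then show ?thesis using t0 by simp
  next
    case False
    then obtain x0 where x0: "x0 \<in> ins (H c) w" by blast
    have pos: "f x < k \<and> pos c i = Suc (pos c (f x)) \<and> x \<in> V" if "x \<in> ins (H c) w" for x
    proof -
      have x: "(x, w) \<in> G" "f x \<noteq> i" "cls (f x) i = c" using that by (auto simp: ins_def H_def i_def)
      then have "x \<in> V" using G by auto
      then show ?thesis using x zigzagD(1)[OF Z, of "f x" i] f i by auto
    qed
    \<comment> \<open>Only one colour immediately precedes \<open>i\<close> on the path
      \<open>c\<close>.\<close>
    have "f x = f x0" if "x \<in> ins (H c) w" for x
      using pos[OF that] pos[OF x0] zigzagD(5)[OF Z c] by (auto dest: inj_onD)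
    then have "ins (H c) w \<subseteq> {x\<in>V. x \<in> ins G w \<and> f x = f x0}"
      using pos by (auto simp: ins_def H_def)
    then have "card (ins (H c) w) \<le> card {x\<in>V. x \<in> ins G w \<and> f x = f x0}"
      by (rule card_mono[rotated]) (use V in auto)
    then show ?thesis using ins[of "f x0"] pos[OF x0] by linarith
  qed
  have outb: "real (card (outs G w)) / real k - t \<le> real (card (outs (H c) w))" if c: "c < k" "Suc
      (pos c i) < k" for c
  proof -
    obtain j where j: "j < k" "j \<noteq> i" "cls i j = c" using zigzagD(3)[OF Z c(1) i c(2)] by blast
    have "{x\<in>V. x \<in> outs G w \<and> f x = j} \<subseteq> outs (H c) w" using j by (auto simp: outs_def H_def i_def)
    then have "card {x\<in>V. x \<in> outs G w \<and> f x = j} \<le> card (outs (H c) w)"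
      by (rule card_mono[rotated]) (use finG in \<open>auto simp: H_def\<close>)
    then show ?thesis using outs[OF j(1)] by linarith
  qed
  have term_le: "real_of_int (max 0 (- arc_excess (H c) w)) \<le> 2 * t + of_bool (pos c i = k - 1) *
      (real (card V) / real k + t)"
    if c: "c < k" for c
  proof -
    have "real_of_int (- arc_excess (H c) w) \<le> 2 * t + of_bool (pos c i = k - 1) * (real (card V) /
        real k + t)"
    proof (cases "Suc (pos c i) < k")
      case True
      have "real (card (ins G w)) / real k \<le> real (card (outs G w)) / real k"
        using ex by (simp add: arc_excess_def divide_right_mono)
      then show ?thesis using inb[OF c] outb[OF c True] True by (simp add: arc_excess_def)
    next
      case False
      then have "pos c i = k - 1" using zigzagD(2)[OF Z c i] by simp
      then show ?thesis using inb[OF c] ins_le t0 by (simp add: arc_excess_def)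
    qed
    moreover have "0 \<le> 2 * t + of_bool (pos c i = k - 1) * (real (card V) / real k + t)" using t0 by
        simp
    ultimately show ?thesis by simp
  qed
  have "(\<Sum>c<k. of_bool (pos c i = k - 1)) = real (card {c\<in>{..<k}. pos c i = k - 1})"
    by (simp add: of_bool_def sum.If_cases Int_def)
  also have "card {c\<in>{..<k}. pos c i = k - 1} \<le> 1"
  proof -
    have "card {c\<in>{..<k}. pos c i = k - 1} \<le> card {k - 1}"
      by (rule card_inj_on_le[of "\<lambda>c. pos c i"])
        (auto intro: inj_on_subset[OF zigzagD(6)[OF Z i]])
    then show ?thesis by simp
  qed
  finally have one: "(\<Sum>c<k. of_bool (pos c i = k - 1)) \<le> (1::real)" by simp
  have "real_of_int (\<Sum>c<k. max 0 (- arc_excess (H c) w)) = (\<Sum>c<k. real_of_int (max 0 (- arc_excess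
      (H c) w)))"
    by (simp only: of_int_sum)
  also have "\<dots> \<le> (\<Sum>c<k. 2 * t + of_bool (pos c i = k - 1) * (real (card V) / real k + t))"
    by (rule sum_mono) (rule term_le, simp)
  also have "\<dots> = 2 * t * real k + (\<Sum>c<k. of_bool (pos c i = k - 1)) * (real (card V) / real k + t)"
    by (simp add: sum.distrib sum_distrib_right)
  also have "\<dots> \<le> 2 * t * real k + 1 * (real (card V) / real k + t)"
    using t0 by (intro add_left_mono mult_right_mono one) simp
  finally show ?thesis by (simp add: H_def)
qed

lemma nat_le_of_real_bounds:
  assumes "real_of_int a \<le> x" "int n \<le> a + b" "real_of_int b \<le> y" "x + y \<le> real s"
  shows "n \<le> s"
  using assms by linarith

text \<open>\<open>class_decomposition\<close> reduces the count of wrong ends to the imbalances of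
  the classes. The two summands \<open>card V / k + t\<close> in \<open>s\<close> have different
  sources: one is the class whose Hamilton path stops at the colour of \<open>w\<close>, the other
  the arcs joining \<open>w\<close> to vertices of its own colour.\<close>

lemma short_path_decomposition:
  fixes G :: "('a \<times> 'a) set" and t \<mu> :: real
  assumes V: "finite V" and G: "G \<subseteq> V \<times> V" and irr: "\<And>x. (x, x) \<notin> G"
    and k: "even k" "0 < k" and \<mu>: "0 \<le> \<mu>" "\<mu> \<le> 1"
    and t: "4 * real (card V) * real k * exp (\<mu>\<^sup>2 * real (card V)) < exp (\<mu> * t)"
    and s: "2 * t * real k + 2 * (real (card V) / real k + t) \<le> real s"
  shows "\<exists>Q. path_dec G Q \<and> (\<forall>q\<in>Q. length q \<le> k + 1) \<and>
    (\<forall>w\<in>V. (0 \<le> arc_excess G w \<longrightarrow> card {q\<in>Q. last q = w} \<le> s) \<and> (arc_excess G w \<le> 0 \<longrightarrow> card {q\<in>Q. hd q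
        = w} \<le> s))"
proof -
  have finG: "finite G" using G V by (auto intro: finite_subset[of _ "V \<times> V"])
  obtain cls pos where Z: "zigzag k cls pos" using zigzag_exists[OF k] by blast
  define S where "S i = (if snd i then outs G (fst i) else ins G (fst i))" for i :: "'a \<times> bool"
  have "\<exists>f. (\<forall>x\<in>V. f x < k) \<and> (\<forall>i\<in>V \<times> (UNIV :: bool set). \<forall>j<k.
    \<bar>real (card {x\<in>V. x \<in> S i \<and> f x = j}) - real (card {x\<in>V. x \<in> S i}) / real k\<bar> < t)"
    by (rule balanced_coloring[OF V _ k(2) \<mu>]) (use V t in \<open>simp_all add: card_cartesian_product\<close>)
  then obtain f where f: "\<And>x. x \<in> V \<Longrightarrow> f x < k"
    and dev: "\<And>i j. i \<in> V \<times> (UNIV :: bool set) \<Longrightarrow> j < k \<Longrightarrow>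
      \<bar>real (card {x\<in>V. x \<in> S i \<and> f x = j}) - real (card {x\<in>V. x \<in> S i}) / real k\<bar> < t" by blast
  have outsV: "outs G w \<subseteq> V" and insV: "ins G w \<subseteq> V" for w using G by (auto simp: outs_def ins_def)
  have eqV: "{x\<in>V. x \<in> outs G w} = outs G w" "{x\<in>V. x \<in> ins G w} = ins G w" for w
    using outsV[of w] insV[of w] by auto
  have dev_outs: "\<bar>real (card {x\<in>V. x \<in> outs G w \<and> f x = j}) - real (card (outs G w)) / real k\<bar> < t"
    and dev_ins: "\<bar>real (card {x\<in>V. x \<in> ins G w \<and> f x = j}) - real (card (ins G w)) / real k\<bar> < t"
    if "w \<in> V" "j < k" for w j
    using dev[of "(w, True)" j] dev[of "(w, False)" j] that eqV[of w] by (simp_all add: S_def)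
  define H where "H c = {e\<in>G. f (fst e) \<noteq> f (snd e) \<and> cls (f (fst e)) (f (snd e)) = c}" for c
  define N where "N = {e\<in>G. f (fst e) = f (snd e)}"
  \<comment> \<open>An arc inside a colour is on no Hamilton path and forms a class of its own, in
    which \<open>P\<close> gives its ends the positions 0 and 1.\<close>
  define cl where "cl e = (if f (fst e) = f (snd e) then Inr e else Inl (cls (f (fst e)) (f (snd
      e))))" for e
  define P where "P c x = (case c of Inl c \<Rightarrow> pos c (f x) | Inr e \<Rightarrow> of_bool (x = snd e))" for c ::
      "nat + 'a \<times> 'a" and x
  have P: "P (cl (x, y)) x < P (cl (x, y)) y \<and> P (cl (x, y)) y \<le> k" if "(x, y) \<in> G" for x y
  proof (cases "f x = f y")
    case True
    moreover have "x \<noteq> y" using that irr by auto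
    ultimately show ?thesis using k by (simp add: cl_def P_def)
  next
    case False
    have V': "f x < k" "f y < k" using that G f by auto
    show ?thesis
      using zigzagD(1)[OF Z V' False] zigzagD(2)[OF Z _ V'(2), of "cls (f x) (f y)"] False
      by (simp add: cl_def P_def)
  qed
  obtain Q where Q: "path_dec G Q" "\<forall>q\<in>Q. length q \<le> k + 1"
    and last: "\<And>w. int (card {q\<in>Q. last q = w}) = (\<Sum>c\<in>cl ` G. max 0 (- arc_excess {e\<in>G. cl e = c} w))"
    and hd: "\<And>w. int (card {q\<in>Q. hd q = w}) = (\<Sum>c\<in>cl ` G. max 0 (arc_excess {e\<in>G. cl e = c} w))"
    using class_decomposition[OF finG, of P cl k] P by blast
  have finN: "finite N" using finG by (simp add: N_def)
  have clG: "cl ` G \<subseteq> Inl ` {..<k} \<union> Inr ` N"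
  proof
    fix c assume "c \<in> cl ` G"
    then obtain x y where e: "(x, y) \<in> G" "c = cl (x, y)" by auto
    have "f x < k" "f y < k" using e G f by auto
    then show "c \<in> Inl ` {..<k} \<union> Inr ` N" using zigzagD(1)[OF Z, of "f x" "f y"] e by (auto simp:
        cl_def N_def)
  qed
  have cl_Inl: "{e\<in>G. cl e = Inl c} = H c" for c by (auto simp: cl_def H_def)
  have cl_Inr: "{e'\<in>G. cl e' = Inr e} = {e}" if "e \<in> N" for e
    using that by (auto simp: cl_def N_def split: if_splits)
  have split: "(\<Sum>c\<in>cl ` G. max 0 (F {e\<in>G. cl e = c})) \<le> (\<Sum>c<k. max 0 (F (H c))) + (\<Sum>e\<in>N. max 0 (F {e}))"
    for F :: "('a \<times> 'a) set \<Rightarrow> int"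
  proof -
    have "(\<Sum>c\<in>cl ` G. max 0 (F {e\<in>G. cl e = c})) \<le> (\<Sum>c\<in>Inl ` {..<k} \<union> Inr ` N. max 0 (F {e\<in>G. cl e =
        c}))"
      by (rule sum_mono2) (use clG finN in auto)
    also have "\<dots> = (\<Sum>c\<in>Inl ` {..<k}. max 0 (F {e\<in>G. cl e = c})) + (\<Sum>c\<in>Inr ` N. max 0 (F {e\<in>G. cl e =
        c}))"
      by (rule sum.union_disjoint) (use finN in auto)
    also have "(\<Sum>c\<in>Inl ` {..<k}. max 0 (F {e\<in>G. cl e = c})) = (\<Sum>c<k. max 0 (F (H c)))"
      by (subst sum.reindex) (simp_all add: cl_Inl)
    also have "(\<Sum>c\<in>Inr ` N. max 0 (F {e\<in>G. cl e = c})) = (\<Sum>e\<in>N. max 0 (F {e}))"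
      by (subst sum.reindex) (simp_all add: cl_Inr)
    finally show ?thesis .
  qed
  have exc1: "arc_excess {(x, y)} w = of_bool (x = w) - of_bool (y = w)" for x y w :: 'a
  proof -
    have "outs {(x, y)} w = (if x = w then {y} else {})" "ins {(x, y)} w = (if y = w then {x} else {})"
      by (auto simp: outs_def ins_def)
    then show ?thesis by (simp add: arc_excess_def)
  qed
  \<comment> \<open>A one-arc class affects only the ends of its arc, so what counts is the number
    of neighbours of \<open>w\<close> with its own colour.\<close>
  have loc: "real_of_int (\<Sum>e\<in>N. max 0 (- arc_excess {e} w)) \<le> real (card V) / real k + t \<and>
      real_of_int (\<Sum>e\<in>N. max 0 (arc_excess {e} w)) \<le> real (card V) / real k + t" if w: "w \<in> V" for w
  proof
    have deg: "real (card {x\<in>V. x \<in> ins G w \<and> f x = f w}) \<le> real (card V) / real k + t"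
      "real (card {x\<in>V. x \<in> outs G w \<and> f x = f w}) \<le> real (card V) / real k + t"
    proof -
      have "real (card (ins G w)) / real k \<le> real (card V) / real k" "real (card (outs G w)) / real
          k \<le> real (card V) / real k"
        using card_mono[OF V insV] card_mono[OF V outsV] by (simp_all add: divide_right_mono)
      then show "real (card {x\<in>V. x \<in> ins G w \<and> f x = f w}) \<le> real (card V) / real k + t"
        "real (card {x\<in>V. x \<in> outs G w \<and> f x = f w}) \<le> real (card V) / real k + t"
        using dev_ins[OF w f[OF w]] dev_outs[OF w f[OF w]] by linarith+
    qed
    have "(\<Sum>e\<in>N. max 0 (- arc_excess {e} w)) \<le> (\<Sum>e\<in>N. of_bool (snd e = w))"
      by (rule sum_mono) (auto simp: exc1 split: prod.splits)
    also have "\<dots> = int (card {e\<in>N. snd e = w})" using finN by (simp add: of_bool_def sum.If_cases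
        Int_def)
    also have "card {e\<in>N. snd e = w} \<le> card {x\<in>V. x \<in> ins G w \<and> f x = f w}"
    proof (rule card_inj_on_le)
      show "inj_on fst {e\<in>N. snd e = w}" by (auto simp: inj_on_def)
      show "fst ` {e\<in>N. snd e = w} \<subseteq> {x\<in>V. x \<in> ins G w \<and> f x = f w}"
        using G by (auto simp: N_def ins_def)
    qed (use V in auto)
    finally have "(\<Sum>e\<in>N. max 0 (- arc_excess {e} w)) \<le> int (card {x\<in>V. x \<in> ins G w \<and> f x = f w})" by
        simp
    then show "real_of_int (\<Sum>e\<in>N. max 0 (- arc_excess {e} w)) \<le> real (card V) / real k + t" using
        deg(1) by linarith
    have "(\<Sum>e\<in>N. max 0 (arc_excess {e} w)) \<le> (\<Sum>e\<in>N. of_bool (fst e = w))"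
      by (rule sum_mono) (auto simp: exc1 split: prod.splits)
    also have "\<dots> = int (card {e\<in>N. fst e = w})" using finN by (simp add: of_bool_def sum.If_cases
        Int_def)
    also have "card {e\<in>N. fst e = w} \<le> card {x\<in>V. x \<in> outs G w \<and> f x = f w}"
    proof (rule card_inj_on_le)
      show "inj_on snd {e\<in>N. fst e = w}" by (auto simp: inj_on_def)
      show "snd ` {e\<in>N. fst e = w} \<subseteq> {x\<in>V. x \<in> outs G w \<and> f x = f w}"
        using G by (auto simp: N_def outs_def)
    qed (use V in auto)
    finally have "(\<Sum>e\<in>N. max 0 (arc_excess {e} w)) \<le> int (card {x\<in>V. x \<in> outs G w \<and> f x = f w})" by simp
    then show "real_of_int (\<Sum>e\<in>N. max 0 (arc_excess {e} w)) \<le> real (card V) / real k + t" using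
        deg(2) by linarith
  qed
  have ends: "card {q\<in>Q. last q = w} \<le> s" if w: "w \<in> V" and ex: "0 \<le> arc_excess G w" for w
  proof -
    have "real_of_int (\<Sum>c<k. max 0 (- arc_excess (H c) w)) \<le> 2 * t * real k + (real (card V) / real
        k + t)"
      unfolding H_def by (rule zigzag_imbalance[OF Z k(2) V G w f dev_outs[OF w] dev_ins[OF w] ex])
    moreover have "int (card {q\<in>Q. last q = w}) \<le> (\<Sum>c<k. max 0 (- arc_excess (H c) w)) + (\<Sum>e\<in>N. max
        0 (- arc_excess {e} w))"
      unfolding last by (rule split)
    ultimately show ?thesis
      by (rule nat_le_of_real_bounds[OF _ _ loc[OF w, THEN conjunct1]]) (use s in \<open>simp add:
          algebra_simps\<close>)
  qed
  have starts: "card {q\<in>Q. hd q = w} \<le> s" if w: "w \<in> V" and ex: "arc_excess G w \<le> 0" for w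
  proof -
    \<comment> \<open>Starts for \<open>G\<close> correspond to ends for its converse, with the same
      colouring and the reversed Hamilton paths.\<close>
    have rev: "arc_excess {e\<in>G\<inverse>. f (fst e) \<noteq> f (snd e) \<and> cls (f (snd e)) (f (fst e)) = c} w = -
        arc_excess (H c) w" for c
    proof -
      have "{e\<in>G\<inverse>. f (fst e) \<noteq> f (snd e) \<and> cls (f (snd e)) (f (fst e)) = c} = (H c)\<inverse>" by (auto simp:
          H_def)
      then show ?thesis by (simp add: arc_excess_converse)
    qed
    have "real_of_int (\<Sum>c<k. max 0 (- arc_excess {e\<in>G\<inverse>. f (fst e) \<noteq> f (snd e) \<and> cls (f (snd e)) (f
        (fst e)) = c} w))
        \<le> 2 * t * real k + (real (card V) / real k + t)"
      by (rule zigzag_imbalance[OF zigzag_reverse[OF Z] k(2) V _ w f])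
        (use G ex dev_outs[OF w] dev_ins[OF w] in \<open>auto simp: arc_excess_converse ins_converse
            outs_converse\<close>)
    then have "real_of_int (\<Sum>c<k. max 0 (arc_excess (H c) w)) \<le> 2 * t * real k + (real (card V) /
        real k + t)"
      unfolding rev by simp
    moreover have "int (card {q\<in>Q. hd q = w}) \<le> (\<Sum>c<k. max 0 (arc_excess (H c) w)) + (\<Sum>e\<in>N. max 0
        (arc_excess {e} w))"
      unfolding hd by (rule split)
    ultimately show ?thesis
      by (rule nat_le_of_real_bounds[OF _ _ loc[OF w, THEN conjunct2]]) (use s in \<open>simp add:
          algebra_simps\<close>)
  qed
  show ?thesis using Q ends starts by (intro exI[of _ Q]) simp
qed

section \<open>Path decompositions of unbalanced tournaments\<close>

text \<open>Vertices above the threshold contribute at most \<open>card V\<close> each to the sum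
  and all others at most \<open>r\<close> each. The latter account for at most one of the six units
  of \<open>r * card V\<close>.\<close>

lemma many_unbalanced:
  assumes V: "finite V" "V \<noteq> {}" and e: "\<And>v. v \<in> V \<Longrightarrow> (e v :: int) \<le> int (card V)"
    and r: "int (6 * r * card V) \<le> (\<Sum>v\<in>V. max 0 (e v))"
  shows "5 * r \<le> card {v\<in>V. int r < e v}"
proof -
  let ?U = "{v\<in>V. int r < e v}"
  have "(\<Sum>v\<in>V. max 0 (e v)) \<le> (\<Sum>v\<in>V. of_bool (int r < e v) * int (card V) + int r)"
  proof (rule sum_mono)
    fix v assume "v \<in> V"
    then show "max 0 (e v) \<le> of_bool (int r < e v) * int (card V) + int r" using e[of v] by auto
  qed
  also have "\<dots> = int (card ?U) * int (card V) + int (card V) * int r"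
    using V by (simp add: sum.distrib of_bool_def sum.If_cases Int_def flip: sum_distrib_right)
  finally have "int (6 * r * card V) \<le> int (card ?U * card V + card V * r)" using r by (simp add:
      algebra_simps)
  then have "6 * r * card V \<le> card ?U * card V + card V * r" by linarith
  then have "(5 * r) * card V \<le> card ?U * card V" by (simp add: algebra_simps)
  then show ?thesis using V by (simp add: card_gt_0_iff)
qed

lemma arc_excess_sum_zero:
  assumes "finite V" "E \<subseteq> V \<times> V"
  shows "(\<Sum>v\<in>V. arc_excess E v) = 0"
proof -
  have "outs E v = {y\<in>V. (v, y) \<in> E}" "ins E v = {x\<in>V. (x, v) \<in> E}" for v
    using assms by (auto simp: outs_def ins_def)
  then have "(\<Sum>v\<in>V. card (outs E v)) = (\<Sum>v\<in>V. card (ins E v))"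
    using sum_card_relation[OF assms(1,1), of "\<lambda>x y. (x, y) \<in> E"] by simp
  then show ?thesis by (simp add: arc_excess_def sum_subtractf flip: of_nat_sum)
qed

text \<open>The point in assembling the parts is that deleting the reserved arcs does not reverse
  the sign of any excess: their paths start and end only at vertices whose excess exceeds
  \<open>r\<close> in absolute value, and fewer than \<open>r\<close> of them meet any given
  vertex.\<close>

lemma tournament_path_decomposition:
  fixes V :: "'a set" and t \<mu> :: real
  assumes T: "tournament_on V E" and V: "V \<noteq> {}" and r: "0 < r" "int (6 * r * card V) \<le> (\<Sum>v\<in>V. max 0
      (arc_excess E v))"
    and h: "card V \<le> h * r"
    and c: "card V * s' * (2 * h + 2) \<le> cap * c" "0 < cap"
    and room: "cap + s' + c + s' * (2 * h + 2) + (h + 1) < r"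
    and k: "even k" "0 < k" and \<mu>: "0 \<le> \<mu>" "\<mu> \<le> 1"
    and t: "4 * real (card V) * real k * exp (\<mu>\<^sup>2 * real (card V)) < exp (\<mu> * t)"
    and s: "2 * t * real k + 2 * (real (card V) / real k + t) \<le> real s"
    and s': "s + 2 * (k + 1) + 2 * (h + 1) < s'"
  shows "\<exists>Q. path_dec E Q \<and> (\<forall>q\<in>Q. 0 \<le> arc_excess E (hd q) \<and> arc_excess E (last q) < 0)"
proof -
  have fin: "finite V" and EV: "E \<subseteq> V \<times> V" using T unfolding tournament_on_def by blast+
  have finE: "finite E" using tournament_on_finite[OF T] .
  have irr: "(x, x) \<notin> E" for x using T unfolding tournament_on_def by blast
  have degs: "arc_excess E v \<le> int (card V)" "- arc_excess E v \<le> int (card V)" for v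
  proof -
    have "outs E v \<subseteq> V" "ins E v \<subseteq> V" using EV by (auto simp: outs_def ins_def)
    then have "card (outs E v) \<le> card V" "card (ins E v) \<le> card V" by (simp_all add: card_mono fin)
    then show "arc_excess E v \<le> int (card V)" "- arc_excess E v \<le> int (card V)" by (simp_all add:
        arc_excess_def)
  qed
  define Up where "Up = {v\<in>V. int r < arc_excess E v}"
  define Um where "Um = {v\<in>V. int r < - arc_excess E v}"
  have cUp: "5 * r \<le> card Up"
    unfolding Up_def by (rule many_unbalanced[OF fin V degs(1) r(2)])
  have "(\<Sum>v\<in>V. max 0 (arc_excess E v)) - (\<Sum>v\<in>V. max 0 (- arc_excess E v)) = (\<Sum>v\<in>V. arc_excess E v)"
    by (subst sum_subtractf[symmetric], rule sum.cong) auto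
  then have "(\<Sum>v\<in>V. max 0 (- arc_excess E v)) = (\<Sum>v\<in>V. max 0 (arc_excess E v))"
    using arc_excess_sum_zero[OF fin EV] by simp
  then have cUm: "5 * r \<le> card Um"
    unfolding Um_def using r(2) by (intro many_unbalanced[OF fin V degs(2)]) simp
  have "\<exists>\<rho>. \<forall>x\<in>V. \<rho> x \<le> h \<and> (\<rho> x = 0 \<longrightarrow> x \<in> Um) \<and>
      (0 < \<rho> x \<longrightarrow> r \<le> card {y\<in>V. (x, y) \<in> E \<and> \<rho> y < \<rho> x})"
    by (rule rank_exists[OF T _ cUm r(1) _ h]) (auto simp: Um_def)
  then obtain \<rho> where \<rho>: "ranking V E r h \<rho>" "\<And>x. x \<in> V \<Longrightarrow> \<rho> x = 0 \<Longrightarrow> x \<in> Um"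
    unfolding ranking_def by blast
  have "\<exists>\<sigma>. \<forall>x\<in>V. \<sigma> x \<le> h \<and> (\<sigma> x = 0 \<longrightarrow> x \<in> Up) \<and>
      (0 < \<sigma> x \<longrightarrow> r \<le> card {y\<in>V. (x, y) \<in> E\<inverse> \<and> \<sigma> y < \<sigma> x})"
    by (rule rank_exists[OF tournament_on_converse[OF T] _ cUp r(1) _ h]) (auto simp: Up_def
        arc_excess_converse)
  then obtain \<sigma> where \<sigma>: "ranking V (E\<inverse>) r h \<sigma>" "\<And>x. x \<in> V \<Longrightarrow> \<sigma> x = 0 \<Longrightarrow> x \<in> Up"
    unfolding ranking_def by blast
  let ?J = "V \<times> {..<s'}"
  from through_paths[OF fin \<rho>(1) \<sigma>(1) c room] obtain a where "\<exists>b. (\<forall>j\<in>?J. through V E \<rho> \<sigma> h (fst j)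
      (a j) (b j)) \<and>
    (\<forall>j\<in>?J. \<forall>j'\<in>?J. j \<noteq> j' \<longrightarrow>
       (path_edges (a j) \<union> path_edges (b j)) \<inter> (path_edges (a j') \<union> path_edges (b j')) = {} \<and>
       (fst j = fst j' \<longrightarrow> (set (a j) \<union> set (b j)) \<inter> (set (a j') \<union> set (b j')) \<subseteq> {fst j})) \<and>
    (\<forall>v. card {j\<in>?J. v \<in> set (a j) \<union> set (b j)} \<le> cap + s')" ..
  then obtain b where ab: "(\<forall>j\<in>?J. through V E \<rho> \<sigma> h (fst j) (a j) (b j)) \<and>
    (\<forall>j\<in>?J. \<forall>j'\<in>?J. j \<noteq> j' \<longrightarrow>
       (path_edges (a j) \<union> path_edges (b j)) \<inter> (path_edges (a j') \<union> path_edges (b j')) = {} \<and>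
       (fst j = fst j' \<longrightarrow> (set (a j) \<union> set (b j)) \<inter> (set (a j') \<union> set (b j')) \<subseteq> {fst j})) \<and>
    (\<forall>v. card {j\<in>?J. v \<in> set (a j) \<union> set (b j)} \<le> cap + s')" ..
  note thr = ab[THEN conjunct1, rule_format]
    and dis = ab[THEN conjunct2, THEN conjunct1, rule_format]
    and load = ab[THEN conjunct2, THEN conjunct2, rule_format]
  define R where "R = (\<Union>j\<in>?J. path_edges (a j) \<union> path_edges (b j))"
  define G where "G = E - R"
  have finJ: "finite ?J" using fin by simp
  have j: "hd (a j) \<in> Up" "last (b j) \<in> Um" "distinct (a j @ tl (b j))" "a j @ tl (b j) \<noteq> []"
    "hd (a j @ tl (b j)) = hd (a j)" "last (a j @ tl (b j)) = last (b j)" "hd (a j) \<in> set (a j)"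
        "last (b j) \<in> set (b j)"
    "path_edges (a j @ tl (b j)) = path_edges (a j) \<union> path_edges (b j)" "path_edges (a j) \<union>
        path_edges (b j) \<subseteq> E"
    if "j \<in> ?J" for j
  proof -
    note t = thr[OF that, unfolded through_def]
    have ne: "a j \<noteq> []" "b j \<noteq> []" and lh: "last (a j) = hd (b j)" using t by auto
    show hl: "hd (a j) \<in> set (a j)" "last (b j) \<in> set (b j)" using ne by auto
    then have "hd (a j) \<in> V" "last (b j) \<in> V" using t by auto
    then show "hd (a j) \<in> Up" "last (b j) \<in> Um" using t by (auto intro: \<rho>(2) \<sigma>(2))
    show "distinct (a j @ tl (b j))" "a j @ tl (b j) \<noteq> []" "hd (a j @ tl (b j)) = hd (a j)"
      "path_edges (a j) \<union> path_edges (b j) \<subseteq> E" using t by auto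
    show "path_edges (a j @ tl (b j)) = path_edges (a j) \<union> path_edges (b j)"
      by (rule path_edges_join[OF ne lh])
    show "last (a j @ tl (b j)) = last (b j)" using ne lh by (cases "b j") auto
  qed
  have RE: "R \<subseteq> E" unfolding R_def using j(10) by blast
  have exR: "arc_excess R w = int (card {j\<in>?J. hd (a j) = w}) - int (card {j\<in>?J. last (b j) = w})" for w
  proof -
    have "arc_excess R w = (\<Sum>j\<in>?J. arc_excess (path_edges (a j) \<union> path_edges (b j)) w)"
      unfolding R_def by (rule arc_excess_UN[OF finJ]) (use dis in auto)
    also have "\<dots> = (\<Sum>j\<in>?J. of_bool (hd (a j) = w) - of_bool (last (b j) = w))"
    proof (rule sum.cong[OF refl])
      fix i assume i: "i \<in> ?J"
      show "arc_excess (path_edges (a i) \<union> path_edges (b i)) w = of_bool (hd (a i) = w) - of_bool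
          (last (b i) = w)"
        using arc_excess_path[OF j(3,4)[OF i], of w] unfolding j(5,6,9)[OF i] .
    qed
    also have "\<dots> = int (card {j\<in>?J. hd (a j) = w}) - int (card {j\<in>?J. last (b j) = w})"
      using finJ by (simp add: sum_subtractf of_bool_def sum.If_cases Int_def)
    finally show ?thesis .
  qed
  have cJ: "card {j\<in>?J. hd (a j) = w} \<le> r" "card {j\<in>?J. last (b j) = w} \<le> r" for w
  proof -
    have "card {j\<in>?J. hd (a j) = w} \<le> card {j\<in>?J. w \<in> set (a j) \<union> set (b j)}"
      by (rule card_mono) (use finJ j(7) in auto)
    then show "card {j\<in>?J. hd (a j) = w} \<le> r" using load[of w] room by linarith
    have "card {j\<in>?J. last (b j) = w} \<le> card {j\<in>?J. w \<in> set (a j) \<union> set (b j)}"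
      by (rule card_mono) (use finJ j(8) in auto)
    then show "card {j\<in>?J. last (b j) = w} \<le> r" using load[of w] room by linarith
  qed
  have exG: "arc_excess G w = arc_excess E w - arc_excess R w" for w
  proof -
    have fR: "finite R" using RE finE finite_subset by blast
    have "outs E w = outs G w \<union> outs R w" "outs G w \<inter> outs R w = {}"
      "ins E w = ins G w \<union> ins R w" "ins G w \<inter> ins R w = {}"
      using RE by (auto simp: G_def outs_def ins_def)
    then have "card (outs E w) = card (outs G w) + card (outs R w)" "card (ins E w) = card (ins G w)
        + card (ins R w)"
      using finE fR by (simp_all add: card_Un_disjoint G_def)
    then show ?thesis by (simp add: arc_excess_def)
  qed
  have GV: "G \<subseteq> V \<times> V" using EV by (auto simp: G_def)
  have none: "{j\<in>?J. hd (a j) = w} = {}" if "arc_excess E w \<le> int r" for w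
    using j(1) that by (force simp: Up_def)
  have none': "{j\<in>?J. last (b j) = w} = {}" if "- int r \<le> arc_excess E w" for w
    using j(2) that by (force simp: Um_def)
  \<comment> \<open>With excess between 0 and \<open>r\<close>, the vertex is no end of a reserved
    path and keeps its excess. With larger excess it loses at most \<open>r\<close>.\<close>
  have posG: "0 \<le> arc_excess G w" if "0 \<le> arc_excess E w" for w
  proof (cases "arc_excess E w \<le> int r")
    case True
    then show ?thesis using exG[of w] exR[of w] that none[OF True] none'[of w] by simp
  next
    case False
    then show ?thesis using exG[of w] exR[of w] cJ(1)[of w] by linarith
  qed
  have negG: "arc_excess G w \<le> 0" if "arc_excess E w < 0" for w
  proof (cases "- int r \<le> arc_excess E w")
    case True
    then show ?thesis using exG[of w] exR[of w] that none[of w] none'[OF True] by simp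
  next
    case False
    then show ?thesis using exG[of w] exR[of w] cJ(2)[of w] by linarith
  qed
  have "\<exists>Q. path_dec G Q \<and> (\<forall>q\<in>Q. length q \<le> k + 1) \<and>
    (\<forall>w\<in>V. (0 \<le> arc_excess G w \<longrightarrow> card {q\<in>Q. last q = w} \<le> s) \<and> (arc_excess G w \<le> 0 \<longrightarrow> card {q\<in>Q. hd q
        = w} \<le> s))"
    by (rule short_path_decomposition[OF fin GV _ k \<mu> t s]) (simp add: G_def irr)
  then obtain Q where Q0: "path_dec G Q \<and> (\<forall>q\<in>Q. length q \<le> k + 1) \<and>
    (\<forall>w\<in>V. (0 \<le> arc_excess G w \<longrightarrow> card {q\<in>Q. last q = w} \<le> s) \<and> (arc_excess G w \<le> 0 \<longrightarrow> card {q\<in>Q. hd q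
        = w} \<le> s))" ..
  note Q = Q0[THEN conjunct1] Q0[THEN conjunct2, THEN conjunct1, rule_format]
    and ends = Q0[THEN conjunct2, THEN conjunct2, rule_format, THEN conjunct1, rule_format]
      Q0[THEN conjunct2, THEN conjunct2, rule_format, THEN conjunct2, rule_format]
  \<comment> \<open>Vertices of excess 0 count as admissible starts. As no path of the result ends
    there, none starts there either.\<close>
  have "\<exists>Q'. path_dec E Q' \<and> (\<forall>q\<in>Q'. 0 \<le> arc_excess E (hd q) \<and> \<not> 0 \<le> arc_excess E (last q))"
  proof (rule crossing[OF fin EV thr dis _ _ _ Q _ _ s'])
    show "G = E - (\<Union>j\<in>?J. path_edges (a j) \<union> path_edges (b j))" by (simp add: G_def R_def)
    show "0 \<le> arc_excess E x" if "x \<in> V" "\<sigma> x = 0" for x using \<sigma>(2)[OF that] by (simp add: Up_def)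
    show "\<not> 0 \<le> arc_excess E x" if "x \<in> V" "\<rho> x = 0" for x using \<rho>(2)[OF that] by (simp add: Um_def)
    show "0 \<le> arc_excess G w \<and> card {q\<in>Q. last q = w} \<le> s" if "w \<in> V" "0 \<le> arc_excess E w" for w
      using ends(1)[OF that(1)] posG[OF that(2)] by simp
    show "arc_excess G w \<le> 0 \<and> card {q\<in>Q. hd q = w} \<le> s" if "w \<in> V" "\<not> 0 \<le> arc_excess E w" for w
      using ends(2)[OF that(1)] negG[of w] that(2) by simp
  qed
  then show ?thesis by (simp add: not_le)
qed

section \<open>Choice of parameters\<close>

text \<open>With \<open>r\<close>, \<open>cap\<close>, \<open>c\<close> of order
  \<open>n powr (17/18)\<close>, \<open>h\<close> of order \<open>n powr (1/18)\<close>,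
  \<open>s'\<close> of order \<open>n powr (29/36)\<close>, \<open>k\<close> of order
  \<open>n powr (2/9)\<close> and \<open>t = n powr (5/9)\<close>, both \<open>t * k\<close> and
  \<open>n / k\<close> have exponent 28/36, just below that of \<open>s'\<close>. The product
  \<open>n * s' * h\<close> has exponent 67/36, just below the 68/36 of
  \<open>cap * c\<close>.\<close>

lemma parameters_exist:
  "\<exists>n0. \<forall>n>n0. \<exists>r h s' cap c k s. \<exists>\<mu> t :: real.
    0 < r \<and> real (6 * r * n) \<le> real n powr (2 - 1 / 18) \<and> n \<le> h * r \<and>
    n * s' * (2 * h + 2) \<le> cap * c \<and> 0 < cap \<and> cap + s' + c + s' * (2 * h + 2) + (h + 1) < r \<and>
    even k \<and> 0 < k \<and> 0 \<le> \<mu> \<and> \<mu> \<le> 1 \<and>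
    4 * real n * real k * exp (\<mu>\<^sup>2 * real n) < exp (\<mu> * t) \<and>
    2 * t * real k + 2 * (real n / real k + t) \<le> real s \<and>
    s + 2 * (k + 1) + 2 * (h + 1) < (s' :: nat)"
proof -
  \<comment> \<open>Real inequalities with the rounding losses built in: the pairs 6 and 7, or 40
    and 41, bound an integer part from above and below. The bound \<open>y \<le> 2 * (y - 1)\<close>
    keeps twice the integer part of \<open>y\<close> between \<open>y\<close> and
    \<open>2 * y\<close>.\<close>
  have "\<forall>\<^sub>F x :: real in at_top.
    1 \<le> x \<and> (1 < x powr (17/18) / 7 \<and> x powr (17/18) / 7 \<le> x powr (17/18) / 6 - 1) \<and>
    x / (x powr (17/18) / 7) + 1 \<le> 8 * x powr (1/18) \<and>
    x powr (29/36) / 2 \<le> x powr (29/36) - 1 \<and>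
    (1 < x powr (17/18) / 41 \<and> x powr (17/18) / 41 \<le> x powr (17/18) / 40 - 1) \<and>
    x * x powr (29/36) * (2 * (8 * x powr (1/18)) + 2) \<le> (x powr (17/18) / 41) * (x powr (17/18) / 41) \<and>
    x powr (17/18) / 40 + x powr (29/36) + x powr (17/18) / 40 +
      x powr (29/36) * (2 * (8 * x powr (1/18)) + 2) + (8 * x powr (1/18) + 1) < x powr (17/18) / 7 \<and>
    (1 < x powr (2/9) \<and> x powr (2/9) \<le> 2 * (x powr (2/9) - 1)) \<and>
    x powr (5/9) / (2 * x) \<le> 1 \<and>
    ln (8 * x * x powr (2/9)) < x powr (1/9) / 4 \<and>
    2 * x powr (5/9) * (2 * x powr (2/9)) + 2 * (x / x powr (2/9) + x powr (5/9)) \<le> x powr (29/36) /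
        4 - 1 \<and>
    x powr (29/36) / 4 + 2 * (2 * x powr (2/9) + 1) + 2 * (8 * x powr (1/18) + 1) < x powr (29/36) / 2"
    (is "eventually ?P _")
    by (intro eventually_conj; real_asymp)
  then have "\<forall>\<^sub>F n in sequentially. ?P (real n)"
    by (rule eventually_compose_filterlim) (rule filterlim_real_sequentially)
  then obtain n0 where n0: "\<And>n. n0 \<le> n \<Longrightarrow> ?P (real n)"
    unfolding eventually_sequentially by blast
  show ?thesis
  proof (rule exI[of _ n0], intro allI impI)
    fix n assume "n0 < n"
    then have "?P (real n)" using n0[of n] by simp
    note P = this
    define x where "x = real n"
    define R where "R = x powr (17/18)"
    define q where "q = x powr (1/18)"
    define w where "w = x powr (29/36)"
    define y where "y = x powr (2/9)"
    define t where "t = x powr (5/9)"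
    have P: "1 \<le> x" "1 < R / 7" "R / 7 \<le> R / 6 - 1" "x / (R / 7) + 1 \<le> 8 * q" "w / 2 \<le> w - 1"
      "1 < R / 41" "R / 41 \<le> R / 40 - 1" "x * w * (2 * (8 * q) + 2) \<le> (R / 41) * (R / 41)"
      "R / 40 + w + R / 40 + w * (2 * (8 * q) + 2) + (8 * q + 1) < R / 7"
      "1 < y" "y \<le> 2 * (y - 1)" "t / (2 * x) \<le> 1"
      "ln (8 * x * y) < x powr (1/9) / 4"
      "2 * t * (2 * y) + 2 * (x / y + t) \<le> w / 4 - 1"
      "w / 4 + 2 * (2 * y + 1) + 2 * (8 * q + 1) < w / 2"
      using P unfolding R_def q_def w_def y_def t_def x_def by simp_all
    have t0: "0 \<le> t" and w0: "0 \<le> w" and q0: "0 \<le> q" by (simp_all add: t_def w_def q_def)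
    have tt: "t * t = x * x powr (1/9)"
    proof -
      have "t * t = x powr (1 + 1/9)" unfolding t_def by (simp flip: powr_add)
      also have "\<dots> = x powr 1 * x powr (1/9)" by (rule powr_add)
      finally show ?thesis using P(1) by simp
    qed
    have fl: "real (nat \<lfloor>z\<rfloor>) \<le> z \<and> z - 1 \<le> real (nat \<lfloor>z\<rfloor>)" if "0 \<le> z" for z :: real
      using that by linarith
    define r where "r = nat \<lfloor>R / 6\<rfloor>"
    define h where "h = nat \<lceil>x / real r\<rceil>"
    define s' where "s' = nat \<lfloor>w\<rfloor>"
    define c where "c = nat \<lfloor>R / 40\<rfloor>"
    define m where "m = nat \<lfloor>y\<rfloor>"
    define s where "s = nat \<lfloor>w / 4\<rfloor>"
    have r: "real r \<le> R / 6" "R / 7 \<le> real r" using fl[of "R / 6"] P(2,3) unfolding r_def by linarith+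
    have c: "real c \<le> R / 40" "R / 41 \<le> real c" using fl[of "R / 40"] P(6,7) unfolding c_def by
        linarith+
    have s': "real s' \<le> w" "w / 2 \<le> real s'" using fl[of w] P(5) w0 unfolding s'_def by linarith+
    have m: "real m \<le> y" "y - 1 \<le> real m" using fl[of y] P(10) unfolding m_def by linarith+
    have s: "real s \<le> w / 4" "w / 4 - 1 \<le> real s" using fl[of "w / 4"] w0 unfolding s_def by linarith+
    have r0: "0 < real r" using r P(2) by linarith
    have xr: "0 \<le> x / real r" using P(1) by simp
    have h: "x / real r \<le> real h" "real h \<le> x / real r + 1" using xr unfolding h_def by linarith+
    have "x / real r \<le> x / (R / 7)" using r P(1,2) by (intro divide_left_mono) (auto intro!:
        mult_pos_pos r0)
    then have hq: "real h \<le> 8 * q" using h P(4) by linarith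
    have n: "real n = x" by (simp add: x_def)
    have k: "y \<le> real (2 * m)" "real (2 * m) \<le> 2 * y" using m P(11) by simp_all
    have bound: "real s' * (2 * real h + 2) \<le> w * (2 * (8 * q) + 2)"
      using s' hq w0 by (intro mult_mono) auto
    show "\<exists>r h s' cap c k s. \<exists>\<mu> t :: real.
      0 < r \<and> real (6 * r * n) \<le> real n powr (2 - 1 / 18) \<and> n \<le> h * r \<and>
      n * s' * (2 * h + 2) \<le> cap * c \<and> 0 < cap \<and> cap + s' + c + s' * (2 * h + 2) + (h + 1) < r \<and>
      even k \<and> 0 < k \<and> 0 \<le> \<mu> \<and> \<mu> \<le> 1 \<and>
      4 * real n * real k * exp (\<mu>\<^sup>2 * real n) < exp (\<mu> * t) \<and>
      2 * t * real k + 2 * (real n / real k + t) \<le> real s \<and>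
      s + 2 * (k + 1) + 2 * (h + 1) < s'"
    \<comment> \<open>The witnesses are fixed by the goals that follow: \<open>c\<close> serves for
      both \<open>cap\<close> and \<open>c\<close>, \<open>2 * m\<close> is the even
      \<open>k\<close>, and \<open>t / (2 * x)\<close> is \<open>\<mu>\<close>.\<close>
    proof (intro exI conjI)
      show "0 < r" using r0 by simp
      have "real (6 * r * n) = (6 * real r) * x" by (simp add: n)
      also have "\<dots> \<le> R * x" using r P(1) by (intro mult_right_mono) auto
      also have "R * x = x powr (17/18) * x powr 1" using P(1) by (simp add: R_def)
      also have "\<dots> = x powr (17/18 + 1)" by (rule powr_add[symmetric])
      also have "\<dots> = x powr (2 - 1 / 18)" by simp
      finally show "real (6 * r * n) \<le> real n powr (2 - 1 / 18)" by (simp add: n)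
      have "x \<le> real h * real r" using h(1) r0 by (simp add: field_simps)
      then have "real n \<le> real (h * r)" by (simp add: n)
      then show "n \<le> h * r" by (simp only: of_nat_le_iff)
      have "real (n * s' * (2 * h + 2)) = x * (real s' * (2 * real h + 2))" by (simp add: n
          algebra_simps)
      also have "\<dots> \<le> x * (w * (2 * (8 * q) + 2))" using bound P(1) by (intro mult_left_mono) auto
      also have "\<dots> \<le> (R / 41) * (R / 41)" using P(8) by (simp add: mult.assoc)
      also have "\<dots> \<le> real c * real c" using c P(6) by (intro mult_mono) auto
      finally have "real (n * s' * (2 * h + 2)) \<le> real (c * c)" by simp
      then show "n * s' * (2 * h + 2) \<le> c * c" by (simp only: of_nat_le_iff)
      show "0 < c" using c P(6) by simp
      have "real (c + s' + c + s' * (2 * h + 2) + (h + 1)) = real c + real s' + real c + real s' *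
          (2 * real h + 2) + (real h + 1)"
        by (simp add: algebra_simps)
      also have "\<dots> < real r" using c s' bound hq P(9) r by linarith
      finally show "c + s' + c + s' * (2 * h + 2) + (h + 1) < r" by (simp only: of_nat_less_iff)
      show "even (2 * m)" by simp
      show "0 < 2 * m" using k P(10) by simp
      \<comment> \<open>This \<open>\<mu>\<close> minimises
        \<open>\<mu> ^ 2 * x - \<mu> * t\<close>. The minimum is
        \<open>- (x powr (1/9)) / 4\<close>, a power of \<open>x\<close>, so it outweighs the
        logarithm of the polynomial factor.\<close>
      show "0 \<le> t / (2 * x)" using t0 P(1) by simp
      show "t / (2 * x) \<le> 1" by (rule P)
      have "4 * x * real (2 * m) * exp (x powr (1/9) / 4) \<le> 4 * x * (2 * y) * exp (x powr (1/9) / 4)"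
        using k P(1) by (intro mult_right_mono mult_left_mono) auto
      also have "4 * x * (2 * y) = exp (ln (8 * x * y))" using P(1,10) by simp
      also have "exp (ln (8 * x * y)) * exp (x powr (1/9) / 4) < exp (x powr (1/9) / 2)"
        using P(13) by (simp flip: exp_add)
      also have "x powr (1/9) / 2 = t / (2 * x) * t" using tt P(1) by (simp add: field_simps)
      finally have "4 * x * real (2 * m) * exp (x powr (1/9) / 4) < exp (t / (2 * x) * t)" .
      moreover have "(t / (2 * x))\<^sup>2 * x = x powr (1/9) / 4"
        using tt P(1) by (simp add: field_simps power2_eq_square)
      ultimately show "4 * real n * real (2 * m) * exp ((t / (2 * x))\<^sup>2 * real n) < exp (t / (2 * x)
          * t)"
        by (simp only: n)
      have "2 * t * K + 2 * (x / K + t) \<le> real s" if K: "y \<le> K" "K \<le> 2 * y" for K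
      proof -
        have "2 * t * K + 2 * (x / K + t) \<le> 2 * t * (2 * y) + 2 * (x / y + t)"
          using K t0 P(1,10) by (intro add_mono mult_left_mono divide_left_mono order_refl) auto
        also have "\<dots> \<le> w / 4 - 1" by (rule P)
        also have "\<dots> \<le> real s" by (rule s)
        finally show ?thesis .
      qed
      from this[OF k] show "2 * t * real (2 * m) + 2 * (real n / real (2 * m) + t) \<le> real s"
        by (simp only: n)
      have "real (s + 2 * (2 * m + 1) + 2 * (h + 1)) = real s + 2 * (real (2 * m) + 1) + 2 * (real h
          + 1)" by simp
      also have "\<dots> \<le> w / 4 + 2 * (2 * y + 1) + 2 * (8 * q + 1)"
        by (intro add_mono mult_left_mono order_refl s k hq) simp_all
      also have "\<dots> < w / 2" by (rule P)
      also have "\<dots> \<le> real s'" by (rule s')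
      finally show "s + 2 * (2 * m + 1) + 2 * (h + 1) < s'" by (simp only: of_nat_less_iff)
    qed
  qed
qed

section \<open>Path numbers of digraphs\<close>

lemma arc_excess_eq_vertex_excess:
  assumes "digraph D"
  shows "arc_excess (arcs_ends D) v = vertex_excess D v"
proof -
  interpret digraph D by fact
  have inj: "inj_on (arc_to_ends D) (arcs D)" by (rule inj_onI) (rule no_multi_arcs)
  have "bij_betw (head D) (out_arcs D v) (outs (arcs_ends D) v)"
  proof (rule bij_betwI')
    fix e e' assume "e \<in> out_arcs D v" "e' \<in> out_arcs D v"
    then show "head D e = head D e' \<longleftrightarrow> e = e'"
      using inj by (auto simp: inj_on_def arc_to_ends_def)
  qed (auto simp: outs_def arcs_ends_def arc_to_ends_def)
  moreover have "bij_betw (tail D) (in_arcs D v) (ins (arcs_ends D) v)"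
  proof (rule bij_betwI')
    fix e e' assume "e \<in> in_arcs D v" "e' \<in> in_arcs D v"
    then show "tail D e = tail D e' \<longleftrightarrow> e = e'"
      using inj by (auto simp: inj_on_def arc_to_ends_def)
  qed (auto simp: ins_def arcs_ends_def arc_to_ends_def)
  ultimately show ?thesis
    by (simp add: arc_excess_def vertex_excess_def out_degree_def in_degree_def bij_betw_same_card)
qed

lemma tournament_tournament_on:
  assumes "tournament D"
  shows "tournament_on (verts D) (arcs_ends D)"
proof -
  interpret tournament D by fact
  show ?thesis
    unfolding tournament_on_def
  proof (intro conjI allI ballI impI)
    show "finite (verts D)" by (rule finite_verts)
    show "arcs_ends D \<subseteq> verts D \<times> verts D" by (auto simp: arcs_ends_def arc_to_ends_def)
    show "(v, v) \<notin> arcs_ends D" for v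
      using no_loops by (auto simp: arcs_ends_def arc_to_ends_def)
    show "(u, v) \<in> arcs_ends D \<longleftrightarrow> (v, u) \<notin> arcs_ends D" if "u \<in> verts D" "v \<in> verts D" "u \<noteq> v" for u v
      using one_orientation[OF that] .
  qed
qed

section \<open>Passage between arc lists and vertex lists\<close>

lemma (in wf_digraph) path_edges_awalk_verts:
  "cas u p v \<Longrightarrow> p \<noteq> [] \<Longrightarrow> path_edges (awalk_verts u p) = arc_to_ends G ` set p"
proof (induction p arbitrary: u)
  case (Cons e p)
  then show ?case by (cases p) (auto simp: arc_to_ends_def)
qed simp

lemma (in digraph) apath_of_vertices:
  assumes "distinct q" "2 \<le> length q" "path_edges q \<subseteq> arcs_ends G"
    and g: "\<And>x. x \<in> arcs_ends G \<Longrightarrow> g x \<in> arcs G \<and> arc_to_ends G (g x) = x"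
  shows "apath (hd q) (map g (zip q (tl q))) (last q)"
proof -
  have walk: "q \<noteq> [] \<Longrightarrow> set q \<subseteq> verts G \<Longrightarrow> path_edges q \<subseteq> arcs_ends G \<Longrightarrow> awalk_verts (hd q) (map g (zip
      q (tl q))) = q \<and>
      cas (hd q) (map g (zip q (tl q))) (last q) \<and> set (map g (zip q (tl q))) \<subseteq> arcs G"
    for q
  proof (induction q rule: induct_list012)
    case (3 x y zs)
    have "tail G (g (x, y)) = x" "head G (g (x, y)) = y" "g (x, y) \<in> arcs G"
      using g[of "(x, y)"] 3(4,5) by (auto simp: arc_to_ends_def)
    then show ?case using 3 by simp
  qed auto
  have sv: "set q \<subseteq> verts G"
  proof
    fix x assume "x \<in> set q"
    then obtain y where "(x, y) \<in> path_edges q \<or> (y, x) \<in> path_edges q"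
      using path_edges_covers assms(2) by metis
    then show "x \<in> verts G" using assms(3) by (auto simp: arcs_ends_def arc_to_ends_def)
  qed
  have "q \<noteq> []" using assms(2) by auto
  note w = walk[OF this sv assms(3)]
  show ?thesis unfolding apath_def
  proof
    show "awalk (hd q) (map g (zip q (tl q))) (last q)" by (rule awalkI) (use w sv in simp_all)
    show "distinct (awalk_verts (hd q) (map g (zip q (tl q))))" using w assms(1) by simp
  qed
qed

section \<open>Counting the paths of a decomposition by their starts\<close>

lemma path_dec_card:
  assumes Q: "path_dec E Q" and V: "finite V" "E \<subseteq> V \<times> V"
  shows "card Q = (\<Sum>v\<in>V. card {q\<in>Q. hd q = v})"
proof -
  have "finite Q" using Q by (simp add: path_dec_def)
  have "hd q \<in> V" if "q \<in> Q" for q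
  proof -
    have "simple_path q" using Q that by (simp add: path_dec_def)
    then show ?thesis using path_dec_verts[OF Q V(2) that] simple_path_ne[of q] hd_in_set[of q] by blast
  qed
  then have "Q = (\<Union>v\<in>V. {q\<in>Q. hd q = v})" by auto
  then have "card Q = card (\<Union>v\<in>V. {q\<in>Q. hd q = v})" by (rule arg_cong)
  also have "\<dots> = (\<Sum>v\<in>V. card {q\<in>Q. hd q = v})"
    by (rule card_UN_disjoint) (use V \<open>finite Q\<close> in auto)
  finally show ?thesis .
qed

lemma path_dec_card_ge:
  assumes Q: "path_dec E Q" and V: "finite V" "E \<subseteq> V \<times> V"
  shows "(\<Sum>v\<in>V. max 0 (arc_excess E v)) \<le> int (card Q)"
  unfolding path_dec_card[OF assms] of_nat_sum
  by (rule sum_mono) (use path_dec_arc_excess[OF Q] in simp)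

text \<open>At a vertex of nonnegative excess no path ends, so exactly its excess many start. At a
  vertex of negative excess none starts.\<close>

lemma path_dec_card_eq:
  assumes Q: "path_dec E Q" and V: "finite V" "E \<subseteq> V \<times> V"
    and ends: "\<forall>q\<in>Q. 0 \<le> arc_excess E (hd q) \<and> arc_excess E (last q) < 0"
  shows "int (card Q) = (\<Sum>v\<in>V. max 0 (arc_excess E v))"
  unfolding path_dec_card[OF Q V] of_nat_sum
proof (rule sum.cong[OF refl])
  fix v
  show "int (card {q\<in>Q. hd q = v}) = max 0 (arc_excess E v)"
  proof (cases "0 \<le> arc_excess E v")
    case True
    then have no: "{q\<in>Q. last q = v} = {}" using ends by auto
    show ?thesis using path_dec_arc_excess[OF Q, of v] True unfolding no by simp
  next
    case False
    then have "{q\<in>Q. hd q = v} = {}" using ends by auto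
    then have "card {q\<in>Q. hd q = v} = 0" by (simp only: card.empty)
    then show ?thesis using False by simp
  qed
qed

lemma (in digraph) path_dec_of_path_decomposition:
  assumes P: "path_decomposition G P"
  shows "\<exists>Q. path_dec (arcs_ends G) Q \<and> card Q = card P"
proof -
  have inj: "inj_on (arc_to_ends G) (arcs G)" by (rule inj_onI) (rule no_multi_arcs)
  have part: "partition_on (arcs G) (set ` P)" and finP: "finite P" and injP: "inj_on set P"
    and ap: "\<And>p. p \<in> P \<Longrightarrow> \<exists>u v. apath u p v"
    using P by (auto simp: path_decomposition_def)
  have ne: "p \<noteq> []" and sub: "set p \<subseteq> arcs G" if "p \<in> P" for p
    using part that by (auto simp: partition_on_def)
  have disj: "set p \<inter> set p' = {}" if "p \<in> P" "p' \<in> P" "p \<noteq> p'" for p p'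
  proof -
    have "set p \<noteq> set p'" using injP that by (auto simp: inj_on_def)
    then show ?thesis using part that by (auto simp: partition_on_def disjoint_def)
  qed
  \<comment> \<open>The first argument of \<open>awalk_verts\<close> matters only for the empty
    list, and parts of a partition are nonempty. One formula thus serves paths with different
    starts.\<close>
  define W where "W p = awalk_verts undefined p" for p
  have W: "simple_path (W p)" "path_edges (W p) = arc_to_ends G ` set p" if p: "p \<in> P" for p
  proof -
    obtain u v where uv: "apath u p v" using ap[OF p] by blast
    have e: "W p = awalk_verts u p" unfolding W_def by (rule awalk_verts_ne_eq[OF ne[OF p]])
    have "0 < length p" using ne[OF p] by simp
    then have "2 \<le> length (W p)" by (simp add: e length_awalk_verts Suc_le_eq)
    then show "simple_path (W p)" using uv by (simp add: simple_path_def e apath_def)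
    have "cas u p v" using uv by (simp add: apath_def awalk_def)
    then show "path_edges (W p) = arc_to_ends G ` set p"
      unfolding e by (rule path_edges_awalk_verts) (rule ne[OF p])
  qed
  have Wd: "path_edges (W p) \<inter> path_edges (W p') = {}" if "p \<in> P" "p' \<in> P" "p \<noteq> p'" for p p'
    unfolding W(2)[OF that(1)] W(2)[OF that(2)]
    using inj_on_image_Int[OF inj sub[OF that(1)] sub[OF that(2)]] disj[OF that] by simp
  have "path_dec (arcs_ends G) (W ` P)"
  proof (rule path_dec_UN[OF finP W(1) Wd])
    have "(\<Union>p\<in>P. path_edges (W p)) = arc_to_ends G ` (\<Union>p\<in>P. set p)" using W(2) by auto
    also have "(\<Union>p\<in>P. set p) = arcs G" using part by (simp add: partition_on_def)
    finally show "(\<Union>p\<in>P. path_edges (W p)) = arcs_ends G" by (simp add: arcs_ends_def)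
  qed
  moreover have "inj_on W P"
  proof (rule inj_onI, rule ccontr)
    fix p p' assume p: "p \<in> P" "p' \<in> P" "W p = W p'" "p \<noteq> p'"
    have "path_edges (W p) \<noteq> {}" using W(1)[OF p(1)] by (auto simp: simple_path_def intro!:
        path_edges_nonempty)
    then show False using Wd[OF p(1,2,4)] p(3) by simp
  qed
  ultimately show ?thesis using card_image by blast
qed

lemma (in digraph) path_decomposition_of_path_dec:
  assumes Q: "path_dec (arcs_ends G) Q"
  shows "\<exists>P. path_decomposition G P \<and> card P = card Q"
proof -
  have inj: "inj_on (arc_to_ends G) (arcs G)" by (rule inj_onI) (rule no_multi_arcs)
  \<comment> \<open>Without parallel arcs an arc is determined by its ends, so \<open>g\<close>
    recovers it.\<close>
  define g where "g = the_inv_into (arcs G) (arc_to_ends G)"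
  have g: "g x \<in> arcs G \<and> arc_to_ends G (g x) = x" if "x \<in> arcs_ends G" for x
    using that the_inv_into_into[OF inj, of x "arcs G"] f_the_inv_into_f[OF inj, of x]
    by (auto simp: arcs_ends_def g_def)
  have g_arc: "g (arc_to_ends G e) = e" if "e \<in> arcs G" for e
    unfolding g_def by (rule the_inv_into_f_f[OF inj that])
  define A where "A q = map g (zip q (tl q))" for q
  have setA: "set (A q) = g ` path_edges q" for q by (simp add: A_def path_edges_def)
  have dp: "simple_path q" and sub: "path_edges q \<subseteq> arcs_ends G" if "q \<in> Q" for q
    using Q that by (auto simp: path_dec_def)
  have ap: "apath (hd q) (A q) (last q)" if "q \<in> Q" for q
    unfolding A_def using dp[OF that] sub[OF that] g by (intro apath_of_vertices) (auto simp:
        simple_path_def)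
  have ne: "set (A q) \<noteq> {}" if "q \<in> Q" for q
    using dp[OF that] path_edges_nonempty[of q] by (simp add: setA simple_path_def)
  have injg: "inj_on g (arcs_ends G)" using g by (metis inj_onI)
  have disj: "set (A q) \<inter> set (A q') = {}" if "q \<in> Q" "q' \<in> Q" "q \<noteq> q'" for q q'
  proof -
    have "path_edges q \<inter> path_edges q' = {}" using Q that by (simp add: path_dec_def)
    then show ?thesis unfolding setA
      using inj_on_image_Int[OF injg sub[OF that(1)] sub[OF that(2)]] by simp
  qed
  have injset: "inj_on (\<lambda>q. set (A q)) Q"
  proof (rule inj_onI, rule ccontr)
    fix q q' assume q: "q \<in> Q" "q' \<in> Q" "set (A q) = set (A q')" "q \<noteq> q'"
    then show False using disj[OF q(1,2,4)] ne[OF q(1)] by simp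
  qed
  have UN: "(\<Union>q\<in>Q. set (A q)) = arcs G"
  proof -
    have "(\<Union>q\<in>Q. set (A q)) = g ` (\<Union>q\<in>Q. path_edges q)" by (auto simp: setA)
    also have "(\<Union>q\<in>Q. path_edges q) = arc_to_ends G ` arcs G" using Q by (simp add: path_dec_def
        arcs_ends_def)
    also have "g ` arc_to_ends G ` arcs G = arcs G" using g_arc by (force simp: image_image)
    finally show ?thesis .
  qed
  have "path_decomposition G (A ` Q)"
    unfolding path_decomposition_def
  proof (intro conjI)
    show "finite (A ` Q)" using Q by (simp add: path_dec_def)
    show "\<forall>p\<in>A ` Q. \<exists>u v. apath u p v" using ap by blast
    show "inj_on set (A ` Q)" using injset by (auto simp: inj_on_def)
    show "partition_on (arcs G) (set ` A ` Q)"
      unfolding image_image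
    proof (rule partition_onI)
      show "\<Union> ((\<lambda>q. set (A q)) ` Q) = arcs G" by (rule UN)
      show "disjnt p p'" if "p \<in> (\<lambda>q. set (A q)) ` Q" "p' \<in> (\<lambda>q. set (A q)) ` Q" "p \<noteq> p'" for p p'
      proof -
        from that(1,2) obtain q q' where "q \<in> Q" "q' \<in> Q" "p = set (A q)" "p' = set (A q')" by blast
        moreover then have "q \<noteq> q'" using that(3) by auto
        ultimately show ?thesis using disj[of q q'] by (simp add: disjnt_def)
      qed
      show "{} \<notin> (\<lambda>q. set (A q)) ` Q" using ne by force
    qed
  qed
  moreover have "inj_on A Q" using injset by (auto simp: inj_on_def)
  ultimately show ?thesis using card_image by blast
qed

lemma path_number_eq_excess:
  assumes T: "tournament D"
    and Q: "path_dec (arcs_ends D) Q" "\<forall>q\<in>Q. 0 \<le> arc_excess (arcs_ends D) (hd q) \<and> arc_excess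
        (arcs_ends D) (last q) < 0"
  shows "int (path_number D) = excess D"
proof -
  interpret tournament D by fact
  have tn: "tournament_on (verts D) (arcs_ends D)" by (rule tournament_tournament_on[OF T])
  then have V: "finite (verts D)" "arcs_ends D \<subseteq> verts D \<times> verts D" unfolding tournament_on_def by
      blast+
  have ex: "excess D = (\<Sum>v\<in>verts D. max 0 (arc_excess (arcs_ends D) v))"
    by (simp add: excess_def pos_vertex_excess_def arc_excess_eq_vertex_excess[OF digraph_axioms]
        max.commute)
  obtain P where "path_decomposition D P" "card P = card Q" using path_decomposition_of_path_dec[OF
      Q(1)] by blast
  then have "path_number D \<le> card Q" unfolding path_number_def by (metis (mono_tags, lifting) Least_le)
  then have "int (path_number D) \<le> excess D" using path_dec_card_eq[OF Q(1) V Q(2)] ex by simp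
  moreover obtain P' where "path_decomposition D P'" "card P' = path_number D" using
      path_number_attained by blast
  then obtain Q' where "path_dec (arcs_ends D) Q'" "card Q' = path_number D" using
      path_dec_of_path_decomposition by metis
  then have "excess D \<le> int (path_number D)" using path_dec_card_ge[OF _ V] ex by metis
  ultimately show ?thesis by simp
qed

theorem theorem1p6:
  shows "\<exists>\<epsilon>::real. \<epsilon> > 0 \<and> \<epsilon> = 1 / 18 \<and>
    (\<exists>n\<^sub>0::nat. \<forall>(T :: ('a, 'b) pre_digraph) n.
       tournament T \<and> card (verts T) = n \<and> n > n\<^sub>0 \<and> even n \<and>
       real_of_int (excess T) \<ge> real n powr (2 - \<epsilon>)
       \<longrightarrow> int (path_number T) = excess T)"
proof -
  obtain n0 where n0: "\<forall>n>n0. \<exists>r h s' cap c k s. \<exists>\<mu> t :: real.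
    0 < r \<and> real (6 * r * n) \<le> real n powr (2 - 1 / 18) \<and> n \<le> h * r \<and>
    n * s' * (2 * h + 2) \<le> cap * c \<and> 0 < cap \<and> cap + s' + c + s' * (2 * h + 2) + (h + 1) < r \<and>
    even k \<and> 0 < k \<and> 0 \<le> \<mu> \<and> \<mu> \<le> 1 \<and>
    4 * real n * real k * exp (\<mu>\<^sup>2 * real n) < exp (\<mu> * t) \<and>
    2 * t * real k + 2 * (real n / real k + t) \<le> real s \<and>
    s + 2 * (k + 1) + 2 * (h + 1) < (s' :: nat)"
    using parameters_exist by (elim exE)
  have "int (path_number T) = excess T"
    if T: "tournament T" and n: "card (verts T) > n0"
      and ex: "real (card (verts T)) powr (2 - 1 / 18) \<le> real_of_int (excess T)"
    for T :: "('a, 'b) pre_digraph"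
  proof -
    interpret tournament T by (rule T)
    let ?V = "verts T" and ?E = "arcs_ends T"
    obtain r h s' cap c k s and \<mu> t :: real where *: "0 < r" "real (6 * r * card ?V) \<le> real (card
        ?V) powr (2 - 1 / 18)"
      "card ?V \<le> h * r" "card ?V * s' * (2 * h + 2) \<le> cap * c" "0 < cap"
      "cap + s' + c + s' * (2 * h + 2) + (h + 1) < r" "even k" "0 < k" "0 \<le> \<mu>" "\<mu> \<le> 1"
      "4 * real (card ?V) * real k * exp (\<mu>\<^sup>2 * real (card ?V)) < exp (\<mu> * t)"
      "2 * t * real k + 2 * (real (card ?V) / real k + t) \<le> real s"
      "s + 2 * (k + 1) + 2 * (h + 1) < s'"
      using n0[rule_format, OF n] by (elim exE conjE)
    have "excess T = (\<Sum>v\<in>?V. max 0 (arc_excess ?E v))"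
      by (simp add: excess_def pos_vertex_excess_def arc_excess_eq_vertex_excess[OF digraph_axioms]
          max.commute)
    moreover have "real (6 * r * card ?V) \<le> real_of_int (excess T)" using *(2) ex by (rule order_trans)
    ultimately have big: "int (6 * r * card ?V) \<le> (\<Sum>v\<in>?V. max 0 (arc_excess ?E v))" by linarith
    have "?V \<noteq> {}" using n by auto
    from tournament_path_decomposition[OF tournament_tournament_on[OF T] this *(1) big *(3-13)]
    obtain Q where "path_dec ?E Q \<and> (\<forall>q\<in>Q. 0 \<le> arc_excess ?E (hd q) \<and> arc_excess ?E (last q) < 0)" ..
    then show ?thesis using path_number_eq_excess[OF T] by blast
  qed
  then show ?thesis by (intro exI[of _ "1 / 18"] conjI exI[of _ n0]) auto
qed

end
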